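(* Let $(\mathcal A,(\mathcal A_t)_{t\ge0},\mathbb E_{\mathcal A})$, $(\mathcal B,(\mathcal B_t)_{t\ge0},\mathbb E_{\mathcal B})$, $(\mathcal C,(\mathcal C_t)_{t\ge0},\mathbb E_{\mathcal C})$ be filtered $\mathrm C^*$-probability spaces. Fix an $L^2$-decomposable process $X=X(0)+M+A:\mathbb R_+\to L^2(\mathbb E_{\mathcal A})$ (with martingale part $M$ and FV part $A$), a stochastically $X$-integrable process $H\in\mathcal I^{\mathcal B}(X)$, and a strongly measurable map $K:\mathbb R_+\to B(L^2(\mathbb E_{\mathcal B});L^2(\mathbb E_{\mathcal C}))$. Write $Y_H:=\int_0^\cdot H[dX]$. If there exists a sequence $(K_n)_{n\in\mathbb N}$ in $\mathrm{EP}^{2;2}(\mathbb E_{\mathcal B};\mathbb E_{\mathcal C})$ such that $$\int_{(0,t]}\|K_n-K\|_{2;2}^2\|H\|_{2;2}^2\,d\kappa_M+\int_{(0,t]}\|K_n-K\|_{2;2}\|H\|_{2;2}\,d\kappa_A\xrightarrow{n\to\infty}0\qquad(t\ge0),$$ then $K\in\mathcal I^{\mathcal C}(Y_H)$, $KH\in\mathcal I^{\mathcal C}(X)$, and $$\int_0^\cdot K[dY_H]=\int_0^\cdot KH[dX].$$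
   Context: A $\mathrm C^*$-probability space $(\mathcal A,\mathbb E)$ is a unital $\mathrm C^*$-algebra with a faithful tracial state. $\|a\|_p=\mathbb E[|a|^p]^{1/p}$, and $L^p(\mathcal A,\mathbb E)=L^p(\mathbb E)$ is the $\|\cdot\|_p$-completion of $\mathcal A$ ($1\le p<\infty$). A filtration is an increasing family $(\mathcal A_t)_{t\ge0}$ of unital norm-closed $*$-subalgebras; $\mathbb E[a\mid\mathcal N]\in L^1(\mathcal N,\mathbb E)$ is the trace-preserving conditional expectation ($\mathbb E[b_0\mathbb E[a\mid\mathcal N]]=\mathbb E[b_0a]$ for $b_0\in\mathcal N$). Linear means real-linear; $B(V;W)$ is the space of bounded linear maps, and $\|\cdot\|_{2;2}$ is the operator norm $L^2\to L^2$. $X:\mathbb R_+\to L^2(\mathbb E)$ is $L^2$-decomposable if it is adapted ($X(t)\in L^2(\mathcal A_t,\mathbb E)$) and $X=X(0)+M+A$ with $M$ an $L^2$-continuous $L^2$-martingale ($\mathbb E[M(t)\mid\mathcal A_s]=M(s)$ for $s\le t$, adapted), $A$ adapted, $L^2$-continuous and of locally bounded $\|\cdot\|_2$-variation, and $M(0)=A(0)=0$; the decomposition is unique. $\kappa_M$ is the Borel measure on $\mathbb R_+$ with $\kappa_M(\{0\})=0$, $\kappa_M((s,t])=\|M(t)-M(s)\|_2^2$; $\kappa_A$ is the Borel measure with $\kappa_A(\{0\})=0$ and $\kappa_A((s,t])$ equal to the $\|\cdot\|_2$-variation of $A$ on $[s,t]$; $\kappa_X=\kappa_M+\kappa_A$.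 $\mathcal F_t^{2;2}(\mathbb E_{\mathcal A};\mathbb E_{\mathcal B})$ is the set of $T\in B(L^2(\mathbb E_{\mathcal A});L^2(\mathbb E_{\mathcal B}))$ with $\mathbb E_{\mathcal B}[Tx\mid\mathcal B_u]=T\,\mathbb E_{\mathcal A}[x\mid\mathcal A_u]$ for all $u\ge t$, $x\in L^2(\mathbb E_{\mathcal A})$. $\mathrm{EP}^{2;2}(\mathbb E_{\mathcal A};\mathbb E_{\mathcal B})$ is the set of maps $H=1_{\{0\}}H_0+\sum_{i=1}^k1_{(s_i,t_i]}H_i$ with $0\le s_i\le t_i$, $H_0\in\mathcal F_0^{2;2}$, $H_i\in\mathcal F_{s_i}^{2;2}$; for such $H$, $\int_0^tH[dX]:=\sum_iH_i[X(t_i\wedge t)-X(s_i\wedge t)]$. (Similarly for other pairs of spaces.) $\mathcal L_X^{\mathcal B}$ is the Fréchet space of $H\in L^1_{\mathrm{loc}}(\mathbb R_+,\kappa_X;B(L^2(\mathbb E_{\mathcal A});L^2(\mathbb E_{\mathcal B})))$ (strongly measurable, modulo $\kappa_X$-a.e. equality) with $\|H\|_{X,t}=\big(\int_{(0,t]}\|H\|_{2;2}^2d\kappa_M\big)^{1/2}+\int_{(0,t]}\|H\|_{2;2}\,d\kappa_A<\infty$ for all $t\ge0$, with these seminorms. $\mathcal I^{\mathcal B}(X)$ (stochastically $X$-integrable processes) is the closure in $\mathcal L^{\mathcal B}_X$ of the classes of elements of $\mathrm{EP}^{2;2}(\mathbb E_{\mathcal A};\mathbb E_{\mathcal B})$.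 The integral extends uniquely to a continuous linear map $H\mapsto\int_0^\cdot H[dX]$ from $\mathcal I^{\mathcal B}(X)$ to the $L^2$-continuous adapted processes $\mathbb R_+\to L^2(\mathbb E_{\mathcal B})$ (uniform $L^2$-convergence on compacts), with $\|\int_0^tH[dX]\|_2\le\|H\|_{X,t}$; and $\int_0^\cdot H[dX]$ is again $L^2$-decomposable. *)

theory Defs
  imports "HOL-Analysis.Analysis"
begin

section \<open>C*-probability spaces\<close>

class cstar_algebra = real_normed_algebra_1 + banach +
  fixes scaleC :: "complex \<Rightarrow> 'a \<Rightarrow> 'a"
    and adj :: "'a \<Rightarrow> 'a"
  assumes scaleC_add_right: "scaleC c (x + y) = scaleC c x + scaleC c y"
    and scaleC_add_left: "scaleC (c + d) x = scaleC c x + scaleC d x"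
    and scaleC_scaleC: "scaleC c (scaleC d x) = scaleC (c * d) x"
    and scaleC_of_real: "scaleC (complex_of_real r) x = scaleR r x"
    and scaleC_mult_left: "scaleC c x * y = scaleC c (x * y)"
    and scaleC_mult_right: "x * scaleC c y = scaleC c (x * y)"
    and norm_scaleC: "norm (scaleC c x) = cmod c * norm x"
    and adj_adj: "adj (adj x) = x"
    and adj_add: "adj (x + y) = adj x + adj y"
    and adj_scaleC: "adj (scaleC c x) = scaleC (cnj c) (adj x)"
    and adj_mult: "adj (x * y) = adj y * adj x"
    and norm_adj_mult_self: "norm (adj x * x) = (norm x)\<^sup>2"

class cstar_prob_space = cstar_algebra +
  fixes expec :: "'a \<Rightarrow> complex"
  assumes expec_add: "expec (x + y) = expec x + expec y"
    and expec_scaleC: "expec (scaleC c x) = c * expec x"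
    and expec_one: "expec 1 = 1"
    and expec_positive: "expec (adj x * x) \<in> \<real>\<^sub>\<ge>\<^sub>0"
    and expec_faithful: "expec (adj x * x) = 0 \<Longrightarrow> x = 0"
    and expec_tracial: "expec (x * y) = expec (y * x)"

lemma scaleC_neg_one: "scaleC (-1) x = - (x::'a::cstar_algebra)"
  using scaleC_of_real[of "-1" x] by simp

lemma scaleC_zero_left: "scaleC 0 x = (0::'a::cstar_algebra)"
  using scaleC_of_real[of 0 x] by simp

lemma adj_zero: "adj (0::'a::cstar_algebra) = 0"
  using adj_add[of 0 "0::'a"] by simp

lemma adj_minus: "adj (- x) = - adj (x::'a::cstar_algebra)"
  using adj_scaleC[of "-1" x] by (simp add: scaleC_neg_one)

lemma adj_diff: "adj (x - y) = adj x - adj (y::'a::cstar_algebra)"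
  using adj_add[of x "- y"] by (simp add: adj_minus)

lemma adj_scaleR: "adj (scaleR r x) = scaleR r (adj (x::'a::cstar_algebra))"
  using adj_scaleC[of "complex_of_real r" x] by (simp add: scaleC_of_real)

lemma expec_scaleR: "expec (scaleR r x) = of_real r * expec (x::'a::cstar_prob_space)"
  using expec_scaleC[of "complex_of_real r" x] by (simp add: scaleC_of_real)

lemma expec_zero: "expec (0::'a::cstar_prob_space) = 0"
  using expec_add[of 0 "0::'a"] by simp

lemma expec_diff: "expec (x - y) = expec x - expec (y::'a::cstar_prob_space)"
  using expec_add[of "x - y" y] by simp

lemma expec_adj_mult_self:
  "expec (adj x * x) = of_real (Re (expec (adj x * (x::'a::cstar_prob_space))))"
  using expec_positive[of x] by (metis Reals_cases complex_nonneg_Reals_iff complex_is_Real_iff Re_complex_of_real)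

lemma Re_expec_adj_commute:
  "Re (expec (adj x * y)) = Re (expec (adj y * (x::'a::cstar_prob_space)))"
proof -
  let ?z = "x + scaleC \<i> y"
  have "Im (expec (adj ?z * ?z)) = 0"
    using expec_positive[of ?z] by (simp add: complex_nonneg_Reals_iff)
  moreover have "expec (adj ?z * ?z) =
      expec (adj x * x) + \<i> * expec (adj x * y) - \<i> * expec (adj y * x) + expec (adj y * y)"
    by (simp add: adj_add adj_scaleC algebra_simps scaleC_mult_left scaleC_mult_right
        expec_add expec_scaleC)
  moreover have "Im (expec (adj x * x)) = 0" "Im (expec (adj y * y)) = 0"
    using expec_positive[of x] expec_positive[of y] by (simp_all add: complex_nonneg_Reals_iff)
  ultimately show ?thesis by simp
qed

section \<open>The Hilbert space \<open>L\<^sup>2\<close> of a C*-probability space\<close>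

text \<open>A copy of the algebra carrying \<open>\<parallel>a\<parallel>\<^sub>2 = E[\<bar>a\<bar>\<^sup>2]\<^bsup>1/2\<^esup> = E[a\<^sup>* a]\<^bsup>1/2\<^esup>\<close> instead of the C*-norm.
  As all linearity is real-linearity, only the real part of \<open>(a, b) \<mapsto> E[a\<^sup>* b]\<close> is kept as
  inner product.\<close>

typedef (overloaded) 'a pre_L2 = "UNIV :: 'a::cstar_prob_space set"
  morphisms of_pre_L2 to_pre_L2 ..

setup_lifting type_definition_pre_L2

instantiation pre_L2 :: (cstar_prob_space) real_inner
begin

lift_definition zero_pre_L2 :: "'a pre_L2" is 0 .
lift_definition plus_pre_L2 :: "'a pre_L2 \<Rightarrow> 'a pre_L2 \<Rightarrow> 'a pre_L2" is "(+)" .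
lift_definition minus_pre_L2 :: "'a pre_L2 \<Rightarrow> 'a pre_L2 \<Rightarrow> 'a pre_L2" is "(-)" .
lift_definition uminus_pre_L2 :: "'a pre_L2 \<Rightarrow> 'a pre_L2" is uminus .
lift_definition scaleR_pre_L2 :: "real \<Rightarrow> 'a pre_L2 \<Rightarrow> 'a pre_L2" is scaleR .
lift_definition inner_pre_L2 :: "'a pre_L2 \<Rightarrow> 'a pre_L2 \<Rightarrow> real"
  is "\<lambda>a b. Re (expec (adj a * b))" .
lift_definition norm_pre_L2 :: "'a pre_L2 \<Rightarrow> real"
  is "\<lambda>a. sqrt (Re (expec (adj a * a)))" .

definition dist_pre_L2 :: "'a pre_L2 \<Rightarrow> 'a pre_L2 \<Rightarrow> real"
  where "dist_pre_L2 x y = norm (x - y)"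
definition sgn_pre_L2 :: "'a pre_L2 \<Rightarrow> 'a pre_L2"
  where "sgn_pre_L2 x = inverse (norm x) *\<^sub>R x"
definition uniformity_pre_L2 :: "('a pre_L2 \<times> 'a pre_L2) filter"
  where "uniformity_pre_L2 = (INF e\<in>{0<..}. principal {(x, y). dist x y < e})"
definition open_pre_L2 :: "'a pre_L2 set \<Rightarrow> bool"
  where "open_pre_L2 U \<longleftrightarrow> (\<forall>x\<in>U. \<forall>\<^sub>F (x', y) in uniformity. x' = x \<longrightarrow> y \<in> U)"

instance
proof
  fix x y z :: "'a pre_L2" and r s :: real
  show "x + y + z = x + (y + z)" by transfer (simp add: add.assoc)
  show "x + y = y + x" by transfer (simp add: add.commute)
  show "0 + x = x" by transfer simp
  show "- x + x = 0" by transfer simp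
  show "x - y = x + - y" by transfer simp
  show "r *\<^sub>R (x + y) = r *\<^sub>R x + r *\<^sub>R y" by transfer (simp add: scaleR_add_right)
  show "(r + s) *\<^sub>R x = r *\<^sub>R x + s *\<^sub>R x" by transfer (simp add: scaleR_add_left)
  show "r *\<^sub>R s *\<^sub>R x = (r * s) *\<^sub>R x" by transfer simp
  show "1 *\<^sub>R x = x" by transfer simp
  show "dist x y = norm (x - y)" by (rule dist_pre_L2_def)
  show "sgn x = inverse (norm x) *\<^sub>R x" by (rule sgn_pre_L2_def)
  show "uniformity = (INF e\<in>{0<..}. principal {(x, y :: 'a pre_L2). dist x y < e})"
    by (rule uniformity_pre_L2_def)
  show "open U \<longleftrightarrow> (\<forall>x\<in>U. \<forall>\<^sub>F (x', y) in uniformity. x' = x \<longrightarrow> y \<in> U)" for U :: "'a pre_L2 set"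
    by (rule open_pre_L2_def)
  show "inner x y = inner y x" by transfer (rule Re_expec_adj_commute)
  show "inner (x + y) z = inner x z + inner y z"
    by transfer (simp add: adj_add distrib_right expec_add)
  show "inner (r *\<^sub>R x) y = r * inner x y"
    by transfer (simp add: adj_scaleR expec_scaleR)
  show "0 \<le> inner x x"
    by transfer (use expec_positive in \<open>auto simp: complex_nonneg_Reals_iff\<close>)
  show "inner x x = 0 \<longleftrightarrow> x = 0"
    by transfer (metis expec_adj_mult_self expec_faithful expec_zero mult_zero_right of_real_0 zero_complex.sel(1))
  show "norm x = sqrt (inner x x)" by transfer simp
qed

end

text \<open>The completion of an inner product space, as Cauchy sequences modulo null sequences.\<close>

quotient_type (overloaded) 'a completion_space = "nat \<Rightarrow> 'a::real_inner" / partial: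
  "\<lambda>X Y. Cauchy X \<and> Cauchy Y \<and> (\<lambda>n. X n - Y n) \<longlonglongrightarrow> 0"
proof (rule part_equivpI)
  show "\<exists>X::nat \<Rightarrow> 'a. Cauchy X \<and> Cauchy X \<and> (\<lambda>n. X n - X n) \<longlonglongrightarrow> 0"
    by (rule exI[of _ "\<lambda>_. 0"]) (auto intro: convergent_Cauchy convergent_const)
  show "symp (\<lambda>X Y::nat \<Rightarrow> 'a. Cauchy X \<and> Cauchy Y \<and> (\<lambda>n. X n - Y n) \<longlonglongrightarrow> 0)"
    by (rule sympI) (auto dest: tendsto_minus)
  show "transp (\<lambda>X Y::nat \<Rightarrow> 'a. Cauchy X \<and> Cauchy Y \<and> (\<lambda>n. X n - Y n) \<longlonglongrightarrow> 0)"
  proof (rule transpI, clarify)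
    fix X Y Z :: "nat \<Rightarrow> 'a"
    assume "(\<lambda>n. X n - Y n) \<longlonglongrightarrow> 0" "(\<lambda>n. Y n - Z n) \<longlonglongrightarrow> 0"
    from tendsto_add[OF this] show "(\<lambda>n. X n - Z n) \<longlonglongrightarrow> 0" by simp
  qed
qed

lemma Cauchy_inner_convergent:
  fixes X Y :: "nat \<Rightarrow> 'a::real_inner"
  assumes X: "Cauchy X" and Y: "Cauchy Y"
  shows "convergent (\<lambda>n. X n \<bullet> Y n)"
proof -
  obtain a where a: "a > 0" "\<And>n. norm (X n) \<le> a"
    using Cauchy_Bseq[OF X] by (auto simp: Bseq_def)
  obtain b where b: "b > 0" "\<And>n. norm (Y n) \<le> b"
    using Cauchy_Bseq[OF Y] by (auto simp: Bseq_def)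
  have "Cauchy (\<lambda>n. X n \<bullet> Y n)"
  proof (rule CauchyI)
    fix e :: real assume e: "e > 0"
    obtain N1 where N1: "\<And>m n. m \<ge> N1 \<Longrightarrow> n \<ge> N1 \<Longrightarrow> norm (X m - X n) < e / (2 * b)"
      using CauchyD[OF X, of "e / (2 * b)"] e b by auto
    obtain N2 where N2: "\<And>m n. m \<ge> N2 \<Longrightarrow> n \<ge> N2 \<Longrightarrow> norm (Y m - Y n) < e / (2 * a)"
      using CauchyD[OF Y, of "e / (2 * a)"] e a by auto
    have "norm (X m \<bullet> Y m - X n \<bullet> Y n) < e" if "m \<ge> max N1 N2" "n \<ge> max N1 N2" for m n
    proof -
      have "X m \<bullet> Y m - X n \<bullet> Y n = (X m - X n) \<bullet> Y m + X n \<bullet> (Y m - Y n)"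
        by (simp add: inner_diff_left inner_diff_right)
      also have "norm \<dots> \<le> norm (X m - X n) * norm (Y m) + norm (X n) * norm (Y m - Y n)"
        by (rule order_trans[OF norm_triangle_ineq]) (auto intro: add_mono Cauchy_Schwarz_ineq2)
      also have "\<dots> \<le> norm (X m - X n) * b + a * norm (Y m - Y n)"
        by (intro add_mono mult_left_mono mult_right_mono a b) auto
      also have "\<dots> < e / (2 * b) * b + a * (e / (2 * a))"
        using N1[of m n] N2[of m n] that a b
        by (intro add_strict_mono mult_strict_right_mono mult_strict_left_mono) auto
      also have "\<dots> = e" using a b by simp
      finally show ?thesis .
    qed
    then show "\<exists>N. \<forall>m\<ge>N. \<forall>n\<ge>N. norm (X m \<bullet> Y m - X n \<bullet> Y n) < e" by blast
  qed
  then show ?thesis by (simp add: Cauchy_convergent_iff)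
qed

lemma Cauchy_inner_lim_cong:
  fixes X X' Y Y' :: "nat \<Rightarrow> 'a::real_inner"
  assumes "Cauchy X" "Cauchy X'" "(\<lambda>n. X n - X' n) \<longlonglongrightarrow> 0"
    and "Cauchy Y" "Cauchy Y'" "(\<lambda>n. Y n - Y' n) \<longlonglongrightarrow> 0"
  shows "lim (\<lambda>n. X n \<bullet> Y n) = lim (\<lambda>n. X' n \<bullet> Y' n)"
proof -
  have bdd: "Bfun Y sequentially" "Bfun X' sequentially"
    using assms Cauchy_Bseq by blast+
  have 1: "(\<lambda>n. (X n - X' n) \<bullet> Y n) \<longlonglongrightarrow> 0"
    using bounded_bilinear.Zfun_prod_Bfun[OF bounded_bilinear_inner _ bdd(1), of "\<lambda>n. X n - X' n"] assms(3)
    by (simp add: tendsto_Zfun_iff)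
  have 2: "(\<lambda>n. X' n \<bullet> (Y n - Y' n)) \<longlonglongrightarrow> 0"
    using bounded_bilinear.Bfun_prod_Zfun[OF bounded_bilinear_inner bdd(2), of "\<lambda>n. Y n - Y' n"] assms(6)
    by (simp add: tendsto_Zfun_iff)
  have "(\<lambda>n. X n \<bullet> Y n - X' n \<bullet> Y' n) \<longlonglongrightarrow> 0"
    using tendsto_add[OF 1 2] by (simp add: inner_diff_left inner_diff_right)
  moreover obtain l where l: "(\<lambda>n. X' n \<bullet> Y' n) \<longlonglongrightarrow> l"
    using Cauchy_inner_convergent[OF assms(2,5)] by (auto simp: convergent_def)
  ultimately have "(\<lambda>n. X n \<bullet> Y n) \<longlonglongrightarrow> l"
    using tendsto_add by fastforce
  with l show ?thesis by (simp add: limI)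
qed

lemma Cauchy_scaleR_seq:
  fixes X :: "nat \<Rightarrow> 'a::real_normed_vector"
  shows "Cauchy X \<Longrightarrow> Cauchy (\<lambda>n. r *\<^sub>R X n)"
  by (rule bounded_linear.Cauchy[OF bounded_linear_scaleR_right])

lemma Cauchy_plus_seq:
  fixes X Y :: "nat \<Rightarrow> 'a::real_normed_vector"
  assumes "Cauchy X" "Cauchy Y"
  shows "Cauchy (\<lambda>n. X n + Y n)"
proof (rule CauchyI)
  fix e :: real assume e: "e > 0"
  obtain N1 where N1: "\<And>m n. m \<ge> N1 \<Longrightarrow> n \<ge> N1 \<Longrightarrow> norm (X m - X n) < e / 2"
    using CauchyD[OF assms(1), of "e / 2"] e by auto
  obtain N2 where N2: "\<And>m n. m \<ge> N2 \<Longrightarrow> n \<ge> N2 \<Longrightarrow> norm (Y m - Y n) < e / 2"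
    using CauchyD[OF assms(2), of "e / 2"] e by auto
  have "norm (X m + Y m - (X n + Y n)) < e" if "m \<ge> max N1 N2" "n \<ge> max N1 N2" for m n
    using norm_triangle_ineq[of "X m - X n" "Y m - Y n"] N1[of m n] N2[of m n] that
    by (simp add: algebra_simps)
  then show "\<exists>N. \<forall>m\<ge>N. \<forall>n\<ge>N. norm (X m + Y m - (X n + Y n)) < e" by blast
qed

instantiation completion_space :: (real_inner) real_inner
begin

lift_definition zero_completion_space :: "'a completion_space" is "\<lambda>_. 0"
  by (auto intro: convergent_Cauchy convergent_const)
lift_definition plus_completion_space ::
  "'a completion_space \<Rightarrow> 'a completion_space \<Rightarrow> 'a completion_space"
  is "\<lambda>X Y n. X n + Y n"
  by (auto intro: Cauchy_plus_seq simp: add_diff_add intro: tendsto_add_zero)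
lift_definition scaleR_completion_space ::
  "real \<Rightarrow> 'a completion_space \<Rightarrow> 'a completion_space"
  is "\<lambda>r X n. r *\<^sub>R X n"
  by (auto intro: Cauchy_scaleR_seq simp flip: scaleR_diff_right intro: tendsto_scaleR[OF tendsto_const, of _ 0, simplified])
lift_definition inner_completion_space ::
  "'a completion_space \<Rightarrow> 'a completion_space \<Rightarrow> real"
  is "\<lambda>X Y. lim (\<lambda>n. X n \<bullet> Y n)"
  by (auto intro: Cauchy_inner_lim_cong)

definition uminus_completion_space :: "'a completion_space \<Rightarrow> 'a completion_space"
  where "uminus_completion_space x = (-1) *\<^sub>R x"
definition minus_completion_space ::
  "'a completion_space \<Rightarrow> 'a completion_space \<Rightarrow> 'a completion_space"
  where "minus_completion_space x y = x + - y"
definition norm_completion_space :: "'a completion_space \<Rightarrow> real"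
  where "norm_completion_space x = sqrt (inner x x)"
definition dist_completion_space :: "'a completion_space \<Rightarrow> 'a completion_space \<Rightarrow> real"
  where "dist_completion_space x y = norm (x - y)"
definition sgn_completion_space :: "'a completion_space \<Rightarrow> 'a completion_space"
  where "sgn_completion_space x = inverse (norm x) *\<^sub>R x"
definition uniformity_completion_space :: "('a completion_space \<times> 'a completion_space) filter"
  where "uniformity_completion_space = (INF e\<in>{0<..}. principal {(x, y). dist x y < e})"
definition open_completion_space :: "'a completion_space set \<Rightarrow> bool"
  where "open_completion_space U \<longleftrightarrow> (\<forall>x\<in>U. \<forall>\<^sub>F (x', y) in uniformity. x' = x \<longrightarrow> y \<in> U)"

instance
proof
  fix x y z :: "'a completion_space" and r s :: real
  have lim_inner: "(\<lambda>n. X n \<bullet> Y n) \<longlonglongrightarrow> lim (\<lambda>n. X n \<bullet> Y n)"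
    if "Cauchy X" "Cauchy Y" for X Y :: "nat \<Rightarrow> 'a"
    using Cauchy_inner_convergent[OF that] by (simp add: convergent_LIMSEQ_iff)
  show "x + y + z = x + (y + z)"
    by transfer (auto intro: Cauchy_plus_seq simp: add.assoc)
  show "x + y = y + x"
    by transfer (auto intro: Cauchy_plus_seq simp: add.commute)
  show "0 + x = x" by transfer auto
  show "- x + x = 0"
    unfolding uminus_completion_space_def
    by transfer (auto intro: Cauchy_plus_seq Cauchy_scaleR_seq convergent_Cauchy convergent_const)
  show "x - y = x + - y" by (rule minus_completion_space_def)
  show "r *\<^sub>R (x + y) = r *\<^sub>R x + r *\<^sub>R y"
    by transfer (auto intro!: Cauchy_plus_seq Cauchy_scaleR_seq simp: scaleR_add_right)
  show "(r + s) *\<^sub>R x = r *\<^sub>R x + s *\<^sub>R x"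
    by transfer (auto intro!: Cauchy_plus_seq Cauchy_scaleR_seq simp: scaleR_add_left)
  show "r *\<^sub>R s *\<^sub>R x = (r * s) *\<^sub>R x"
    by transfer (auto intro!: Cauchy_scaleR_seq)
  show "1 *\<^sub>R x = x" by transfer auto
  show "dist x y = norm (x - y)" by (rule dist_completion_space_def)
  show "sgn x = inverse (norm x) *\<^sub>R x" by (rule sgn_completion_space_def)
  show "uniformity = (INF e\<in>{0<..}. principal {(x, y :: 'a completion_space). dist x y < e})"
    by (rule uniformity_completion_space_def)
  show "open U \<longleftrightarrow> (\<forall>x\<in>U. \<forall>\<^sub>F (x', y) in uniformity. x' = x \<longrightarrow> y \<in> U)"
    for U :: "'a completion_space set"
    by (rule open_completion_space_def)
  show "inner x y = inner y x" by transfer (simp add: inner_commute)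
  show "inner (x + y) z = inner x z + inner y z"
    by transfer (auto intro!: limI tendsto_add lim_inner simp: inner_add_left)
  show "inner (r *\<^sub>R x) y = r * inner x y"
    by transfer (auto intro!: limI tendsto_mult lim_inner)
  show "0 \<le> inner x x"
    by transfer (auto intro!: LIMSEQ_le_const[OF lim_inner])
  show "inner x x = 0 \<longleftrightarrow> x = 0"
  proof transfer
    fix X :: "nat \<Rightarrow> 'a"
    assume X: "Cauchy X \<and> Cauchy X \<and> (\<lambda>n. X n - X n) \<longlonglongrightarrow> 0"
    have "X \<longlonglongrightarrow> 0" if "lim (\<lambda>n. X n \<bullet> X n) = 0"
    proof -
      have "(\<lambda>n. X n \<bullet> X n) \<longlonglongrightarrow> 0" using lim_inner[of X X] X that by simp
      from tendsto_real_sqrt[OF this] show ?thesis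
        by (simp add: norm_eq_sqrt_inner[symmetric] tendsto_norm_zero_iff)
    qed
    moreover have "lim (\<lambda>n. X n \<bullet> X n) = 0" if "X \<longlonglongrightarrow> 0"
      using tendsto_inner[OF that that] by (auto intro: limI)
    ultimately show "lim (\<lambda>n. X n \<bullet> X n) = 0 \<longleftrightarrow>
        Cauchy X \<and> Cauchy (\<lambda>_. 0::'a) \<and> (\<lambda>n. X n - 0) \<longlonglongrightarrow> 0"
      using X by (auto intro: convergent_Cauchy convergent_const)
  qed
  show "norm x = sqrt (inner x x)" by (rule norm_completion_space_def)
qed

end

lift_definition to_completion :: "'a::real_inner \<Rightarrow> 'a completion_space" is "\<lambda>a _. a"
  by (auto intro: convergent_Cauchy convergent_const)

lemma to_completion_add: "to_completion (a + b) = to_completion a + to_completion b"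
  by transfer (auto intro: convergent_Cauchy convergent_const)

lemma to_completion_scaleR: "to_completion (r *\<^sub>R a) = r *\<^sub>R to_completion a"
  by transfer (auto intro: convergent_Cauchy convergent_const)

lemma to_completion_diff: "to_completion (a - b) = to_completion a - to_completion b"
  using to_completion_add[of "a - b" b] by (simp add: algebra_simps)

lemma inner_to_completion: "to_completion a \<bullet> to_completion b = a \<bullet> b"
  by transfer (auto intro: limI)

lemma norm_to_completion: "norm (to_completion a) = norm a"
  by (simp add: norm_eq_sqrt_inner inner_to_completion)

lemma to_completion_tendsto_abs:
  assumes X: "Cauchy X"
  shows "(\<lambda>k. to_completion (X k)) \<longlonglongrightarrow> abs_completion_space X"
proof (rule LIMSEQ_I)
  fix e :: real assume e: "e > 0"
  obtain N where N: "\<And>m n. m \<ge> N \<Longrightarrow> n \<ge> N \<Longrightarrow> norm (X m - X n) < e / 2"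
    using CauchyD[OF X, of "e / 2"] e by auto
  have "norm (to_completion (X k) - abs_completion_space X) < e" if k: "k \<ge> N" for k
  proof -
    have C: "Cauchy (\<lambda>n. X k + (-1) *\<^sub>R X n)"
      by (intro Cauchy_plus_seq Cauchy_scaleR_seq X convergent_Cauchy convergent_const)
    have eq: "to_completion (X k) - abs_completion_space X
        = abs_completion_space (\<lambda>n. X k + (-1) *\<^sub>R X n)"
    proof -
      have "(-1) *\<^sub>R abs_completion_space X = abs_completion_space (\<lambda>n. (-1) *\<^sub>R X n)"
        by (rule scaleR_completion_space.abs_eq) (simp add: X)
      moreover have "abs_completion_space (\<lambda>_. X k) + abs_completion_space (\<lambda>n. (-1) *\<^sub>R X n)
          = abs_completion_space (\<lambda>n. X k + (-1) *\<^sub>R X n)"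
        using Cauchy_scaleR_seq[OF X, of "-1"]
        by (intro plus_completion_space.abs_eq) (simp_all add: convergent_Cauchy convergent_const)
      ultimately show ?thesis
        unfolding minus_completion_space_def uminus_completion_space_def to_completion.abs_eq
        by (simp only:)
    qed
    let ?D = "\<lambda>n. X k + (-1) *\<^sub>R X n"
    have "(\<lambda>n. ?D n \<bullet> ?D n) \<longlonglongrightarrow> lim (\<lambda>n. ?D n \<bullet> ?D n)"
      using Cauchy_inner_convergent[OF C C] by (simp add: convergent_LIMSEQ_iff)
    moreover have "\<forall>n\<ge>N. ?D n \<bullet> ?D n \<le> (e / 2)\<^sup>2"
    proof (intro allI impI)
      fix n assume "n \<ge> N"
      then have "norm (?D n) \<le> e / 2" using N[OF k, of n] by simp
      then show "?D n \<bullet> ?D n \<le> (e / 2)\<^sup>2"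
        unfolding power2_norm_eq_inner[symmetric] by (intro power_mono) auto
    qed
    ultimately have "lim (\<lambda>n. ?D n \<bullet> ?D n) \<le> (e / 2)\<^sup>2"
      using LIMSEQ_le_const2 by blast
    then have "norm (to_completion (X k) - abs_completion_space X) \<le> e / 2"
      using e C real_sqrt_le_mono[of "lim (\<lambda>n. ?D n \<bullet> ?D n)" "(e / 2)\<^sup>2"]
      unfolding eq norm_eq_sqrt_inner
      by (subst inner_completion_space.abs_eq) simp_all
    then show ?thesis using e by simp
  qed
  then show "\<exists>N. \<forall>k\<ge>N. norm (to_completion (X k) - abs_completion_space X) < e" by blast
qed

lemma to_completion_approx:
  assumes "e > 0"
  shows "\<exists>a. norm (to_completion a - x) < e"
proof -
  obtain X where X: "Cauchy X" "x = abs_completion_space X"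
    by (induct x rule: completion_space.abs_induct) auto
  from LIMSEQ_D[OF to_completion_tendsto_abs[OF X(1)] assms] X(2) show ?thesis by auto
qed

instance completion_space :: (real_inner) banach
proof
  fix x :: "nat \<Rightarrow> 'a completion_space"
  assume x: "Cauchy x"
  have "\<exists>a. norm (to_completion a - x n) < inverse (real (Suc n))" for n
    by (rule to_completion_approx) simp
  then obtain a where a: "\<And>n. norm (to_completion (a n) - x n) < inverse (real (Suc n))"
    by metis
  have "(\<lambda>n. norm (to_completion (a n) - x n)) \<longlonglongrightarrow> 0"
    by (rule tendsto_sandwich[OF _ _ tendsto_const LIMSEQ_inverse_real_of_nat])
      (use a in \<open>auto intro!: always_eventually less_imp_le simp del: of_nat_Suc\<close>)
  then have diff: "(\<lambda>n. to_completion (a n) - x n) \<longlonglongrightarrow> 0"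
    by (rule tendsto_norm_zero_cancel)
  have "Cauchy (\<lambda>n. (to_completion (a n) - x n) + x n)"
    by (intro Cauchy_plus_seq x) (use diff in \<open>auto intro: LIMSEQ_imp_Cauchy\<close>)
  then have "Cauchy (\<lambda>n. to_completion (a n))" by simp
  then have "Cauchy a"
    by (simp add: Cauchy_iff to_completion_diff[symmetric] norm_to_completion)
  from to_completion_tendsto_abs[OF this]
  have "(\<lambda>n. to_completion (a n) - (to_completion (a n) - x n)) \<longlonglongrightarrow> abs_completion_space a - 0"
    by (intro tendsto_diff diff)
  then show "convergent x" by (auto simp: convergent_def)
qed

type_synonym 'a L2 = "'a pre_L2 completion_space"

definition to_L2 :: "'a::cstar_prob_space \<Rightarrow> 'a L2"
  where "to_L2 a = to_completion (to_pre_L2 a)"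

definition L2_of :: "'a::cstar_prob_space set \<Rightarrow> 'a L2 set"
  where "L2_of N = closure (to_L2 ` N)"

section \<open>Conditional expectations, filtrations, decomposable processes\<close>

text \<open>\<open>E[b x]\<close> for \<open>b\<close> in the algebra and \<open>x\<close> in \<open>L\<^sup>2\<close>, by \<open>L\<^sup>2\<close>-continuity in \<open>x\<close>.\<close>

definition expec_mult :: "'a::cstar_prob_space \<Rightarrow> 'a L2 \<Rightarrow> complex"
  where "expec_mult b x =
    (THE z. \<forall>a. (\<lambda>n. to_L2 (a n)) \<longlonglongrightarrow> x \<longrightarrow> (\<lambda>n. expec (b * a n)) \<longlonglongrightarrow> z)"

lemma Re_expec_mult_eq_inner: "Re (expec (b * a)) = to_L2 (adj b) \<bullet> to_L2 a"
  unfolding to_L2_def inner_to_completion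
  by (simp add: inner_pre_L2.rep_eq to_pre_L2_inverse adj_adj)

lemma Im_expec_mult_eq_inner:
  "Im (expec (b * a)) = to_L2 (adj (scaleC (- \<i>) b)) \<bullet> to_L2 (a :: 'a::cstar_prob_space)"
  unfolding Re_expec_mult_eq_inner[symmetric]
  by (simp add: scaleC_mult_left expec_scaleC)

lemma expec_mult_eq:
  "expec_mult b x = Complex (to_L2 (adj b) \<bullet> x) (to_L2 (adj (scaleC (- \<i>) b)) \<bullet> x)"
proof -
  let ?z = "Complex (to_L2 (adj b) \<bullet> x) (to_L2 (adj (scaleC (- \<i>) b)) \<bullet> x)"
  have lim: "(\<lambda>n. expec (b * a n)) \<longlonglongrightarrow> ?z" if "(\<lambda>n. to_L2 (a n)) \<longlonglongrightarrow> x" for a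
    unfolding tendsto_complex_iff Re_expec_mult_eq_inner Im_expec_mult_eq_inner
    by (auto intro!: tendsto_inner that)
  have "\<exists>a. norm (to_L2 a - x) < inverse (real (Suc n))" for n
    using to_completion_approx[of "inverse (real (Suc n))" x] unfolding to_L2_def
    by (metis inverse_positive_iff_positive of_nat_0_less_iff of_pre_L2_inverse zero_less_Suc)
  then obtain a where a: "\<And>n. norm (to_L2 (a n) - x) < inverse (real (Suc n))"
    by metis
  have "(\<lambda>n. norm (to_L2 (a n) - x)) \<longlonglongrightarrow> 0"
    by (rule tendsto_sandwich[OF _ _ tendsto_const LIMSEQ_inverse_real_of_nat])
      (use a in \<open>auto intro!: always_eventually less_imp_le simp del: of_nat_Suc\<close>)
  then have "(\<lambda>n. to_L2 (a n)) \<longlonglongrightarrow> x"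
    by (simp add: LIM_zero_iff tendsto_norm_zero_iff)
  then show ?thesis
    unfolding expec_mult_def
    by (intro the_equality) (use lim LIMSEQ_unique in blast)+
qed

lemma expec_mult_to_L2: "expec_mult b (to_L2 a) = expec (b * a)"
  by (simp add: expec_mult_eq complex_eq_iff Re_expec_mult_eq_inner Im_expec_mult_eq_inner)

text \<open>The conditional expectation \<open>L\<^sup>1 \<rightarrow> L\<^sup>1(N)\<close> restricted to \<open>L\<^sup>2\<close>, which it maps into \<open>L\<^sup>2(N)\<close>.\<close>

definition cond_expec :: "'a::cstar_prob_space set \<Rightarrow> 'a L2 \<Rightarrow> 'a L2"
  where "cond_expec N x =
    (THE y. y \<in> L2_of N \<and> (\<forall>b\<in>N. expec_mult b y = expec_mult b x))"

definition unital_closed_star_subalgebra :: "'a::cstar_algebra set \<Rightarrow> bool"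
  where "unital_closed_star_subalgebra N \<longleftrightarrow>
    1 \<in> N \<and> (\<forall>x\<in>N. \<forall>y\<in>N. x + y \<in> N \<and> x * y \<in> N) \<and>
    (\<forall>c. \<forall>x\<in>N. scaleC c x \<in> N) \<and> (\<forall>x\<in>N. adj x \<in> N) \<and> closed N"

text \<open>Processes and filtrations are functions on \<^typ>\<open>real\<close>; values at negative times are ignored
  throughout.\<close>

definition filtration :: "(real \<Rightarrow> 'a::cstar_algebra set) \<Rightarrow> bool"
  where "filtration F \<longleftrightarrow>
    (\<forall>t\<ge>0. unital_closed_star_subalgebra (F t)) \<and> (\<forall>s t. 0 \<le> s \<and> s \<le> t \<longrightarrow> F s \<subseteq> F t)"

definition adapted :: "(real \<Rightarrow> 'a::cstar_prob_space set) \<Rightarrow> (real \<Rightarrow> 'a L2) \<Rightarrow> bool"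
  where "adapted F X \<longleftrightarrow> (\<forall>t\<ge>0. X t \<in> L2_of (F t))"

definition L2_martingale :: "(real \<Rightarrow> 'a::cstar_prob_space set) \<Rightarrow> (real \<Rightarrow> 'a L2) \<Rightarrow> bool"
  where "L2_martingale F M \<longleftrightarrow>
    adapted F M \<and> (\<forall>s t. 0 \<le> s \<and> s \<le> t \<longrightarrow> cond_expec (F s) (M t) = M s)"

definition variation :: "(real \<Rightarrow> 'v::real_normed_vector) \<Rightarrow> real \<Rightarrow> real \<Rightarrow> ennreal"
  where "variation A s t =
    (SUP (n, p) \<in> {(n::nat, p::nat \<Rightarrow> real). mono_on {..n} p \<and> p 0 = s \<and> p n = t}.
      \<Sum>i<n. ennreal (norm (A (p (Suc i)) - A (p i))))"

definition locally_bounded_variation :: "(real \<Rightarrow> 'v::real_normed_vector) \<Rightarrow> bool"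
  where "locally_bounded_variation A \<longleftrightarrow> (\<forall>s t. 0 \<le> s \<and> s \<le> t \<longrightarrow> variation A s t < \<infinity>)"

definition L2_decomposition ::
  "(real \<Rightarrow> 'a::cstar_prob_space set) \<Rightarrow> (real \<Rightarrow> 'a L2) \<Rightarrow> (real \<Rightarrow> 'a L2) \<Rightarrow> (real \<Rightarrow> 'a L2) \<Rightarrow> bool"
  where "L2_decomposition F X M A \<longleftrightarrow>
    adapted F X \<and> (\<forall>t\<ge>0. X t = X 0 + M t + A t) \<and>
    L2_martingale F M \<and> continuous_on {0..} M \<and>
    adapted F A \<and> continuous_on {0..} A \<and> locally_bounded_variation A \<and>
    M 0 = 0 \<and> A 0 = 0"

definition L2_decomposable :: "(real \<Rightarrow> 'a::cstar_prob_space set) \<Rightarrow> (real \<Rightarrow> 'a L2) \<Rightarrow> bool"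
  where "L2_decomposable F X \<longleftrightarrow> (\<exists>M A. L2_decomposition F X M A)"

text \<open>The decomposition is unique on \<open>{0..}\<close>; the choice only concerns negative times.\<close>

definition mart_part :: "(real \<Rightarrow> 'a::cstar_prob_space set) \<Rightarrow> (real \<Rightarrow> 'a L2) \<Rightarrow> real \<Rightarrow> 'a L2"
  where "mart_part F X = (SOME M. \<exists>A. L2_decomposition F X M A)"

definition fv_part :: "(real \<Rightarrow> 'a::cstar_prob_space set) \<Rightarrow> (real \<Rightarrow> 'a L2) \<Rightarrow> real \<Rightarrow> 'a L2"
  where "fv_part F X = (SOME A. \<exists>M. L2_decomposition F X M A)"

abbreviation borel_nonneg :: "real measure"
  where "borel_nonneg \<equiv> restrict_space borel {0..}"

definition kappa_mart :: "(real \<Rightarrow> 'a::cstar_prob_space L2) \<Rightarrow> real measure"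
  where "kappa_mart M = (THE \<mu>. sets \<mu> = sets borel_nonneg \<and> emeasure \<mu> {0} = 0 \<and>
    (\<forall>s t. 0 \<le> s \<and> s \<le> t \<longrightarrow> emeasure \<mu> {s<..t} = ennreal ((norm (M t - M s))\<^sup>2)))"

definition kappa_fv :: "(real \<Rightarrow> 'a::cstar_prob_space L2) \<Rightarrow> real measure"
  where "kappa_fv A = (THE \<mu>. sets \<mu> = sets borel_nonneg \<and> emeasure \<mu> {0} = 0 \<and>
    (\<forall>s t. 0 \<le> s \<and> s \<le> t \<longrightarrow> emeasure \<mu> {s<..t} = variation A s t))"

definition kappa :: "(real \<Rightarrow> 'a::cstar_prob_space set) \<Rightarrow> (real \<Rightarrow> 'a L2) \<Rightarrow> real measure"
  where "kappa F X = measure_of {0..} (sets borel_nonneg)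
    (\<lambda>S. emeasure (kappa_mart (mart_part F X)) S + emeasure (kappa_fv (fv_part F X)) S)"

section \<open>Elementary predictable processes\<close>

definition F22 ::
  "(real \<Rightarrow> 'a::cstar_prob_space set) \<Rightarrow> (real \<Rightarrow> 'b::cstar_prob_space set) \<Rightarrow> real \<Rightarrow> ('a L2 \<Rightarrow>\<^sub>L 'b L2) set"
  where "F22 FA FB t =
    {T. \<forall>u\<ge>t. \<forall>x. cond_expec (FB u) (blinfun_apply T x) = blinfun_apply T (cond_expec (FA u) x)}"

text \<open>\<open>(H\<^sub>0, [(s\<^sub>1, t\<^sub>1, H\<^sub>1), \<dots>, (s\<^sub>k, t\<^sub>k, H\<^sub>k)])\<close> represents
  \<open>1\<^bsub>{0}\<^esub> H\<^sub>0 + \<Sum>\<^sub>i 1\<^bsub>(s\<^sub>i, t\<^sub>i]\<^esub> H\<^sub>i\<close>.\<close>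

type_synonym 'v elem_data = "'v \<times> (real \<times> real \<times> 'v) list"

definition elem_data ::
  "(real \<Rightarrow> 'a::cstar_prob_space set) \<Rightarrow> (real \<Rightarrow> 'b::cstar_prob_space set) \<Rightarrow>
    ('a L2 \<Rightarrow>\<^sub>L 'b L2) elem_data set"
  where "elem_data FA FB = {(H0, Hs). H0 \<in> F22 FA FB 0 \<and>
    (\<forall>(s, t, Hi) \<in> set Hs. 0 \<le> s \<and> s \<le> t \<and> Hi \<in> F22 FA FB s)}"

definition elem_process :: "'v::real_vector elem_data \<Rightarrow> real \<Rightarrow> 'v"
  where "elem_process E u =
    indicator {0} u *\<^sub>R fst E + (\<Sum>(s, t, Hi) \<leftarrow> snd E. indicator {s<..t} u *\<^sub>R Hi)"

definition elem_integral ::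
  "('v::real_normed_vector \<Rightarrow>\<^sub>L 'w::real_normed_vector) elem_data \<Rightarrow> (real \<Rightarrow> 'v) \<Rightarrow> real \<Rightarrow> 'w"
  where "elem_integral E X u =
    (\<Sum>(s, t, Hi) \<leftarrow> snd E. blinfun_apply Hi (X (min t u) - X (min s u)))"

definition EP22 ::
  "(real \<Rightarrow> 'a::cstar_prob_space set) \<Rightarrow> (real \<Rightarrow> 'b::cstar_prob_space set) \<Rightarrow>
    (real \<Rightarrow> 'a L2 \<Rightarrow>\<^sub>L 'b L2) set"
  where "EP22 FA FB = elem_process ` elem_data FA FB"

section \<open>Stochastic integrals\<close>

text \<open>Strong measurability in Bochner's sense, for the norm topology of the target space.\<close>

definition strongly_measurable :: "(real \<Rightarrow> 'v::real_normed_vector) \<Rightarrow> bool"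
  where "strongly_measurable H \<longleftrightarrow>
    (\<exists>S. (\<forall>n::nat. simple_function borel_nonneg (S n)) \<and> (\<forall>t\<ge>0. (\<lambda>n. S n t) \<longlonglongrightarrow> H t))"

definition ennreal_sqrt :: "ennreal \<Rightarrow> ennreal"
  where "ennreal_sqrt x = (if x = \<infinity> then \<infinity> else ennreal (sqrt (enn2real x)))"

definition X_seminorm ::
  "(real \<Rightarrow> 'a::cstar_prob_space set) \<Rightarrow> (real \<Rightarrow> 'a L2) \<Rightarrow> real \<Rightarrow>
    (real \<Rightarrow> 'a L2 \<Rightarrow>\<^sub>L 'b::cstar_prob_space L2) \<Rightarrow> ennreal"
  where "X_seminorm FA X t H =
    ennreal_sqrt (\<integral>\<^sup>+ s\<in>{0<..t}. ennreal ((norm (H s))\<^sup>2) \<partial>kappa_mart (mart_part FA X)) +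
    (\<integral>\<^sup>+ s\<in>{0<..t}. ennreal (norm (H s)) \<partial>kappa_fv (fv_part FA X))"

text \<open>Elements of the Frechet space are represented by functions; each class modulo null sets has
  an everywhere strongly measurable representative.\<close>

definition L_space ::
  "(real \<Rightarrow> 'a::cstar_prob_space set) \<Rightarrow> (real \<Rightarrow> 'a L2) \<Rightarrow>
    (real \<Rightarrow> 'a L2 \<Rightarrow>\<^sub>L 'b::cstar_prob_space L2) set"
  where "L_space FA X = {H. strongly_measurable H \<and>
    (\<forall>t\<ge>0. (\<integral>\<^sup>+ s\<in>{0..t}. ennreal (norm (H s)) \<partial>kappa FA X) < \<infinity>) \<and>
    (\<forall>t\<ge>0. X_seminorm FA X t H < \<infinity>)}"

definition L_tendsto ::
  "(real \<Rightarrow> 'a::cstar_prob_space set) \<Rightarrow> (real \<Rightarrow> 'a L2) \<Rightarrow>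
    (nat \<Rightarrow> real \<Rightarrow> 'a L2 \<Rightarrow>\<^sub>L 'b::cstar_prob_space L2) \<Rightarrow> (real \<Rightarrow> 'a L2 \<Rightarrow>\<^sub>L 'b L2) \<Rightarrow> bool"
  where "L_tendsto FA X Hn H \<longleftrightarrow>
    (\<forall>t\<ge>0. (\<lambda>n. X_seminorm FA X t (\<lambda>s. Hn n s - H s)) \<longlonglongrightarrow> 0)"

text \<open>The topology is given by the seminorms at integer times, hence metrizable, so
  sequential closure is closure.\<close>

definition stoch_integrable ::
  "(real \<Rightarrow> 'a::cstar_prob_space set) \<Rightarrow> (real \<Rightarrow> 'b::cstar_prob_space set) \<Rightarrow> (real \<Rightarrow> 'a L2) \<Rightarrow>
    (real \<Rightarrow> 'a L2 \<Rightarrow>\<^sub>L 'b L2) set"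
  where "stoch_integrable FA FB X = {H. L2_decomposable FA X \<and> H \<in> L_space FA X \<and>
    (\<exists>Hn. (\<forall>n. Hn n \<in> EP22 FA FB) \<and> L_tendsto FA X Hn H)}"

text \<open>The extension by continuity of the elementary integral; the value does not depend on the
  approximating sequence.\<close>

definition stoch_integral ::
  "(real \<Rightarrow> 'a::cstar_prob_space set) \<Rightarrow> (real \<Rightarrow> 'b::cstar_prob_space set) \<Rightarrow>
    (real \<Rightarrow> 'a L2 \<Rightarrow>\<^sub>L 'b L2) \<Rightarrow> (real \<Rightarrow> 'a L2) \<Rightarrow> real \<Rightarrow> 'b L2"
  where "stoch_integral FA FB H X t =
    (THE y. \<exists>E. (\<forall>n. E n \<in> elem_data FA FB) \<and> L_tendsto FA X (\<lambda>n. elem_process (E n)) H \<and>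
      (\<lambda>n. elem_integral (E n) X t) \<longlonglongrightarrow> y)"

end

theory Submission
  imports Defs
begin

text \<open>The formula is evident for elementary processes: the product of \<open>1\<^bsub>(s, t]\<^esub> K\<close> and \<open>1\<^bsub>(s', t']\<^esub> H\<close> is again
  elementary, and integrating it against \<open>X\<close> is integrating \<open>1\<^bsub>(s, t]\<^esub> K\<close> against \<open>\<integral> 1\<^bsub>(s', t']\<^esub> H [dX]\<close>
  (lemma \<open>elem_integral_compose\<close>). The general case is a double limit \<open>K\<^sub>n \<rightarrow> K\<close>, \<open>H\<^sub>m \<rightarrow> H\<close>, and what makes
  the limit possible is that the measure \<open>\<kappa>\<^sub>Y\<close> of the integral \<open>Y = \<integral> H [dX]\<close> is controlled by \<open>\<kappa>\<^sub>X\<close>.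

  To see this, \<open>\<parallel>\<integral>\<^sub>s\<^sup>t H [dM]\<parallel>\<^sup>2 \<le> \<integral>\<^sub>s\<^sup>t \<parallel>H\<parallel>\<^sup>2 d\<kappa>\<^sub>M\<close> and \<open>\<parallel>\<integral>\<^sub>s\<^sup>t H [dA]\<parallel> \<le> \<integral>\<^sub>s\<^sup>t \<parallel>H\<parallel> d\<kappa>\<^sub>A\<close> for elementary \<open>H\<close>. On a
  partition adapted to \<open>H\<close>, the first is Pythagoras: operators in \<open>\<F>\<close> commute with conditional
  expectations, which are orthogonal projections of \<open>L\<^sup>2\<close>, so that the terms of the integral against
  \<open>M\<close> are orthogonal to each other. The second is the triangle inequality. Both estimates pass, up to
  a factor \<open>2\<close>, to limits of elementary processes (lemma \<open>ex_stoch_integral_decomposition\<close>). They show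
  that \<open>Y\<close> is the sum of a martingale \<open>\<integral> H [dM]\<close> and a process \<open>\<integral> H [dA]\<close> of locally bounded variation,
  and that \<open>\<kappa>\<^bsub>\<integral>H[dM]\<^esub> \<le> 2 \<parallel>H\<parallel>\<^sup>2 \<kappa>\<^sub>M\<close> and \<open>\<kappa>\<^bsub>\<integral>H[dA]\<^esub> \<le> 2 \<parallel>H\<parallel> \<kappa>\<^sub>A\<close> (lemma \<open>energy_dominated\<close>).

  Hence the hypothesis implies that \<open>K\<^sub>n \<rightarrow> K\<close> in \<open>\<L>\<^sub>Y\<close>, so \<open>K\<close> is \<open>Y\<close>-integrable and
  \<open>\<integral> K\<^sub>n [dY] \<rightarrow> \<integral> K [dY]\<close>. For fixed \<open>n\<close>, the elementary process \<open>K\<^sub>n\<close> is bounded, so \<open>K\<^sub>n H\<^sub>m \<rightarrow> K\<^sub>n H\<close> in \<open>\<L>\<^sub>X\<close>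
  and \<open>\<integral> K\<^sub>n H\<^sub>m [dX] \<rightarrow> \<integral> K\<^sub>n [dY]\<close> as \<open>m \<rightarrow> \<infinity>\<close>. The hypothesis also implies that \<open>K\<^sub>n H \<rightarrow> K H\<close> in \<open>\<L>\<^sub>X\<close>. A
  diagonal sequence \<open>K\<^sub>n H\<^bsub>m(n)\<^esub>\<close> of elementary processes therefore converges to \<open>K H\<close>, and its integrals
  converge to \<open>\<integral> K [dY]\<close>.

  The measures \<open>\<kappa>\<^sub>M\<close> and \<open>\<kappa>\<^sub>A\<close> and the conditional expectations are given by definite descriptions, and
  the parts of a decomposition by choice, so their existence and uniqueness have to be established
  first: by the projection theorem, by right-continuity of the distribution functions, and by the
  fact that a continuous martingale of locally bounded variation vanishes if it starts at \<open>0\<close>.\<close>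

section \<open>Orthogonal projections and conditional expectations\<close>

text \<open>A minimising sequence for the distance from \<open>x\<close> to \<open>S\<close> is Cauchy by the parallelogram law; at its
  limit \<open>y\<close> the distance is minimal, so moving from \<open>y\<close> in a direction of \<open>S\<close> does not decrease it.\<close>

lemma ex_orthogonal_projection:
  fixes S :: "'v::{real_inner,banach} set"
  assumes S: "subspace S" "closed S"
  shows "\<exists>y\<in>S. \<forall>z\<in>S. (x - y) \<bullet> z = 0"
proof -
  define d where "d = infdist x S"
  have ne: "S \<noteq> {}" using subspace_0[OF S(1)] by auto
  have d_le: "d \<le> norm (x - z)" if "z \<in> S" for z
    using infdist_le[OF that, of x] by (simp add: d_def dist_norm)
  have d0: "d \<ge> 0" by (simp add: d_def infdist_nonneg)
  have "\<exists>y\<in>S. (norm (x - y))\<^sup>2 < d\<^sup>2 + e" if "e > 0" for e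
  proof -
    have "d < sqrt (d\<^sup>2 + e)" using that d0 by (simp add: real_less_rsqrt)
    then obtain y where "y \<in> S" "norm (x - y) < sqrt (d\<^sup>2 + e)"
      using cInf_lessD[of "dist x ` S" "sqrt (d\<^sup>2 + e)"] ne
      by (auto simp: d_def infdist_def dist_norm image_iff split: if_splits)
    then have "(norm (x - y))\<^sup>2 < (sqrt (d\<^sup>2 + e))\<^sup>2"
      by (intro power_strict_mono) auto
    then show ?thesis using \<open>y \<in> S\<close> that d0 by auto
  qed
  then have "\<exists>y\<in>S. (norm (x - y))\<^sup>2 < d\<^sup>2 + inverse (real (Suc n))" for n by simp
  then obtain y where y: "\<And>n. y n \<in> S" "\<And>n. (norm (x - y n))\<^sup>2 < d\<^sup>2 + inverse (real (Suc n))"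
    by metis
  have gap: "(norm (y m - y n))\<^sup>2 \<le> 2 * inverse (real (Suc m)) + 2 * inverse (real (Suc n))" for m n
  proof -
    have "(1/2) *\<^sub>R (y m + y n) \<in> S" using S(1) y(1) by (simp add: subspace_add subspace_scale)
    from d_le[OF this] have "d\<^sup>2 \<le> (norm (x - (1/2) *\<^sub>R (y m + y n)))\<^sup>2"
      using d0 by (intro power_mono)
    \<comment> \<open>the parallelogram law for \<open>x - y m\<close> and \<open>x - y n\<close>\<close>
    moreover have "(norm (y m - y n))\<^sup>2 + 4 * (norm (x - (1/2) *\<^sub>R (y m + y n)))\<^sup>2
        = 2 * (norm (x - y m))\<^sup>2 + 2 * (norm (x - y n))\<^sup>2"
      unfolding power2_norm_eq_inner
      by (simp add: inner_diff_left inner_diff_right inner_add_left inner_add_right inner_commute algebra_simps)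
    ultimately show ?thesis using y(2)[of m] y(2)[of n] by linarith
  qed
  have "Cauchy y"
  proof (rule CauchyI)
    fix e :: real assume e: "e > 0"
    obtain N where N: "inverse (real (Suc N)) < e\<^sup>2 / 4"
      using reals_Archimedean[of "e\<^sup>2 / 4"] e by auto
    have "norm (y m - y n) < e" if "m \<ge> N" "n \<ge> N" for m n
    proof -
      have "inverse (real (Suc m)) \<le> inverse (real (Suc N))" "inverse (real (Suc n)) \<le> inverse (real (Suc N))"
        using that by simp_all
      then have "(norm (y m - y n))\<^sup>2 < e\<^sup>2" using gap[of m n] N by linarith
      then show ?thesis using e by (simp add: power2_less_imp_less)
    qed
    then show "\<exists>M. \<forall>m\<ge>M. \<forall>n\<ge>M. norm (y m - y n) < e" by blast
  qed
  then obtain l where l: "y \<longlonglongrightarrow> l" by (auto simp: Cauchy_convergent_iff convergent_def)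
  have lS: "l \<in> S" using closed_sequentially[OF S(2)] y(1) l by blast
  have "(norm (x - l))\<^sup>2 \<le> d\<^sup>2"
  proof (rule LIMSEQ_le)
    show "(\<lambda>n. (norm (x - y n))\<^sup>2) \<longlonglongrightarrow> (norm (x - l))\<^sup>2" by (intro tendsto_intros l)
    show "(\<lambda>n. d\<^sup>2 + inverse (real (Suc n))) \<longlonglongrightarrow> d\<^sup>2"
      using LIMSEQ_inverse_real_of_nat_add by blast
  qed (use y(2) in \<open>auto intro: less_imp_le\<close>)
  have "(x - l) \<bullet> z = 0" if z: "z \<in> S" for z
  proof (cases "z = 0")
    case False
    \<comment> \<open>the step along \<open>z\<close> that would bring \<open>l\<close> closest to \<open>x\<close>\<close>
    define r where "r = ((x - l) \<bullet> z) / (z \<bullet> z)"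
    have "l + r *\<^sub>R z \<in> S" using S(1) lS z by (simp add: subspace_add subspace_scale)
    from d_le[OF this] have "d\<^sup>2 \<le> (norm (x - (l + r *\<^sub>R z)))\<^sup>2" using d0 by (intro power_mono)
    also have "\<dots> = (norm (x - l))\<^sup>2 - 2 * r * ((x - l) \<bullet> z) + r\<^sup>2 * (z \<bullet> z)"
      unfolding power2_norm_eq_inner unfolding power2_eq_square
      by (simp add: inner_diff_left inner_diff_right inner_add_left inner_add_right inner_commute algebra_simps)
    finally have "2 * r * ((x - l) \<bullet> z) \<le> r\<^sup>2 * (z \<bullet> z)"
      using \<open>(norm (x - l))\<^sup>2 \<le> d\<^sup>2\<close> by linarith
    moreover have "r\<^sup>2 * (z \<bullet> z) = r * ((x - l) \<bullet> z)"
      using False by (simp add: r_def power2_eq_square)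
    ultimately have "r\<^sup>2 * (z \<bullet> z) \<le> 0" by simp
    moreover have "((x - l) \<bullet> z)\<^sup>2 = r\<^sup>2 * (z \<bullet> z) * (z \<bullet> z)"
      using False by (simp add: r_def power2_eq_square)
    ultimately have "((x - l) \<bullet> z)\<^sup>2 \<le> 0"
      using mult_nonpos_nonneg[OF _ inner_ge_zero] by metis
    then show ?thesis by simp
  qed simp
  then show ?thesis using lS by blast
qed

lemma subspace_closure_real:
  fixes S :: "'v::real_normed_vector set"
  assumes "subspace S"
  shows "subspace (closure S)"
proof (rule subspaceI)
  show "0 \<in> closure S" using subspace_0[OF assms] closure_subset by blast
next
  fix x y assume "x \<in> closure S" "y \<in> closure S"
  then obtain a b where "\<And>n. a n \<in> S" "a \<longlonglongrightarrow> x" "\<And>n. b n \<in> S" "b \<longlonglongrightarrow> y"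
    unfolding closure_sequential by metis
  then have "\<And>n. a n + b n \<in> S" "(\<lambda>n. a n + b n) \<longlonglongrightarrow> x + y"
    using subspace_add[OF assms] by (auto intro: tendsto_add)
  then show "x + y \<in> closure S" unfolding closure_sequential by (intro exI[of _ "\<lambda>n. a n + b n"]) auto
next
  fix c x assume "x \<in> closure S"
  then obtain a where "\<And>n. a n \<in> S" "a \<longlonglongrightarrow> x" unfolding closure_sequential by metis
  then have "\<And>n. c *\<^sub>R a n \<in> S" "(\<lambda>n. c *\<^sub>R a n) \<longlonglongrightarrow> c *\<^sub>R x"
    using subspace_scale[OF assms] by (auto intro: tendsto_intros)
  then show "c *\<^sub>R x \<in> closure S" unfolding closure_sequential by (intro exI[of _ "\<lambda>n. c *\<^sub>R a n"]) auto
qed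

lemma to_L2_add: "to_L2 (a + b) = to_L2 a + to_L2 b"
  unfolding to_L2_def to_completion_add[symmetric] plus_pre_L2_def
  by (simp add: to_pre_L2_inverse)

lemma to_L2_scaleR: "to_L2 (r *\<^sub>R a) = r *\<^sub>R to_L2 a"
  unfolding to_L2_def to_completion_scaleR[symmetric] scaleR_pre_L2_def
  by (simp add: to_pre_L2_inverse)

lemma closed_L2_of [simp]: "closed (L2_of N)"
  by (simp add: L2_of_def)

lemma L2_of_mono: "N \<subseteq> N' \<Longrightarrow> L2_of N \<subseteq> L2_of N'"
  unfolding L2_of_def by (intro closure_mono image_mono)

context
  fixes N :: "'a::cstar_prob_space set"
  assumes N: "unital_closed_star_subalgebra N"
begin

lemma subspace_L2_of: "subspace (L2_of N)"
  unfolding L2_of_def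
proof (intro subspace_closure_real subspaceI)
  have "scaleC 0 1 \<in> N" using N by (auto simp: unital_closed_star_subalgebra_def)
  then have "0 \<in> N" by (simp add: scaleC_zero_left)
  moreover have "to_L2 (0::'a) = 0" using to_L2_scaleR[of 0 "0::'a"] by simp
  ultimately show "0 \<in> to_L2 ` N" by (metis imageI)
next
  fix x y assume "x \<in> to_L2 ` N" "y \<in> to_L2 ` N"
  then show "x + y \<in> to_L2 ` N"
    using N by (force simp: unital_closed_star_subalgebra_def to_L2_add[symmetric])
next
  fix c :: real and x assume "x \<in> to_L2 ` N"
  then obtain a where "a \<in> N" "x = to_L2 a" by auto
  moreover from this have "scaleC (complex_of_real c) a \<in> N"
    using N by (simp add: unital_closed_star_subalgebra_def)
  ultimately show "c *\<^sub>R x \<in> to_L2 ` N" by (simp add: scaleC_of_real to_L2_scaleR[symmetric])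
qed

text \<open>Testing against \<open>N\<close> by the trace is testing against \<open>L\<^sup>2(N)\<close> by the real inner product:
  \<open>N\<close> is closed under adjoints and under multiplication by \<open>\<i>\<close>, which accounts for imaginary
  parts, and orthogonality passes to the closure.\<close>

lemma expec_mult_eq_iff_orthogonal:
  "(\<forall>b\<in>N. expec_mult b y = expec_mult b x) \<longleftrightarrow> (\<forall>z\<in>L2_of N. (x - y) \<bullet> z = 0)"
proof
  assume eq: "\<forall>b\<in>N. expec_mult b y = expec_mult b x"
  have "to_L2 ` N \<subseteq> {z. (x - y) \<bullet> z = 0}"
  proof safe
    fix a assume "a \<in> N"
    then have "expec_mult (adj a) y = expec_mult (adj a) x"
      using eq N by (simp add: unital_closed_star_subalgebra_def)
    then show "(x - y) \<bullet> to_L2 a = 0"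
      by (simp add: expec_mult_eq adj_adj inner_diff_left inner_diff_right inner_commute[of _ "to_L2 a"])
  qed
  moreover have "closed {z. (x - y) \<bullet> z = 0}"
    by (intro closed_Collect_eq continuous_intros)
  ultimately have "L2_of N \<subseteq> {z. (x - y) \<bullet> z = 0}"
    unfolding L2_of_def by (rule closure_minimal)
  then show "\<forall>z\<in>L2_of N. (x - y) \<bullet> z = 0" by auto
next
  assume orth: "\<forall>z\<in>L2_of N. (x - y) \<bullet> z = 0"
  have *: "to_L2 a \<bullet> y = to_L2 a \<bullet> x" if "a \<in> N" for a
  proof -
    have "to_L2 a \<in> L2_of N" using that closure_subset[of "to_L2 ` N"] by (auto simp: L2_of_def)
    then have "(x - y) \<bullet> to_L2 a = 0" using orth by blast
    then show ?thesis by (simp add: inner_diff_left inner_commute[of "to_L2 a"])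
  qed
  show "\<forall>b\<in>N. expec_mult b y = expec_mult b x"
    using N unfolding expec_mult_eq unital_closed_star_subalgebra_def by (auto intro!: *)
qed

text \<open>So \<open>cond_expec N\<close> is the orthogonal projection onto \<open>L\<^sup>2(N)\<close>, and it is used only through this
  characterisation and its consequences.\<close>

lemma cond_expec_eqI:
  assumes "y \<in> L2_of N" "\<And>z. z \<in> L2_of N \<Longrightarrow> (x - y) \<bullet> z = 0"
  shows "cond_expec N x = y"
  unfolding cond_expec_def expec_mult_eq_iff_orthogonal
proof (rule the_equality)
  fix y' assume y': "y' \<in> L2_of N \<and> (\<forall>z\<in>L2_of N. (x - y') \<bullet> z = 0)"
  have "y' - y \<in> L2_of N" using y' assms(1) subspace_L2_of by (simp add: subspace_diff)
  then have "(y' - y) \<bullet> (y' - y) = 0"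
    using y' assms(2) by (simp add: inner_diff_left)
  then show "y' = y" by simp
qed (use assms in blast)

lemma cond_expec_in: "cond_expec N x \<in> L2_of N"
  and cond_expec_orth: "z \<in> L2_of N \<Longrightarrow> (x - cond_expec N x) \<bullet> z = 0"
proof -
  obtain y where "y \<in> L2_of N" "\<forall>z\<in>L2_of N. (x - y) \<bullet> z = 0"
    using ex_orthogonal_projection[OF subspace_L2_of closed_L2_of] by blast
  moreover from this have "cond_expec N x = y" by (intro cond_expec_eqI) auto
  ultimately show "cond_expec N x \<in> L2_of N" "z \<in> L2_of N \<Longrightarrow> (x - cond_expec N x) \<bullet> z = 0"
    by auto
qed

lemma cond_expec_ident: "x \<in> L2_of N \<Longrightarrow> cond_expec N x = x"
  by (rule cond_expec_eqI) auto

lemma cond_expec_add: "cond_expec N (x + y) = cond_expec N x + cond_expec N y"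
proof (rule cond_expec_eqI)
  fix z assume z: "z \<in> L2_of N"
  show "(x + y - (cond_expec N x + cond_expec N y)) \<bullet> z = 0"
    using cond_expec_orth[OF z, of x] cond_expec_orth[OF z, of y]
    by (simp add: inner_diff_left inner_add_left)
qed (simp add: subspace_add[OF subspace_L2_of] cond_expec_in)

lemma cond_expec_scaleR: "cond_expec N (r *\<^sub>R x) = r *\<^sub>R cond_expec N x"
proof (rule cond_expec_eqI)
  fix z assume z: "z \<in> L2_of N"
  show "(r *\<^sub>R x - r *\<^sub>R cond_expec N x) \<bullet> z = 0"
    using cond_expec_orth[OF z, of x] by (simp add: scaleR_diff_right[symmetric])
qed (simp add: subspace_scale[OF subspace_L2_of] cond_expec_in)

lemma bounded_linear_cond_expec: "bounded_linear (cond_expec N)"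
proof (rule bounded_linear_intro[of _ 1])
  fix x
  have "(cond_expec N x) \<bullet> (cond_expec N x) = x \<bullet> cond_expec N x"
    using cond_expec_orth[OF cond_expec_in, of x x] by (simp add: inner_diff_left)
  also have "\<dots> \<le> norm x * norm (cond_expec N x)" by (rule norm_cauchy_schwarz)
  finally have "norm (cond_expec N x) * norm (cond_expec N x) \<le> norm x * norm (cond_expec N x)"
    by (simp add: power2_norm_eq_inner[symmetric] power2_eq_square)
  then show "norm (cond_expec N x) \<le> norm x * 1"
    by (cases "cond_expec N x = 0") auto
qed (auto simp: cond_expec_add cond_expec_scaleR)

lemma cond_expec_diff: "cond_expec N (x - y) = cond_expec N x - cond_expec N y"
  using cond_expec_add[of "x - y" y] by simp

lemma cond_expec_zero: "cond_expec N 0 = 0"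
  using cond_expec_scaleR[of 0 0] by simp

end

lemma filtration_subalgebra: "filtration F \<Longrightarrow> 0 \<le> t \<Longrightarrow> unital_closed_star_subalgebra (F t)"
  by (simp add: filtration_def)

lemma filtration_L2_of_mono: "filtration F \<Longrightarrow> 0 \<le> s \<Longrightarrow> s \<le> t \<Longrightarrow> L2_of (F s) \<subseteq> L2_of (F t)"
  by (simp add: filtration_def L2_of_mono)

section \<open>The variation of a vector valued function\<close>

lemma variation_upper:
  assumes "mono_on {..n} p" "p 0 = s" "p n = t"
  shows "(\<Sum>i<n. ennreal (norm (A (p (Suc i)) - A (p i)))) \<le> variation A s t"
  unfolding variation_def by (rule SUP_upper2[of "(n, p)"]) (use assms in auto)

lemma variation_least:
  assumes "\<And>n p. mono_on {..n} p \<Longrightarrow> p 0 = s \<Longrightarrow> p n = t \<Longrightarrow>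
    (\<Sum>i<n. ennreal (norm (A (p (Suc i)) - A (p i)))) \<le> c"
  shows "variation A s t \<le> c"
  unfolding variation_def by (rule SUP_least) (use assms in auto)

lemma partition_bounds:
  fixes p :: "nat \<Rightarrow> real"
  assumes "mono_on {..n} p" "p 0 = s" "p n = t" "i \<le> n"
  shows "s \<le> p i" "p i \<le> t"
  using monotone_onD[OF assms(1), of 0 i] monotone_onD[OF assms(1), of i n] assms(2-4) by auto

lemma partition_step:
  fixes p :: "nat \<Rightarrow> real"
  assumes "mono_on {..n} p" "i < n"
  shows "p i \<le> p (Suc i)"
  using monotone_onD[OF assms(1), of i "Suc i"] assms(2) by auto

lemma mono_on_min: "mono_on I p \<Longrightarrow> mono_on I (\<lambda>i. min (p i) (t::real))"
  and mono_on_max: "mono_on I p \<Longrightarrow> mono_on I (\<lambda>i. max (p i) (t::real))"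
  for p :: "nat \<Rightarrow> real"
  by (rule monotone_onI; intro min.mono max.mono; auto dest: monotone_onD)+

text \<open>The variation is the least superadditive interval function that dominates the increments; this is
  how the variation of a difference and of an integral is bounded.\<close>

lemma variation_le_of_increments:
  assumes inc: "\<And>u v. s \<le> u \<Longrightarrow> u \<le> v \<Longrightarrow> v \<le> t \<Longrightarrow> ennreal (norm (A v - A u)) \<le> g u v"
    and add: "\<And>u v w. s \<le> u \<Longrightarrow> u \<le> v \<Longrightarrow> v \<le> w \<Longrightarrow> w \<le> t \<Longrightarrow> g u v + g v w \<le> g u w"
  shows "variation A s t \<le> g s t"
proof (rule variation_least)
  fix n :: nat and p :: "nat \<Rightarrow> real" assume p: "mono_on {..n} p" "p 0 = s" "p n = t"
  have "(\<Sum>i<m. ennreal (norm (A (p (Suc i)) - A (p i)))) \<le> g s (p m)" if "m \<le> n" for m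
    using that
  proof (induction m)
    case 0
    then show ?case by simp
  next
    case (Suc m)
    note b = partition_bounds[OF p] partition_step[OF p(1)]
    have "(\<Sum>i<Suc m. ennreal (norm (A (p (Suc i)) - A (p i)))) \<le> g s (p m) + g (p m) (p (Suc m))"
      using Suc b[of m] b[of "Suc m"] by (auto intro!: add_mono inc)
    also have "\<dots> \<le> g s (p (Suc m))"
      using Suc b[of m] b[of "Suc m"] by (intro add) auto
    finally show ?case .
  qed
  from this[of n] show "(\<Sum>i<n. ennreal (norm (A (p (Suc i)) - A (p i)))) \<le> g s t"
    using p by simp
qed

lemma variation_mono_fun:
  assumes "\<And>u. s \<le> u \<Longrightarrow> u \<le> t \<Longrightarrow> A u = B u"
  shows "variation A s t \<le> variation B s t"
proof (rule variation_least)
  fix n :: nat and p :: "nat \<Rightarrow> real" assume p: "mono_on {..n} p" "p 0 = s" "p n = t"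
  have "(\<Sum>i<n. ennreal (norm (A (p (Suc i)) - A (p i)))) =
    (\<Sum>i<n. ennreal (norm (B (p (Suc i)) - B (p i))))"
    using partition_bounds[OF p] by (intro sum.cong) (auto simp: assms Suc_leI)
  also have "\<dots> \<le> variation B s t" by (rule variation_upper[OF p])
  finally show "(\<Sum>i<n. ennreal (norm (A (p (Suc i)) - A (p i)))) \<le> variation B s t" .
qed

lemma variation_cong:
  assumes "\<And>u. s \<le> u \<Longrightarrow> u \<le> t \<Longrightarrow> A u = B u"
  shows "variation A s t = variation B s t"
  by (rule antisym; rule variation_mono_fun) (simp_all add: assms)

text \<open>Cutting a partition at \<open>t\<close> by means of \<open>min\<close> and \<open>max\<close> keeps its number of points, so that
  no reindexing is needed: \<open>f (min x t) + f (max x t) = f x + f t\<close>.\<close>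

lemma increments_split_at:
  fixes A :: "real \<Rightarrow> 'v::real_normed_vector"
  shows "ennreal (norm (A y - A x)) \<le> ennreal (norm (A (min y t) - A (min x t)))
    + ennreal (norm (A (max y t) - A (max x t)))"
proof -
  have "A y - A x = (A (min y t) - A (min x t)) + (A (max y t) - A (max x t))"
    by (auto simp: min_def max_def)
  then show ?thesis
    by (metis ennreal_leI ennreal_plus norm_ge_zero norm_triangle_ineq)
qed

lemma variation_add:
  assumes "s \<le> t" "t \<le> u"
  shows "variation A s t + variation A t u = variation A s u"
proof (rule antisym)
  show "variation A s u \<le> variation A s t + variation A t u"
  proof (rule variation_least)
    fix n :: nat and p :: "nat \<Rightarrow> real" assume p: "mono_on {..n} p" "p 0 = s" "p n = u"
    have "(\<Sum>i<n. ennreal (norm (A (p (Suc i)) - A (p i)))) \<le>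
        (\<Sum>i<n. ennreal (norm (A (min (p (Suc i)) t) - A (min (p i) t)))) +
        (\<Sum>i<n. ennreal (norm (A (max (p (Suc i)) t) - A (max (p i) t))))"
      unfolding sum.distrib[symmetric] by (intro sum_mono increments_split_at)
    also have "\<dots> \<le> variation A s t + variation A t u"
    proof (intro add_mono)
      show "(\<Sum>i<n. ennreal (norm (A (min (p (Suc i)) t) - A (min (p i) t)))) \<le> variation A s t"
        by (rule variation_upper[of n "\<lambda>i. min (p i) t"])
          (use p assms in \<open>auto intro: mono_on_min\<close>)
      show "(\<Sum>i<n. ennreal (norm (A (max (p (Suc i)) t) - A (max (p i) t)))) \<le> variation A t u"
        by (rule variation_upper[of n "\<lambda>i. max (p i) t"])
          (use p assms in \<open>auto intro: mono_on_max\<close>)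
    qed
    finally show "(\<Sum>i<n. ennreal (norm (A (p (Suc i)) - A (p i)))) \<le>
      variation A s t + variation A t u" .
  qed
next
  have concat: "(\<Sum>i<n. ennreal (norm (A (p (Suc i)) - A (p i)))) +
      (\<Sum>i<m. ennreal (norm (A (q (Suc i)) - A (q i)))) \<le> variation A s u"
    if p: "mono_on {..n} p" "p 0 = s" "p n = t" and q: "mono_on {..m} q" "q 0 = t" "q m = u"
    for n m :: nat and p q :: "nat \<Rightarrow> real"
  proof -
    have split: "(\<Sum>i<n + k. f i) = (\<Sum>i<n. f i) + (\<Sum>i<k. f (n + i))" for f :: "nat \<Rightarrow> ennreal" and k
      by (induction k) (auto simp: add.assoc)
    define r where "r i = (if i \<le> n then p i else q (i - n))" for i
    have r_ge: "r (n + i) = q i" for i using p q by (auto simp: r_def)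
    have "(\<Sum>i<n + m. ennreal (norm (A (r (Suc i)) - A (r i)))) =
        (\<Sum>i<n. ennreal (norm (A (r (Suc i)) - A (r i)))) +
        (\<Sum>i<m. ennreal (norm (A (r (Suc (n + i))) - A (r (n + i)))))"
      by (rule split)
    also have "\<dots> = (\<Sum>i<n. ennreal (norm (A (p (Suc i)) - A (p i)))) +
        (\<Sum>i<m. ennreal (norm (A (q (Suc i)) - A (q i))))"
      using r_ge r_ge[of "Suc _"] by (intro arg_cong2[where f = "(+)"] sum.cong) (auto simp: r_def[of "Suc _"] r_def p q)
    finally have eq: "(\<Sum>i<n + m. ennreal (norm (A (r (Suc i)) - A (r i)))) = \<dots>" .
    have "mono_on {..n + m} r"
    proof (rule mono_onI)
      fix i j assume ij: "i \<in> {..n + m}" "j \<in> {..n + m}" "i \<le> j"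
      consider "j \<le> n" | "i \<le> n" "j > n" | "i > n" "j > n" using ij by linarith
      then show "r i \<le> r j"
      proof cases
        case 2
        then have "p i \<le> t" "t \<le> q (j - n)"
          using partition_bounds(2)[OF p, of i] partition_bounds(1)[OF q, of "j - n"] ij by auto
        then show ?thesis using 2 by (simp add: r_def)
      qed (use ij monotone_onD[OF p(1), of i j] monotone_onD[OF q(1), of "i - n" "j - n"]
          in \<open>auto simp: r_def\<close>)
    qed
    moreover have "r 0 = s" "r (n + m) = u" using p q r_ge[of m] by (auto simp: r_def)
    ultimately show ?thesis using variation_upper[of "n + m" r s u A] eq by simp
  qed
  \<comment> \<open>suprema over a nonempty set commute with addition in \<open>ennreal\<close>\<close>
  have ne: "\<exists>(n::nat) p. mono_on {..n} p \<and> p 0 = a \<and> p n = b" if "a \<le> b" for a b :: real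
    by (rule exI[of _ 1], rule exI[of _ "\<lambda>i. if i = 0 then a else b"])
      (use that in \<open>auto simp: monotone_on_def\<close>)
  have 1: "variation A s t + (\<Sum>i<m. ennreal (norm (A (q (Suc i)) - A (q i)))) \<le> variation A s u"
    if q: "mono_on {..m} q" "q 0 = t" "q m = u" for m :: nat and q :: "nat \<Rightarrow> real"
  proof -
    have ne': "{(n::nat, p::nat \<Rightarrow> real). mono_on {..n} p \<and> p 0 = s \<and> p n = t} \<noteq> {}"
      using ne[OF assms(1)] by auto
    show ?thesis
      unfolding variation_def[of A s t] ennreal_SUP_add_left[OF ne', symmetric]
    proof (rule SUP_least)
      fix x assume "x \<in> {(n::nat, p::nat \<Rightarrow> real). mono_on {..n} p \<and> p 0 = s \<and> p n = t}"
      then show "(case x of (n, p) \<Rightarrow> \<Sum>i<n. ennreal (norm (A (p (Suc i)) - A (p i)))) +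
        (\<Sum>i<m. ennreal (norm (A (q (Suc i)) - A (q i)))) \<le> variation A s u"
        using concat[OF _ _ _ q, of "fst x" "snd x"] by (simp add: case_prod_beta)
    qed
  qed
  have ne': "{(n::nat, p::nat \<Rightarrow> real). mono_on {..n} p \<and> p 0 = t \<and> p n = u} \<noteq> {}"
    using ne[OF assms(2)] by auto
  show "variation A s t + variation A t u \<le> variation A s u"
    unfolding variation_def[of A t u] add.commute[of "variation A s t"] ennreal_SUP_add_left[OF ne', symmetric]
  proof (rule SUP_least)
    fix x assume "x \<in> {(n::nat, p::nat \<Rightarrow> real). mono_on {..n} p \<and> p 0 = t \<and> p n = u}"
    then show "(case x of (n, p) \<Rightarrow> \<Sum>i<n. ennreal (norm (A (p (Suc i)) - A (p i)))) + variation A s t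
        \<le> variation A s u"
      using 1[of "fst x" "snd x"] by (simp add: case_prod_beta add.commute)
  qed
qed

lemma norm_increment_le_variation:
  assumes "s \<le> t"
  shows "ennreal (norm (A t - A s)) \<le> variation A s t"
  using variation_upper[of 1 "\<lambda>i. if i = 0 then s else t" s t A] assms
  by (auto simp: monotone_on_def)

text \<open>A continuous function does not vary suddenly: a partition that almost realises the variation
  over \<open>[a, a + 1]\<close> has, cut at \<open>t\<close> close to \<open>a\<close>, small increments on \<open>[a, t]\<close>, so almost all of
  the variation is left for \<open>[t, a + 1]\<close>.\<close>

lemma variation_right_continuous:
  fixes A :: "real \<Rightarrow> 'v::real_normed_vector"
  assumes cont: "continuous_on {0..} A" and bv: "locally_bounded_variation A" and a: "0 \<le> a"
  shows "(variation A a \<longlongrightarrow> 0) (at_right a)"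
proof (rule order_tendstoI)
  fix e :: ennreal assume "0 < e"
  then obtain d where d: "0 < d" "d < e" "d < \<infinity>"
    by (metis dense infinity_ennreal_def order_less_le_trans top_greatest)
  let ?P = "{(n::nat, p::nat \<Rightarrow> real). mono_on {..n} p \<and> p 0 = a \<and> p n = a + 1}"
  let ?S = "\<lambda>(n, p). \<Sum>i<n. ennreal (norm (A (p (Suc i)) - A (p i)))"
  let ?V = "variation A a (a + 1)"
  have fin: "variation A s t < \<infinity>" if "0 \<le> s" "s \<le> t" for s t
    using bv that by (auto simp: locally_bounded_variation_def)
  have "\<exists>x\<in>?P. ?V < ?S x + d"
  proof (rule ccontr)
    assume "\<not> ?thesis"
    then have "?S x + d \<le> ?V" if "x \<in> ?P" for x using that by (meson not_less)
    then have le: "(SUP x\<in>?P. ?S x + d) \<le> ?V" by (rule SUP_least)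
    have ne: "?P \<noteq> {}"
      by (auto simp: monotone_on_def intro!: exI[of _ 1] exI[of _ "\<lambda>i. if i = 0 then a else a + 1"])
    have "(SUP x\<in>?P. ?S x + d) = ?V + d"
      unfolding variation_def by (rule ennreal_SUP_add_left[OF ne])
    with le have "?V + d \<le> ?V" by simp
    then show False using d fin[of a "a + 1"] a
      by (metis add.right_neutral ennreal_add_left_cancel_less infinity_ennreal_def leD less_add_one less_imp_le)
  qed
  then obtain n p where p: "mono_on {..n} p" "p 0 = a" "p n = a + 1"
    and V: "?V < (\<Sum>i<n. ennreal (norm (A (p (Suc i)) - A (p i)))) + d"
    by auto
  define f where "f t = (\<Sum>i<n. ennreal (norm (A (min (p (Suc i)) t) - A (min (p i) t))))" for t
  have Atend: "((\<lambda>t. A (min (p i) t)) \<longlongrightarrow> A a) (at_right a)" if "i \<le> n" for i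
  proof -
    have "((\<lambda>t. min (p i) t) \<longlongrightarrow> min (p i) a) (at_right a)" by (intro tendsto_intros)
    then have m: "((\<lambda>t. min (p i) t) \<longlongrightarrow> a) (at_right a)"
      using partition_bounds(1)[OF p that] by (simp add: min_def split: if_splits)
    show ?thesis
    proof (rule continuous_on_tendsto_compose[OF cont m])
      show "a \<in> {0..}" using a by simp
      show "\<forall>\<^sub>F t in at_right a. min (p i) t \<in> {0..}"
        using eventually_at_right_less[of a] partition_bounds(1)[OF p that] a
        by (auto elim!: eventually_mono)
    qed
  qed
  have "(f \<longlongrightarrow> (\<Sum>i<n. ennreal (norm (A a - A a)))) (at_right a)"
    unfolding f_def by (intro tendsto_sum tendsto_ennrealI tendsto_norm tendsto_diff Atend) auto
  then have "(f \<longlongrightarrow> 0) (at_right a)" by simp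
  then have "\<forall>\<^sub>F t in at_right a. f t < e - d"
    using d by (intro order_tendstoD(2)) (auto simp: diff_gr0_ennreal)
  moreover have "\<forall>\<^sub>F t in at_right a. a < t \<and> t < a + 1"
    using eventually_at_right[of a "a + 1"] by force
  ultimately show "\<forall>\<^sub>F t in at_right a. variation A a t < e"
  proof eventually_elim
    case (elim t)
    have "variation A a t + variation A t (a + 1) = ?V" using elim by (intro variation_add) auto
    also have "?V < (\<Sum>i<n. ennreal (norm (A (p (Suc i)) - A (p i)))) + d" by (rule V)
    also have "(\<Sum>i<n. ennreal (norm (A (p (Suc i)) - A (p i)))) \<le>
        f t + (\<Sum>i<n. ennreal (norm (A (max (p (Suc i)) t) - A (max (p i) t))))"
      unfolding f_def sum.distrib[symmetric] by (intro sum_mono increments_split_at)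
    also have "\<dots> \<le> f t + variation A t (a + 1)"
      by (intro add_left_mono variation_upper[of n "\<lambda>i. max (p i) t"])
        (use p elim in \<open>auto intro: mono_on_max\<close>)
    finally have "variation A t (a + 1) + variation A a t < variation A t (a + 1) + (f t + d)"
      by (simp add: ac_simps add_right_mono)
    then have "variation A a t < f t + d"
      by (simp add: ennreal_add_left_cancel_less)
    also have "\<dots> \<le> e"
      using elim d by (metis add.commute add_left_mono ennreal_minus_cancel_iff
          less_imp_le diff_add_cancel_ennreal)
    finally show ?case .
  qed
qed simp

section \<open>Measures on the half line\<close>

text \<open>Sums of measures serve twice: \<open>\<kappa>\<^sub>X\<close> is the sum \<open>\<kappa>\<^sub>M + \<kappa>\<^sub>A\<close>, and an inequality of measures is
  turned into an equation with a remainder.\<close>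

definition sum_measure :: "'x measure \<Rightarrow> 'x measure \<Rightarrow> 'x measure"
  where "sum_measure \<mu> \<nu> = measure_of (space \<mu>) (sets \<mu>) (\<lambda>S. emeasure \<mu> S + emeasure \<nu> S)"

lemma sets_sum_measure [simp]: "sets (sum_measure \<mu> \<nu>) = sets \<mu>"
  by (simp add: sum_measure_def)

lemma emeasure_sum_measure:
  assumes "sets \<nu> = sets \<mu>" "S \<in> sets \<mu>"
  shows "emeasure (sum_measure \<mu> \<nu>) S = emeasure \<mu> S + emeasure \<nu> S"
proof (rule emeasure_measure_of[OF sum_measure_def])
  show "countably_additive (sets (sum_measure \<mu> \<nu>)) (\<lambda>S. emeasure \<mu> S + emeasure \<nu> S)"
  proof (rule countably_additiveI)
    fix B :: "nat \<Rightarrow> 'a set"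
    assume B: "range B \<subseteq> sets (sum_measure \<mu> \<nu>)" "disjoint_family B"
    then have "(\<Sum>i. emeasure \<mu> (B i) + emeasure \<nu> (B i)) = (\<Sum>i. emeasure \<mu> (B i)) + (\<Sum>i. emeasure \<nu> (B i))"
      by (intro suminf_add[symmetric]) auto
    also have "\<dots> = emeasure \<mu> (\<Union>i. B i) + emeasure \<nu> (\<Union>i. B i)"
      using B assms by (simp add: suminf_emeasure)
    finally show "(\<Sum>i. emeasure \<mu> (B i) + emeasure \<nu> (B i)) = emeasure \<mu> (\<Union>i. B i) + emeasure \<nu> (\<Union>i. B i)" .
  qed
qed (use assms sets.space_closed in \<open>auto simp: positive_def\<close>)

lemma nn_integral_sum_measure:
  assumes sets: "sets \<nu> = sets \<mu>" and f: "f \<in> borel_measurable \<mu>"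
  shows "(\<integral>\<^sup>+x. f x \<partial>sum_measure \<mu> \<nu>) = (\<integral>\<^sup>+x. f x \<partial>\<mu>) + (\<integral>\<^sup>+x. f x \<partial>\<nu>)"
  using f
proof (induction rule: borel_measurable_induct)
  case (cong f g)
  have \<nu>: "space \<nu> = space \<mu>" by (rule sets_eq_imp_space_eq[OF sets])
  have \<sigma>: "space (sum_measure \<mu> \<nu>) = space \<mu>" by (rule sets_eq_imp_space_eq) simp
  have eq: "(\<integral>\<^sup>+x. f x \<partial>\<kappa>) = (\<integral>\<^sup>+x. g x \<partial>\<kappa>)" if "space \<kappa> = space \<mu>" for \<kappa>
    using cong(3) that by (intro nn_integral_cong) simp
  show ?case using cong(4) eq[OF \<nu>] eq[OF \<sigma>] eq[of \<mu>] by simp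
next
  case (set S)
  then show ?case using sets by (simp add: emeasure_sum_measure)
next
  case (mult u c)
  have "u \<in> borel_measurable \<nu>" "u \<in> borel_measurable (sum_measure \<mu> \<nu>)"
    using mult(2) sets by (simp_all cong: measurable_cong_sets)
  with mult show ?case by (simp add: nn_integral_cmult distrib_left)
next
  case (add u v)
  have "u \<in> borel_measurable \<nu>" "u \<in> borel_measurable (sum_measure \<mu> \<nu>)"
    "v \<in> borel_measurable \<nu>" "v \<in> borel_measurable (sum_measure \<mu> \<nu>)"
    using add sets by (simp_all cong: measurable_cong_sets)
  with add show ?case by (simp add: nn_integral_add ac_simps)
next
  case (seq U)
  have m: "U i \<in> borel_measurable \<nu>" "U i \<in> borel_measurable (sum_measure \<mu> \<nu>)" for i
    using seq(1)[of i] sets by (simp_all cong: measurable_cong_sets)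
  have inc: "incseq (\<lambda>i. \<integral>\<^sup>+x. U i x \<partial>\<kappa>)" for \<kappa>
    by (intro monoI nn_integral_mono le_funD[OF monoD[OF seq.hyps(3)]])
  have sup: "(\<integral>\<^sup>+x. (SUP i. U i) x \<partial>\<kappa>) = (SUP i. \<integral>\<^sup>+x. U i x \<partial>\<kappa>)"
    if "\<And>i. U i \<in> borel_measurable \<kappa>" for \<kappa>
    using nn_integral_monotone_convergence_SUP[OF seq.hyps(3) that] by (simp add: image_comp)
  have "(\<integral>\<^sup>+x. (SUP i. U i) x \<partial>sum_measure \<mu> \<nu>) = (SUP i. \<integral>\<^sup>+x. U i x \<partial>sum_measure \<mu> \<nu>)"
    by (rule sup[OF m(2)])
  also have "\<dots> = (SUP i. (\<integral>\<^sup>+x. U i x \<partial>\<mu>) + (\<integral>\<^sup>+x. U i x \<partial>\<nu>))"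
    by (simp only: seq.IH)
  also have "\<dots> = (SUP i. \<integral>\<^sup>+x. U i x \<partial>\<mu>) + (SUP i. \<integral>\<^sup>+x. U i x \<partial>\<nu>)"
    by (rule ennreal_SUP_add[OF inc inc])
  also have "\<dots> = (\<integral>\<^sup>+x. (SUP i. U i) x \<partial>\<mu>) + (\<integral>\<^sup>+x. (SUP i. U i) x \<partial>\<nu>)"
    by (simp only: sup[OF m(1)] sup[OF seq.hyps(1)])
  finally show ?case .
qed

lemma sets_borel_nonneg: "S \<in> sets borel_nonneg \<longleftrightarrow> S \<in> sets borel \<and> S \<subseteq> {0::real..}"
  by (auto simp: sets_restrict_space image_iff)

lemma Ioc_sets_borel_nonneg [simp]: "0 \<le> s \<Longrightarrow> {s<..t} \<in> sets borel_nonneg"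
  by (auto simp: sets_borel_nonneg)

text \<open>The specification shared by \<open>\<kappa>\<^sub>M\<close> and \<open>\<kappa>\<^sub>A\<close>, which differ only in the increments \<open>g\<close>.\<close>

definition halfline_measure :: "real measure \<Rightarrow> (real \<Rightarrow> real \<Rightarrow> ennreal) \<Rightarrow> bool"
  where "halfline_measure \<mu> g \<longleftrightarrow> sets \<mu> = sets borel_nonneg \<and> emeasure \<mu> {0} = 0 \<and>
    (\<forall>s t. 0 \<le> s \<and> s \<le> t \<longrightarrow> emeasure \<mu> {s<..t} = g s t)"

lemma halfline_measureD:
  assumes "halfline_measure \<mu> g"
  shows "sets \<mu> = sets borel_nonneg" "space \<mu> = {0..}" "emeasure \<mu> {0} = 0"
    "\<And>s t. 0 \<le> s \<Longrightarrow> s \<le> t \<Longrightarrow> emeasure \<mu> {s<..t} = g s t"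
  using assms sets_eq_imp_space_eq[of \<mu> borel_nonneg] by (simp_all add: halfline_measure_def)

text \<open>Transported to the whole line, both measures are determined by half-open intervals; an interval that
  meets the negative numbers contributes \<open>{0}\<close>, a null set, and an interval that starts at \<open>0\<close>.\<close>

lemma halfline_measure_unique:
  assumes \<mu>: "halfline_measure \<mu> g" and \<nu>: "halfline_measure \<nu> g"
    and fin: "\<And>t. 0 \<le> t \<Longrightarrow> g 0 t < \<infinity>"
  shows "\<mu> = \<nu>"
proof -
  let ?N = "\<lambda>\<kappa> :: real measure. distr \<kappa> borel (\<lambda>x. x)"
  have N: "emeasure (?N \<kappa>) S = emeasure \<kappa> (S \<inter> {0..})"
    if \<kappa>: "halfline_measure \<kappa> g" and S: "S \<in> sets borel" for \<kappa> S
  proof -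
    have "(\<lambda>x. x) \<in> measurable \<kappa> borel"
      unfolding measurable_cong_sets[OF halfline_measureD(1)[OF \<kappa>] refl]
      by (rule measurable_restrict_space1[OF measurable_ident_sets[OF refl]])
    from emeasure_distr[OF this S] show ?thesis by (simp add: halfline_measureD(2)[OF \<kappa>])
  qed
  define v where "v a b = (if b < 0 \<or> b \<le> a then 0 else g (max a 0) b)" for a b
  have v: "emeasure (?N \<kappa>) {a<..b} = v a b" if \<kappa>: "halfline_measure \<kappa> g" for \<kappa> a b
  proof -
    note k = halfline_measureD[OF \<kappa>]
    consider "b < 0 \<or> b \<le> a" | "0 \<le> a" "a < b" | "a < 0" "0 \<le> b" by linarith
    then have "emeasure \<kappa> ({a<..b} \<inter> {0..}) = v a b"
    proof cases
      case 1
      then have "{a<..b} \<inter> {0..} = {}" by auto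
      then show ?thesis using 1 by (simp add: v_def)
    next
      case 2
      then have "{a<..b} \<inter> {0..} = {a<..b}" by auto
      then show ?thesis using 2 k(4)[of a b] by (simp add: v_def)
    next
      case 3
      then have "{a<..b} \<inter> {0..} = {0} \<union> {0<..b}" by auto
      also have "emeasure \<kappa> \<dots> = emeasure \<kappa> {0} + emeasure \<kappa> {0<..b}"
        by (intro plus_emeasure[symmetric]) (auto simp: k(1) sets_borel_nonneg)
      finally show ?thesis using 3 k(3) k(4)[of 0 b] by (simp add: v_def)
    qed
    then show ?thesis by (simp add: N[OF \<kappa>])
  qed
  have "?N \<mu> = ?N \<nu>"
  proof (rule measure_eqI_generator_eq[where E = "range (\<lambda>(a, b). {a<..b})" and \<Omega> = UNIV
        and A = "\<lambda>n::nat. {- real n<..real n}"])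
    show "Int_stable (range (\<lambda>(a, b). {a<..b::real}))"
    proof (rule Int_stableI)
      fix S T :: "real set"
      assume "S \<in> range (\<lambda>(a, b). {a<..b})" "T \<in> range (\<lambda>(a, b). {a<..b})"
      then obtain a b c d where "S = {a<..b}" "T = {c<..d}" by auto
      then have "S \<inter> T = (\<lambda>(a, b). {a<..b}) (max a c, min b d)" by auto
      then show "S \<inter> T \<in> range (\<lambda>(a, b). {a<..b})" by (rule range_eqI)
    qed
    show "emeasure (?N \<mu>) S = emeasure (?N \<nu>) S" if "S \<in> range (\<lambda>(a, b). {a<..b})" for S
      using that v[OF \<mu>] v[OF \<nu>] by auto
    have "sets borel = sigma_sets UNIV (range (\<lambda>(a, b). {a<..b::real}))"
      unfolding borel_sigma_sets_Ioc by (rule sets_measure_of) simp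
    then show "sets (?N \<mu>) = sigma_sets UNIV (range (\<lambda>(a, b). {a<..b}))"
      "sets (?N \<nu>) = sigma_sets UNIV (range (\<lambda>(a, b). {a<..b}))" by simp_all
    show "(\<Union>n::nat. {- real n<..real n}) = UNIV"
    proof (intro equalityI subsetI)
      fix x :: real
      obtain n where "\<bar>x\<bar> < real n" using reals_Archimedean2 by blast
      then have "x \<in> {- real n<..real n}" by auto
      then show "x \<in> (\<Union>n::nat. {- real n<..real n})" by blast
    qed simp
    show "emeasure (?N \<mu>) {- real n<..real n} \<noteq> \<infinity>" for n
      unfolding v[OF \<mu>] using fin[of "real n"] by (simp add: v_def less_top)
  qed auto
  then have eq: "emeasure \<mu> (S \<inter> {0..}) = emeasure \<nu> (S \<inter> {0..})" if "S \<in> sets borel" for S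
    using N[OF \<mu> that] N[OF \<nu> that] by simp
  show ?thesis
  proof (rule measure_eqI)
    show "sets \<mu> = sets \<nu>" by (rule trans[OF halfline_measureD(1)[OF \<mu>] halfline_measureD(1)[OF \<nu>, symmetric]])
    fix S assume "S \<in> sets \<mu>"
    then have "S \<in> sets borel" "S \<inter> {0..} = S"
      unfolding halfline_measureD(1)[OF \<mu>] sets_borel_nonneg by blast+
    then show "emeasure \<mu> S = emeasure \<nu> S" using eq[of S] by (simp only:)
  qed
qed

lemma halfline_measure_ex:
  fixes f :: "real \<Rightarrow> real"
  assumes mono: "\<And>s t. 0 \<le> s \<Longrightarrow> s \<le> t \<Longrightarrow> f s \<le> f t"
    and right_cont: "\<And>a. 0 \<le> a \<Longrightarrow> (f \<longlongrightarrow> f a) (at_right a)"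
  shows "\<exists>\<mu>. halfline_measure \<mu> (\<lambda>s t. ennreal (f t - f s))"
proof -
  \<comment> \<open>extending \<open>f\<close> by a constant to the left produces no atom at \<open>0\<close>\<close>
  define F where "F x = f (max 0 x)" for x
  have F: "F x \<le> F y" if "x \<le> y" for x y using that by (auto simp: F_def intro!: mono)
  have cont: "continuous (at_right a) F" for a
  proof (cases "0 \<le> a")
    case True
    have "(F \<longlongrightarrow> f a) (at_right a)"
      by (rule Lim_transform_eventually[OF right_cont[OF True]])
        (use True eventually_at_right_less[of a] in \<open>auto elim!: eventually_mono simp: F_def\<close>)
    then show ?thesis using True by (simp add: continuous_within F_def)
  next
    case False
    have "\<forall>\<^sub>F x in at_right a. F x = F a"
      using False eventually_at_right[of a 0] by (auto simp: F_def intro!: exI[of _ 0])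
    then show ?thesis by (auto simp: continuous_within intro: tendsto_eventually elim: eventually_mono)
  qed
  let ?\<mu> = "restrict_space (interval_measure F) {0..}"
  have Ioc: "emeasure (interval_measure F) {a<..b} = ennreal (F b - F a)" if "a \<le> b" for a b
    by (rule emeasure_interval_measure_Ioc[OF that F cont])
  have em: "emeasure ?\<mu> S = emeasure (interval_measure F) S" if "S \<subseteq> {0..}" for S
    using that by (intro emeasure_restrict_space) auto
  have "halfline_measure ?\<mu> (\<lambda>s t. ennreal (f t - f s))"
    unfolding halfline_measure_def
  proof (intro conjI allI impI)
    show "sets ?\<mu> = sets borel_nonneg" by (rule sets_restrict_space_cong) simp
    have "emeasure (interval_measure F) {0} \<le> emeasure (interval_measure F) {-1<..0}"
      by (intro emeasure_mono) auto
    also have "\<dots> = 0" by (subst Ioc) (auto simp: F_def)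
    finally show "emeasure ?\<mu> {0} = 0" by (simp add: em)
    show "emeasure ?\<mu> {s<..t} = ennreal (f t - f s)" if "0 \<le> s \<and> s \<le> t" for s t
      using that by (subst em) (auto simp: Ioc F_def)
  qed
  then show ?thesis by blast
qed

lemma halfline_measure_right_continuous:
  assumes \<mu>: "sets \<mu> = sets borel_nonneg"
    and fin: "\<And>t. 0 \<le> t \<Longrightarrow> emeasure \<mu> {0<..t} < \<infinity>" and a: "0 \<le> a"
  shows "((\<lambda>t. measure \<mu> {0<..t}) \<longlongrightarrow> measure \<mu> {0<..a}) (at_right a)"
proof (rule tendsto_at_right_sequentially[of a "a + 1"])
  fix S :: "nat \<Rightarrow> real"
  assume S: "\<And>n. a < S n" "\<And>n. S n < a + 1" "decseq S" "S \<longlonglongrightarrow> a"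
  have "(\<lambda>n. emeasure \<mu> {0<..S n}) \<longlonglongrightarrow> emeasure \<mu> (\<Inter>n. {0<..S n})"
  proof (rule Lim_emeasure_decseq)
    show "decseq (\<lambda>n. {0<..S n})" using S(3) by (force simp: decseq_def)
    show "emeasure \<mu> {0<..S n} \<noteq> \<infinity>" for n
      using fin[of "S n"] S(1)[of n] a by (auto simp: less_top)
    show "range (\<lambda>n. {0<..S n}) \<subseteq> sets \<mu>" unfolding \<mu> by (rule image_subsetI) simp
  qed
  moreover have "(\<Inter>n. {0<..S n}) = {0<..a}"
  proof (intro set_eqI iffI)
    fix x assume "x \<in> (\<Inter>n. {0<..S n})"
    then have "0 < x" "\<And>n. x \<le> S n" by auto
    moreover from this(2) have "x \<le> a" by (intro LIMSEQ_le_const[OF S(4)]) simp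
    ultimately show "x \<in> {0<..a}" by simp
  next
    fix x assume "x \<in> {0<..a}"
    moreover have "a \<le> S n" for n using S(1)[of n] by simp
    ultimately show "x \<in> (\<Inter>n. {0<..S n})" by (simp add: order_trans[of x a])
  qed
  ultimately have "(\<lambda>n. emeasure \<mu> {0<..S n}) \<longlonglongrightarrow> emeasure \<mu> {0<..a}" by simp
  then show "(\<lambda>n. measure \<mu> {0<..S n}) \<longlonglongrightarrow> measure \<mu> {0<..a}"
    unfolding measure_def using fin[OF a] by (intro tendsto_enn2real) auto
qed simp

text \<open>An inequality between measures of intervals extends to all Borel sets: the difference of the
  distribution functions is the distribution function of a measure, and by uniqueness that
  measure is what \<open>\<mu>\<close> lacks of \<open>\<nu>\<close>.\<close>

lemma nn_integral_halfline_mono: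
  assumes \<mu>: "sets \<mu> = sets borel_nonneg" "emeasure \<mu> {0} = 0"
    and \<nu>: "sets \<nu> = sets borel_nonneg" "emeasure \<nu> {0} = 0"
    and fin: "\<And>t. 0 \<le> t \<Longrightarrow> emeasure \<nu> {0<..t} < \<infinity>"
    and le: "\<And>s t. 0 \<le> s \<Longrightarrow> s \<le> t \<Longrightarrow> emeasure \<mu> {s<..t} \<le> emeasure \<nu> {s<..t}"
    and h: "h \<in> borel_measurable borel_nonneg"
  shows "(\<integral>\<^sup>+x. h x \<partial>\<mu>) \<le> (\<integral>\<^sup>+x. h x \<partial>\<nu>)"
proof -
  define f where "f t = measure \<nu> {0<..t} - measure \<mu> {0<..t}" for t
  have fin': "emeasure \<mu> {0<..t} < \<infinity>" if "0 \<le> t" for t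
    using le[OF order_refl that] fin[OF that] by (rule le_less_trans)
  have inc: "emeasure \<kappa> {s<..t} = ennreal (measure \<kappa> {0<..t} - measure \<kappa> {0<..s})"
    if \<kappa>: "sets \<kappa> = sets borel_nonneg" "\<And>t. 0 \<le> t \<Longrightarrow> emeasure \<kappa> {0<..t} < \<infinity>"
      and st: "0 \<le> s" "s \<le> t" for \<kappa> s t
  proof -
    have "emeasure \<kappa> {0<..t} = emeasure \<kappa> ({0<..s} \<union> {s<..t})"
      using st by (intro arg_cong[of _ _ "emeasure \<kappa>"]) auto
    also have "\<dots> = emeasure \<kappa> {0<..s} + emeasure \<kappa> {s<..t}"
      using st \<kappa>(1) by (intro plus_emeasure[symmetric]) auto
    finally have eq: "emeasure \<kappa> {0<..t} = emeasure \<kappa> {0<..s} + emeasure \<kappa> {s<..t}" .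
    then have "emeasure \<kappa> {s<..t} < \<infinity>" using \<kappa>(2)[of t] st by (auto simp: less_top)
    then show ?thesis using eq \<kappa>(2)[of s] \<kappa>(2)[of t] st
      by (auto simp: measure_def enn2real_plus less_top)
  qed
  have mle: "measure \<mu> {0<..t} - measure \<mu> {0<..s} \<le> measure \<nu> {0<..t} - measure \<nu> {0<..s}"
    and mmono: "measure \<mu> {0<..s} \<le> measure \<mu> {0<..t}"
    if "0 \<le> s" "s \<le> t" for s t
  proof -
    have mono: "measure \<kappa> {0<..s} \<le> measure \<kappa> {0<..t}"
      if "sets \<kappa> = sets borel_nonneg" "emeasure \<kappa> {0<..t} < \<infinity>" for \<kappa>
      unfolding measure_def using that \<open>s \<le> t\<close>
      by (intro enn2real_mono emeasure_mono) auto
    show "measure \<mu> {0<..s} \<le> measure \<mu> {0<..t}"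
      by (rule mono[OF \<mu>(1) fin']) (use that in simp)
    have n: "measure \<nu> {0<..s} \<le> measure \<nu> {0<..t}"
      by (rule mono[OF \<nu>(1) fin]) (use that in simp)
    have "ennreal (measure \<mu> {0<..t} - measure \<mu> {0<..s}) \<le> ennreal (measure \<nu> {0<..t} - measure \<nu> {0<..s})"
      using le[OF that] inc[OF \<mu>(1) fin' that] inc[OF \<nu>(1) fin that] by simp
    then show "measure \<mu> {0<..t} - measure \<mu> {0<..s} \<le> measure \<nu> {0<..t} - measure \<nu> {0<..s}"
      using n by simp
  qed
  have "\<exists>\<rho>. halfline_measure \<rho> (\<lambda>s t. ennreal (f t - f s))"
  proof (rule halfline_measure_ex)
    show "f s \<le> f t" if "0 \<le> s" "s \<le> t" for s t
      using mle[OF that] by (simp add: f_def)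
    show "(f \<longlongrightarrow> f a) (at_right a)" if "0 \<le> a" for a
      unfolding f_def using that
      by (intro tendsto_diff halfline_measure_right_continuous \<mu> \<nu> fin fin')
  qed
  then obtain \<rho> where \<rho>: "halfline_measure \<rho> (\<lambda>s t. ennreal (f t - f s))" by blast
  have "halfline_measure \<nu> (\<lambda>s t. emeasure \<nu> {s<..t})"
    using \<nu> by (simp add: halfline_measure_def)
  moreover have "halfline_measure (sum_measure \<mu> \<rho>) (\<lambda>s t. emeasure \<nu> {s<..t})"
    unfolding halfline_measure_def
  proof (intro conjI allI impI)
    have sets: "sets \<rho> = sets \<mu>" using halfline_measureD(1)[OF \<rho>] \<mu>(1) by simp
    show "sets (sum_measure \<mu> \<rho>) = sets borel_nonneg" using \<mu> by simp
    have "{0} \<in> sets \<mu>" using \<mu>(1) by (simp add: sets_borel_nonneg)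
    then show "emeasure (sum_measure \<mu> \<rho>) {0} = 0"
      using \<mu> halfline_measureD(3)[OF \<rho>] by (simp add: emeasure_sum_measure[OF sets])
    fix s t :: real assume st: "0 \<le> s \<and> s \<le> t"
    then have "{s<..t} \<in> sets \<mu>" using \<mu>(1) by simp
    then have "emeasure (sum_measure \<mu> \<rho>) {s<..t} = emeasure \<mu> {s<..t} + ennreal (f t - f s)"
      using halfline_measureD(4)[OF \<rho>] st by (simp add: emeasure_sum_measure[OF sets])
    also have "\<dots> = emeasure \<nu> {s<..t}"
      using st mle[of s t] mmono[of s t] inc[OF \<mu>(1) fin', of s t] inc[OF \<nu>(1) fin, of s t]
      by (simp add: f_def ennreal_plus[symmetric] del: ennreal_plus)
    finally show "emeasure (sum_measure \<mu> \<rho>) {s<..t} = emeasure \<nu> {s<..t}" .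
  qed
  ultimately have "\<nu> = sum_measure \<mu> \<rho>" by (rule halfline_measure_unique) (rule fin)
  moreover have "h \<in> borel_measurable \<mu>" using h \<mu>(1) by (simp cong: measurable_cong_sets)
  ultimately have "(\<integral>\<^sup>+x. h x \<partial>\<nu>) = (\<integral>\<^sup>+x. h x \<partial>\<mu>) + (\<integral>\<^sup>+x. h x \<partial>\<rho>)"
    using halfline_measureD(1)[OF \<rho>] \<mu>(1) by (simp add: nn_integral_sum_measure)
  then show ?thesis by simp
qed

lemma borel_measurable_halfline:
  assumes "sets \<mu> = sets borel_nonneg" "f \<in> borel_measurable borel_nonneg"
  shows "f \<in> borel_measurable \<mu>"
  using assms(2) unfolding measurable_cong_sets[OF assms(1) refl] .

text \<open>The estimate on intervals compares \<open>\<kappa>'\<close> with the measure of density \<open>w\<close> with respect to \<open>\<kappa>\<close>.\<close>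

lemma nn_integral_dominated:
  assumes \<kappa>': "halfline_measure \<kappa>' g'" and \<kappa>: "halfline_measure \<kappa> g"
    and w: "w \<in> borel_measurable borel_nonneg" and h: "h \<in> borel_measurable borel_nonneg"
    and fin: "\<And>t. 0 \<le> t \<Longrightarrow> (\<integral>\<^sup>+u\<in>{0<..t}. w u \<partial>\<kappa>) < \<infinity>"
    and le: "\<And>s t. 0 \<le> s \<Longrightarrow> s \<le> t \<Longrightarrow> g' s t \<le> (\<integral>\<^sup>+u\<in>{s<..t}. w u \<partial>\<kappa>)"
  shows "(\<integral>\<^sup>+u. h u \<partial>\<kappa>') \<le> (\<integral>\<^sup>+u. w u * h u \<partial>\<kappa>)"
proof -
  let ?\<nu> = "density \<kappa> w"
  note k = halfline_measureD[OF \<kappa>] and k' = halfline_measureD[OF \<kappa>']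
  note w' = borel_measurable_halfline[OF k(1) w]
  have em: "emeasure ?\<nu> S = (\<integral>\<^sup>+u\<in>S. w u \<partial>\<kappa>)" if "S \<in> sets borel_nonneg" for S
    by (rule emeasure_density[OF w']) (simp only: k(1) that)
  have "{0} \<in> null_sets \<kappa>"
    using k(3) by (intro null_setsI) (simp_all add: k(1) sets_borel_nonneg)
  then have zero: "emeasure ?\<nu> {0} = 0"
    by (subst em) (simp_all add: sets_borel_nonneg nn_integral_null_set)
  have Ioc: "{s<..t} \<in> sets borel_nonneg" if "0 \<le> s" for s t using that by simp
  have "(\<integral>\<^sup>+u. h u \<partial>\<kappa>') \<le> (\<integral>\<^sup>+u. h u \<partial>?\<nu>)"
  proof (rule nn_integral_halfline_mono[OF k'(1) k'(3) _ zero _ _ h])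
    show "sets ?\<nu> = sets borel_nonneg" by (simp only: sets_density k(1))
    show "emeasure ?\<nu> {0<..t} < \<infinity>" if "0 \<le> t" for t
      unfolding em[OF Ioc[OF order_refl]] by (rule fin[OF that])
    show "emeasure \<kappa>' {s<..t} \<le> emeasure ?\<nu> {s<..t}" if "0 \<le> s" "s \<le> t" for s t
      unfolding em[OF Ioc[OF that(1)]] k'(4)[OF that] by (rule le[OF that])
  qed
  also have "\<dots> = (\<integral>\<^sup>+u. w u * h u \<partial>\<kappa>)"
    by (rule nn_integral_density[OF w' borel_measurable_halfline[OF k(1) h]])
  finally show ?thesis .
qed

section \<open>Uniqueness of the decomposition and the measures of a decomposable process\<close>

lemma norm_sum_orthogonal_increments:
  fixes x :: "nat \<Rightarrow> 'v::real_inner"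
  assumes "\<And>j. j < n \<Longrightarrow> x j \<bullet> (\<Sum>i<j. x i) = 0"
  shows "(norm (\<Sum>i<n. x i))\<^sup>2 = (\<Sum>i<n. (norm (x i))\<^sup>2)"
  using assms
proof (induction n)
  case (Suc n)
  then have "x n \<bullet> (\<Sum>i<n. x i) = 0" by simp
  then have "(norm (\<Sum>i<Suc n. x i))\<^sup>2 = (norm (\<Sum>i<n. x i))\<^sup>2 + (norm (x n))\<^sup>2"
    by (simp add: power2_norm_eq_inner inner_add_left inner_add_right inner_commute)
  with Suc show ?case by simp
qed simp

lemma martingale_increment_orthogonal:
  assumes "filtration F" "L2_martingale F M" "0 \<le> s" "s \<le> t" "z \<in> L2_of (F s)"
  shows "(M t - M s) \<bullet> z = 0"
  using cond_expec_orth[OF filtration_subalgebra[OF assms(1,3)] assms(5), of "M t"] assms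
  by (simp add: L2_martingale_def)

text \<open>Pythagoras, since \<open>M t - M s\<close> is orthogonal to \<open>M s\<close>; this makes \<open>t \<mapsto> \<parallel>M(t)\<parallel>\<^sup>2\<close> a distribution
  function of \<open>\<kappa>\<^sub>M\<close>.\<close>

lemma martingale_norm_increment:
  assumes "filtration F" "L2_martingale F M" "0 \<le> s" "s \<le> t"
  shows "(norm (M t - M s))\<^sup>2 = (norm (M t))\<^sup>2 - (norm (M s))\<^sup>2"
proof -
  have "(M t - M s) \<bullet> M s = 0"
    using assms by (intro martingale_increment_orthogonal) (auto simp: L2_martingale_def adapted_def)
  then show ?thesis
    by (simp add: power2_norm_eq_inner inner_diff_left inner_diff_right inner_commute)
qed

lemma adapted_diff:
  assumes "filtration F" "adapted F X" "adapted F Y"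
  shows "adapted F (\<lambda>t. X t - Y t)"
  unfolding adapted_def
proof (intro allI impI)
  fix t :: real assume t: "0 \<le> t"
  show "X t - Y t \<in> L2_of (F t)"
    using assms(2,3) t
    by (intro subspace_diff[OF subspace_L2_of[OF filtration_subalgebra[OF assms(1) t]]])
      (simp_all add: adapted_def)
qed

lemma L2_martingale_diff:
  assumes "filtration F" "L2_martingale F M" "L2_martingale F N"
  shows "L2_martingale F (\<lambda>t. M t - N t)"
  unfolding L2_martingale_def
  using assms(2,3) cond_expec_diff[OF filtration_subalgebra[OF assms(1)]]
  by (simp add: L2_martingale_def adapted_diff[OF assms(1)])

text \<open>A continuous martingale of locally bounded variation is constant: its squared norm is the sum
  of its squared increments, hence at most the mesh of the increments times the variation.\<close>

lemma martingale_bounded_variation_zero: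
  assumes F: "filtration F" and N: "L2_martingale F N" "continuous_on {0..} N" "N 0 = 0"
    and bv: "locally_bounded_variation N" and t: "0 \<le> t"
  shows "N t = 0"
proof (cases "t = 0")
  case False
  with t have t: "t > 0" by simp
  define V where "V = enn2real (variation N 0 t)"
  have V: "variation N 0 t = ennreal V" "0 \<le> V"
    using bv t by (auto simp: V_def locally_bounded_variation_def less_top)
  have bound: "(norm (N t))\<^sup>2 \<le> e * V" if e: "e > 0" for e
  proof -
    have "uniformly_continuous_on {0..t} N"
      by (intro compact_uniformly_continuous continuous_on_subset[OF N(2)]) auto
    then obtain d where d: "d > 0"
      "\<And>u v. u \<in> {0..t} \<Longrightarrow> v \<in> {0..t} \<Longrightarrow> dist v u < d \<Longrightarrow> dist (N v) (N u) < e"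
      using e unfolding uniformly_continuous_on_def by metis
    obtain n :: nat where n: "t / d < real n" using reals_Archimedean2 by blast
    with t d(1) have n0: "n > 0" by (cases n) (auto simp: divide_less_0_iff not_less[symmetric])
    have mesh: "t / real n < d" using n n0 d(1) t by (simp add: field_simps)
    define p where "p i = real i * (t / real n)" for i
    have "mono_on {..n} p"
      unfolding p_def using t by (intro mono_onI mult_right_mono) simp_all
    moreover have "p 0 = 0" "p n = t" using n0 by (simp_all add: p_def)
    ultimately have p: "mono_on {..n} p" "p 0 = 0" "p n = t" by this
    note b = partition_bounds[OF p] partition_step[OF p(1)]
    have step: "norm (N (p (Suc i)) - N (p i)) \<le> e" if "i < n" for i
    proof -
      have "p (Suc i) = p i + t / real n" by (simp add: p_def distrib_right add_divide_distrib)
      then have "dist (p (Suc i)) (p i) < d" using mesh t by (simp add: dist_real_def)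
      then show ?thesis
        using d(2)[of "p i" "p (Suc i)"] b(1,2)[of i] b(1,2)[of "Suc i"] that
        by (simp add: dist_norm)
    qed
    have tel: "(\<Sum>i<j. N (p (Suc i)) - N (p i)) = N (p j)" for j
      using sum_lessThan_telescope[of "\<lambda>i. N (p i)" j] N(3) p(2) by simp
    have "(norm (N t))\<^sup>2 = (norm (\<Sum>i<n. N (p (Suc i)) - N (p i)))\<^sup>2"
      unfolding tel p(3) ..
    also have "\<dots> = (\<Sum>i<n. (norm (N (p (Suc i)) - N (p i)))\<^sup>2)"
    proof (rule norm_sum_orthogonal_increments)
      fix j assume j: "j < n"
      show "(N (p (Suc j)) - N (p j)) \<bullet> (\<Sum>i<j. N (p (Suc i)) - N (p i)) = 0"
        unfolding tel using b(1,3)[of j] j N(1)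
        by (intro martingale_increment_orthogonal[OF F N(1)])
          (auto simp: L2_martingale_def adapted_def)
    qed
    also have "\<dots> \<le> (\<Sum>i<n. e * norm (N (p (Suc i)) - N (p i)))"
      unfolding power2_eq_square using step by (intro sum_mono mult_right_mono) auto
    also have "\<dots> = e * (\<Sum>i<n. norm (N (p (Suc i)) - N (p i)))" by (simp add: sum_distrib_left)
    also have "\<dots> \<le> e * V"
    proof -
      have "ennreal (\<Sum>i<n. norm (N (p (Suc i)) - N (p i))) \<le> ennreal V"
        using variation_upper[OF p, of N] V(1) by simp
      then show ?thesis using e V(2) by (simp add: ennreal_le_iff)
    qed
    finally show ?thesis .
  qed
  have "(norm (N t))\<^sup>2 \<le> 0 + e" if "e > 0" for e
  proof -
    have "(norm (N t))\<^sup>2 \<le> e / (V + 1) * V" using that V(2) by (intro bound) simp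
    also have "\<dots> \<le> e" using that V(2) by (simp add: field_simps)
    finally show ?thesis by simp
  qed
  then have "(norm (N t))\<^sup>2 \<le> 0" by (rule field_le_epsilon)
  then show ?thesis by simp
qed (use N in simp)

lemma L2_decompositionD:
  assumes "L2_decomposition F X M A"
  shows "adapted F X" "\<And>t. 0 \<le> t \<Longrightarrow> X t = X 0 + M t + A t"
    "L2_martingale F M" "continuous_on {0..} M"
    "adapted F A" "continuous_on {0..} A" "locally_bounded_variation A" "M 0 = 0" "A 0 = 0"
  using assms unfolding L2_decomposition_def by blast+

text \<open>The difference of the two martingale parts is also the difference of the two finite variation
  parts, so it is a continuous martingale of locally bounded variation starting at \<open>0\<close>.\<close>

lemma L2_decomposition_unique:
  assumes F: "filtration F"
    and D: "L2_decomposition F X M A" and D': "L2_decomposition F X M' A'" and t: "0 \<le> t"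
  shows "M t = M' t" "A t = A' t"
proof -
  let ?N = "\<lambda>t. M t - M' t"
  have eq: "?N u = A' u - A u" if "0 \<le> u" for u
  proof -
    have "X u = X 0 + M u + A u" "X u = X 0 + M' u + A' u"
      using L2_decompositionD(2)[OF D that] L2_decompositionD(2)[OF D' that] by this
    then have "M u + A u = M' u + A' u" by (metis add.assoc add_left_cancel)
    then show ?thesis by (simp add: algebra_simps)
  qed
  have bv: "locally_bounded_variation ?N"
    unfolding locally_bounded_variation_def
  proof (intro allI impI)
    fix s t :: real assume st: "0 \<le> s \<and> s \<le> t"
    have "variation ?N s t \<le> variation A' s t + variation A s t"
    proof (rule variation_le_of_increments[where g = "\<lambda>s t. variation A' s t + variation A s t"])
      fix u v assume uv: "s \<le> u" "u \<le> v" "v \<le> t"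
      have "?N v - ?N u = (A' v - A' u) - (A v - A u)" using eq[of u] eq[of v] uv st by simp
      then have "norm (?N v - ?N u) \<le> norm (A' v - A' u) + norm (A v - A u)"
        by (simp only: norm_triangle_ineq4)
      then have "ennreal (norm (?N v - ?N u)) \<le> ennreal (norm (A' v - A' u)) + ennreal (norm (A v - A u))"
        by (simp flip: ennreal_plus add: ennreal_leI)
      also have "\<dots> \<le> variation A' u v + variation A u v"
        by (intro add_mono norm_increment_le_variation uv)
      finally show "ennreal (norm (?N v - ?N u)) \<le> variation A' u v + variation A u v" .
    next
      fix u v w assume "s \<le> u" "u \<le> v" "v \<le> w" "w \<le> t"
      then show "variation A' u v + variation A u v + (variation A' v w + variation A v w)
        \<le> variation A' u w + variation A u w"
        using variation_add[of u v w A] variation_add[of u v w A'] by (simp add: ac_simps)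
    qed
    also have "\<dots> < \<infinity>"
      using L2_decompositionD(7)[OF D] L2_decompositionD(7)[OF D'] st
      by (simp add: locally_bounded_variation_def)
    finally show "variation ?N s t < \<infinity>" .
  qed
  have "?N t = 0"
    by (rule martingale_bounded_variation_zero
        [OF F L2_martingale_diff[OF F L2_decompositionD(3)[OF D] L2_decompositionD(3)[OF D']]
          continuous_on_diff[OF L2_decompositionD(4)[OF D] L2_decompositionD(4)[OF D']] _ bv t])
      (simp add: L2_decompositionD(8)[OF D] L2_decompositionD(8)[OF D'])
  then show "M t = M' t" "A t = A' t" using eq[OF t] by simp_all
qed

lemma halfline_measure_the:
  assumes "halfline_measure \<mu> g" "\<And>t. 0 \<le> t \<Longrightarrow> g 0 t < \<infinity>"
  shows "halfline_measure (THE \<mu>. halfline_measure \<mu> g) g"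
  by (rule theI[of _ \<mu>]) (use halfline_measure_unique assms in blast)+

lemma kappa_mart_eq_the:
  "kappa_mart M = (THE \<mu>. halfline_measure \<mu> (\<lambda>s t. ennreal ((norm (M t - M s))\<^sup>2)))"
  by (simp add: kappa_mart_def halfline_measure_def)

lemma kappa_fv_eq_the: "kappa_fv A = (THE \<mu>. halfline_measure \<mu> (variation A))"
  by (simp add: kappa_fv_def halfline_measure_def)

lemma halfline_measure_kappa_mart:
  assumes F: "filtration F" and M: "L2_martingale F M" "continuous_on {0..} M"
  shows "halfline_measure (kappa_mart M) (\<lambda>s t. ennreal ((norm (M t - M s))\<^sup>2))"
proof -
  have "\<exists>\<mu>. halfline_measure \<mu> (\<lambda>s t. ennreal ((norm (M t))\<^sup>2 - (norm (M s))\<^sup>2))"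
  proof (rule halfline_measure_ex)
    show "(norm (M s))\<^sup>2 \<le> (norm (M t))\<^sup>2" if "0 \<le> s" "s \<le> t" for s t
      using martingale_norm_increment[OF F M(1) that] by (metis diff_ge_0_iff_ge zero_le_power2)
    show "((\<lambda>t. (norm (M t))\<^sup>2) \<longlongrightarrow> (norm (M a))\<^sup>2) (at_right a)" if "0 \<le> a" for a
    proof -
      have "(M \<longlongrightarrow> M a) (at a within {0..})" using M(2) that by (simp add: continuous_on_def)
      then have "(M \<longlongrightarrow> M a) (at_right a)"
        by (rule tendsto_within_subset) (use that in auto)
      then show ?thesis by (intro tendsto_intros)
    qed
  qed
  then obtain \<mu> where "halfline_measure \<mu> (\<lambda>s t. ennreal ((norm (M t))\<^sup>2 - (norm (M s))\<^sup>2))" ..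
  then have "halfline_measure \<mu> (\<lambda>s t. ennreal ((norm (M t - M s))\<^sup>2))"
    using martingale_norm_increment[OF F M(1)] by (simp add: halfline_measure_def)
  from halfline_measure_the[OF this] show ?thesis by (simp add: kappa_mart_eq_the)
qed

lemma halfline_measure_kappa_fv:
  assumes cont: "continuous_on {0..} A" and bv: "locally_bounded_variation A"
  shows "halfline_measure (kappa_fv A) (variation A)"
proof -
  let ?f = "\<lambda>t. enn2real (variation A 0 t)"
  have fin: "variation A s t < \<infinity>" if "0 \<le> s" "s \<le> t" for s t
    using bv that by (simp add: locally_bounded_variation_def)
  have inc: "?f t = ?f s + enn2real (variation A s t)" if "0 \<le> s" "s \<le> t" for s t
    using variation_add[OF that, of A] fin[OF that] fin[of 0 s] that
    by (metis enn2real_plus infinity_ennreal_def order_refl)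
  have "\<exists>\<mu>. halfline_measure \<mu> (\<lambda>s t. ennreal (?f t - ?f s))"
  proof (rule halfline_measure_ex)
    show "?f s \<le> ?f t" if "0 \<le> s" "s \<le> t" for s t using inc[OF that] by simp
    show "(?f \<longlongrightarrow> ?f a) (at_right a)" if a: "0 \<le> a" for a
    proof -
      have "((\<lambda>t. enn2real (variation A a t)) \<longlongrightarrow> 0) (at_right a)"
        using variation_right_continuous[OF cont bv a] by (intro tendsto_enn2real) simp_all
      then have lim: "((\<lambda>t. ?f a + enn2real (variation A a t)) \<longlongrightarrow> ?f a + 0) (at_right a)"
        by (intro tendsto_add tendsto_const)
      have "\<forall>\<^sub>F t in at_right a. ?f a + enn2real (variation A a t) = ?f t"
      proof (rule eventually_mono[OF eventually_at_right_less])
        fix t assume "a < t"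
        then show "?f a + enn2real (variation A a t) = ?f t" using inc[OF a, of t] by simp
      qed
      from Lim_transform_eventually[OF lim this] show ?thesis by simp
    qed
  qed
  then obtain \<mu> where \<mu>: "halfline_measure \<mu> (\<lambda>s t. ennreal (?f t - ?f s))" ..
  have "ennreal (?f t - ?f s) = variation A s t" if "0 \<le> s" "s \<le> t" for s t
    using inc[OF that] fin[OF that] by simp
  with \<mu> have "halfline_measure \<mu> (variation A)" by (simp add: halfline_measure_def)
  from halfline_measure_the[OF this] fin show ?thesis by (simp add: kappa_fv_eq_the)
qed

text \<open>Only times \<open>t \<ge> 0\<close> matter for \<open>\<kappa>\<close>. Thus the unspecified values at negative times of the chosen
  parts of a decomposition do not influence the measures, and any decomposition can be used.\<close>

lemma kappa_mart_cong:
  assumes "\<And>t. 0 \<le> t \<Longrightarrow> M t = M' t"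
  shows "kappa_mart M = kappa_mart M'"
  unfolding kappa_mart_def using assms
  by (intro arg_cong[of _ _ The] ext conj_cong refl all_cong) auto

lemma kappa_fv_cong:
  assumes "\<And>t. 0 \<le> t \<Longrightarrow> A t = A' t"
  shows "kappa_fv A = kappa_fv A'"
proof -
  have "variation A s t = variation A' s t" if "0 \<le> s" for s t
    using assms that by (intro variation_cong) simp
  then show ?thesis unfolding kappa_fv_def
    by (intro arg_cong[of _ _ The] ext conj_cong refl all_cong) auto
qed

lemma
  assumes F: "filtration F" and D: "L2_decomposition F X M A"
  shows kappa_mart_part: "kappa_mart (mart_part F X) = kappa_mart M"
    and kappa_fv_part: "kappa_fv (fv_part F X) = kappa_fv A"
proof -
  have "\<exists>A. L2_decomposition F X (mart_part F X) A"
    unfolding mart_part_def by (rule someI_ex[of "\<lambda>M. \<exists>A. L2_decomposition F X M A"]) (use D in blast)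
  then show "kappa_mart (mart_part F X) = kappa_mart M"
    using L2_decomposition_unique(1)[OF F _ D] by (auto intro!: kappa_mart_cong)
  have "\<exists>M. L2_decomposition F X M (fv_part F X)"
    unfolding fv_part_def by (rule someI_ex[of "\<lambda>A. \<exists>M. L2_decomposition F X M A"]) (use D in blast)
  then show "kappa_fv (fv_part F X) = kappa_fv A"
    using L2_decomposition_unique(2)[OF F _ D] by (auto intro!: kappa_fv_cong)
qed

lemma
  assumes F: "filtration F" and D: "L2_decomposition F X M A"
  shows halfline_measure_decomposition_mart:
      "halfline_measure (kappa_mart M) (\<lambda>s t. ennreal ((norm (M t - M s))\<^sup>2))"
    and halfline_measure_decomposition_fv: "halfline_measure (kappa_fv A) (variation A)"
  by (intro halfline_measure_kappa_fv halfline_measure_kappa_mart[OF F] L2_decompositionD[OF D])+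

lemma nn_integral_kappa:
  assumes F: "filtration F" and D: "L2_decomposition F X M A"
    and f: "f \<in> borel_measurable borel_nonneg"
  shows "(\<integral>\<^sup>+s. f s \<partial>kappa F X) = (\<integral>\<^sup>+s. f s \<partial>kappa_mart M) + (\<integral>\<^sup>+s. f s \<partial>kappa_fv A)"
proof -
  note \<mu> = halfline_measureD[OF halfline_measure_decomposition_mart[OF F D]]
  note \<alpha> = halfline_measureD[OF halfline_measure_decomposition_fv[OF F D]]
  have "kappa F X = sum_measure (kappa_mart M) (kappa_fv A)"
    unfolding kappa_def sum_measure_def kappa_mart_part[OF F D] kappa_fv_part[OF F D]
    by (simp only: \<mu>(1,2))
  moreover have "f \<in> borel_measurable (kappa_mart M)"
    using f by (simp only: measurable_cong_sets[OF \<mu>(1) refl])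
  ultimately show ?thesis
    using nn_integral_sum_measure[of "kappa_fv A" "kappa_mart M" f] by (simp only: \<mu>(1) \<alpha>(1))
qed

section \<open>Strong measurability and the energy of a process\<close>

lemma strongly_measurable_simple:
  assumes "simple_function borel_nonneg H"
  shows "strongly_measurable H"
  unfolding strongly_measurable_def
proof (rule exI[of _ "\<lambda>_. H"], intro conjI allI impI)
  show "simple_function borel_nonneg H" by (rule assms)
  show "(\<lambda>n. H t) \<longlonglongrightarrow> H t" for t by (rule tendsto_const)
qed

lemma strongly_measurable_const: "strongly_measurable (\<lambda>_. c)"
  by (rule strongly_measurable_simple[OF simple_function_const])

lemma strongly_measurable_compose2:
  assumes F: "strongly_measurable F" and G: "strongly_measurable G"
    and h: "\<And>a b x y. a \<longlonglongrightarrow> x \<Longrightarrow> b \<longlonglongrightarrow> y \<Longrightarrow> (\<lambda>n. h (a n) (b n)) \<longlonglongrightarrow> h x y"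
  shows "strongly_measurable (\<lambda>s. h (F s) (G s))"
proof -
  obtain S where S: "\<And>n. simple_function borel_nonneg (S n)" "\<And>t. 0 \<le> t \<Longrightarrow> (\<lambda>n. S n t) \<longlonglongrightarrow> F t"
    using F unfolding strongly_measurable_def by blast
  obtain R where R: "\<And>n. simple_function borel_nonneg (R n)" "\<And>t. 0 \<le> t \<Longrightarrow> (\<lambda>n. R n t) \<longlonglongrightarrow> G t"
    using G unfolding strongly_measurable_def by blast
  show ?thesis
    unfolding strongly_measurable_def
  proof (rule exI[of _ "\<lambda>n s. h (S n s) (R n s)"], intro conjI allI impI)
    show "simple_function borel_nonneg (\<lambda>s. h (S n s) (R n s))" for n
      by (rule simple_function_compose2[OF S(1) R(1)])
    show "(\<lambda>n. h (S n t) (R n t)) \<longlonglongrightarrow> h (F t) (G t)" if "0 \<le> t" for t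
      by (rule h[OF S(2)[OF that] R(2)[OF that]])
  qed
qed

lemma strongly_measurable_diff:
  "strongly_measurable F \<Longrightarrow> strongly_measurable G \<Longrightarrow> strongly_measurable (\<lambda>s. F s - G s)"
  by (rule strongly_measurable_compose2[where h = "(-)"]) (assumption | rule tendsto_diff)+

lemma strongly_measurable_compose_blinfun:
  "strongly_measurable F \<Longrightarrow> strongly_measurable G \<Longrightarrow> strongly_measurable (\<lambda>s. F s o\<^sub>L G s)"
  by (rule strongly_measurable_compose2[where h = "(o\<^sub>L)"])
    (assumption | rule bounded_bilinear.tendsto[OF bounded_bilinear_blinfun_compose])+

lemma strongly_measurable_norm:
  assumes "strongly_measurable H"
  shows "(\<lambda>s. norm (H s)) \<in> borel_measurable borel_nonneg"
proof -
  obtain S where S: "\<And>n. simple_function borel_nonneg (S n)" "\<And>t. 0 \<le> t \<Longrightarrow> (\<lambda>n. S n t) \<longlonglongrightarrow> H t"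
    using assms unfolding strongly_measurable_def by blast
  show ?thesis
  proof (rule borel_measurable_LIMSEQ_metric)
    show "(\<lambda>s. norm (S n s)) \<in> borel_measurable borel_nonneg" for n
      by (rule borel_measurable_simple_function[OF simple_function_compose1[OF S(1)]])
    show "(\<lambda>n. norm (S n s)) \<longlonglongrightarrow> norm (H s)" if "s \<in> space borel_nonneg" for s
      using that by (intro tendsto_norm S(2)) (simp add: space_restrict_space)
  qed
qed

text \<open>The convergence in the hypothesis of the theorem is formulated with the squared \<open>L\<^sup>2\<close> part, and
  this is easier to handle than the seminorm: it yields the same notions of finiteness and of
  convergence, and for the quasi-triangle inequality that replaces Minkowski's, the elementary
  \<open>(a + b)\<^sup>2 \<le> 2 a\<^sup>2 + 2 b\<^sup>2\<close> suffices.\<close>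

definition energy :: "real measure \<Rightarrow> real measure \<Rightarrow> real \<Rightarrow> (real \<Rightarrow> 'v::real_normed_vector) \<Rightarrow> ennreal"
  where "energy \<mu> \<alpha> t H = (\<integral>\<^sup>+ s\<in>{0<..t}. ennreal ((norm (H s))\<^sup>2) \<partial>\<mu>) + (\<integral>\<^sup>+ s\<in>{0<..t}. ennreal (norm (H s)) \<partial>\<alpha>)"

abbreviation (input) "energy_of M A \<equiv> energy (kappa_mart M) (kappa_fv A)"

lemma energy_mono_time:
  assumes "t \<le> t'"
  shows "energy \<mu> \<alpha> t H \<le> energy \<mu> \<alpha> t' H"
  unfolding energy_def
  by (intro add_mono nn_integral_mono mult_left_mono) (use assms in \<open>auto simp: indicator_def\<close>)

lemma
  assumes \<mu>: "sets \<mu> = sets borel_nonneg" and F: "strongly_measurable F" and I: "I \<in> sets borel_nonneg"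
  shows measurable_norm_on: "(\<lambda>s. ennreal (norm (F s)) * indicator I s) \<in> borel_measurable \<mu>"
    and measurable_norm_square_on: "(\<lambda>s. ennreal ((norm (F s))\<^sup>2) * indicator I s) \<in> borel_measurable \<mu>"
proof -
  note m = borel_measurable_halfline[OF \<mu> strongly_measurable_norm[OF F]]
  have ind: "(indicator I :: real \<Rightarrow> ennreal) \<in> borel_measurable \<mu>"
    using I unfolding \<mu>[symmetric] by (rule borel_measurable_indicator)
  show "(\<lambda>s. ennreal (norm (F s)) * indicator I s) \<in> borel_measurable \<mu>"
    by (rule borel_measurable_times_ennreal[OF measurable_compose[OF m measurable_ennreal] ind])
  show "(\<lambda>s. ennreal ((norm (F s))\<^sup>2) * indicator I s) \<in> borel_measurable \<mu>"
    by (rule borel_measurable_times_ennreal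
        [OF measurable_compose[OF borel_measurable_power[OF m] measurable_ennreal] ind])
qed

lemma nn_integral_add_cmult:
  assumes "f \<in> borel_measurable \<mu>" "g \<in> borel_measurable \<mu>"
  shows "(\<integral>\<^sup>+x. c * f x + c * g x \<partial>\<mu>) = c * (\<integral>\<^sup>+x. f x \<partial>\<mu>) + c * (\<integral>\<^sup>+x. g x \<partial>\<mu>)"
  using assms by (simp add: nn_integral_add nn_integral_cmult)

lemma nn_integral_square_triangle:
  assumes \<mu>: "sets \<mu> = sets borel_nonneg" and I: "I \<in> sets borel_nonneg"
    and F: "strongly_measurable F" and G: "strongly_measurable G"
    and le: "\<And>s. s \<in> I \<Longrightarrow> norm (H s) \<le> norm (F s) + norm (G s)"
  shows "(\<integral>\<^sup>+ s\<in>I. ennreal ((norm (H s))\<^sup>2) \<partial>\<mu>) \<le>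
    2 * (\<integral>\<^sup>+ s\<in>I. ennreal ((norm (F s))\<^sup>2) \<partial>\<mu>) + 2 * (\<integral>\<^sup>+ s\<in>I. ennreal ((norm (G s))\<^sup>2) \<partial>\<mu>)"
proof -
  have sq: "(norm (H s))\<^sup>2 \<le> 2 * (norm (F s))\<^sup>2 + 2 * (norm (G s))\<^sup>2" if "s \<in> I" for s
  proof -
    have "(norm (H s))\<^sup>2 \<le> (norm (F s) + norm (G s))\<^sup>2" using le[OF that] by (intro power_mono) auto
    also have "\<dots> \<le> 2 * (norm (F s))\<^sup>2 + 2 * (norm (G s))\<^sup>2"
      using sum_squares_bound[of "norm (F s)" "norm (G s)"] by (simp add: power2_sum)
    finally show ?thesis .
  qed
  have "(\<integral>\<^sup>+ s\<in>I. ennreal ((norm (H s))\<^sup>2) \<partial>\<mu>) \<le>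
    (\<integral>\<^sup>+ s. 2 * (ennreal ((norm (F s))\<^sup>2) * indicator I s) + 2 * (ennreal ((norm (G s))\<^sup>2) * indicator I s) \<partial>\<mu>)"
  proof (intro nn_integral_mono)
    fix s
    have "ennreal ((norm (H s))\<^sup>2) \<le> 2 * ennreal ((norm (F s))\<^sup>2) + 2 * ennreal ((norm (G s))\<^sup>2)" if "s \<in> I"
    proof -
      have "ennreal ((norm (H s))\<^sup>2) \<le> ennreal (2 * (norm (F s))\<^sup>2 + 2 * (norm (G s))\<^sup>2)"
        by (rule ennreal_leI[OF sq[OF that]])
      then show ?thesis by (simp add: ennreal_plus ennreal_mult)
    qed
    then show "ennreal ((norm (H s))\<^sup>2) * indicator I s \<le>
      2 * (ennreal ((norm (F s))\<^sup>2) * indicator I s) + 2 * (ennreal ((norm (G s))\<^sup>2) * indicator I s)"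
      by (cases "s \<in> I") auto
  qed
  also have "\<dots> = 2 * (\<integral>\<^sup>+ s\<in>I. ennreal ((norm (F s))\<^sup>2) \<partial>\<mu>) + 2 * (\<integral>\<^sup>+ s\<in>I. ennreal ((norm (G s))\<^sup>2) \<partial>\<mu>)"
    by (intro nn_integral_add_cmult measurable_norm_square_on[OF \<mu> _ I] F G)
  finally show ?thesis .
qed

lemma nn_integral_norm_triangle:
  assumes \<mu>: "sets \<mu> = sets borel_nonneg" and I: "I \<in> sets borel_nonneg"
    and F: "strongly_measurable F" and G: "strongly_measurable G"
    and le: "\<And>s. s \<in> I \<Longrightarrow> norm (H s) \<le> norm (F s) + norm (G s)"
  shows "(\<integral>\<^sup>+ s\<in>I. ennreal (norm (H s)) \<partial>\<mu>) \<le>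
    (\<integral>\<^sup>+ s\<in>I. ennreal (norm (F s)) \<partial>\<mu>) + (\<integral>\<^sup>+ s\<in>I. ennreal (norm (G s)) \<partial>\<mu>)"
proof -
  have "(\<integral>\<^sup>+ s\<in>I. ennreal (norm (H s)) \<partial>\<mu>) \<le>
    (\<integral>\<^sup>+ s. ennreal (norm (F s)) * indicator I s + ennreal (norm (G s)) * indicator I s \<partial>\<mu>)"
  proof (intro nn_integral_mono)
    fix s
    have "ennreal (norm (H s)) \<le> ennreal (norm (F s)) + ennreal (norm (G s))" if "s \<in> I"
      using ennreal_leI[OF le[OF that]] by (simp add: ennreal_plus)
    then show "ennreal (norm (H s)) * indicator I s \<le>
      ennreal (norm (F s)) * indicator I s + ennreal (norm (G s)) * indicator I s"
      by (cases "s \<in> I") auto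
  qed
  also have "\<dots> = (\<integral>\<^sup>+ s\<in>I. ennreal (norm (F s)) \<partial>\<mu>) + (\<integral>\<^sup>+ s\<in>I. ennreal (norm (G s)) \<partial>\<mu>)"
    by (intro nn_integral_add measurable_norm_on[OF \<mu> _ I] F G)
  finally show ?thesis .
qed

lemma energy_triangle:
  assumes \<mu>: "sets \<mu> = sets borel_nonneg" and \<alpha>: "sets \<alpha> = sets borel_nonneg"
    and F: "strongly_measurable F" and G: "strongly_measurable G"
    and le: "\<And>s. 0 < s \<Longrightarrow> norm (H s) \<le> norm (F s) + norm (G s)"
  shows "energy \<mu> \<alpha> t H \<le> 2 * energy \<mu> \<alpha> t F + 2 * energy \<mu> \<alpha> t G"
proof -
  have dbl: "x \<le> 2 * x" for x :: ennreal unfolding mult_2 by (rule add_increasing2) simp_all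
  have I: "{0<..t} \<in> sets borel_nonneg" by simp
  have "energy \<mu> \<alpha> t H \<le> (2 * (\<integral>\<^sup>+ s\<in>{0<..t}. ennreal ((norm (F s))\<^sup>2) \<partial>\<mu>) +
      2 * (\<integral>\<^sup>+ s\<in>{0<..t}. ennreal ((norm (G s))\<^sup>2) \<partial>\<mu>)) +
      ((\<integral>\<^sup>+ s\<in>{0<..t}. ennreal (norm (F s)) \<partial>\<alpha>) + (\<integral>\<^sup>+ s\<in>{0<..t}. ennreal (norm (G s)) \<partial>\<alpha>))"
    unfolding energy_def
    by (rule add_mono[OF nn_integral_square_triangle[OF \<mu> I F G le] nn_integral_norm_triangle[OF \<alpha> I F G le]])
      simp_all
  also have "\<dots> \<le> (2 * (\<integral>\<^sup>+ s\<in>{0<..t}. ennreal ((norm (F s))\<^sup>2) \<partial>\<mu>) +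
      2 * (\<integral>\<^sup>+ s\<in>{0<..t}. ennreal ((norm (G s))\<^sup>2) \<partial>\<mu>)) +
      (2 * (\<integral>\<^sup>+ s\<in>{0<..t}. ennreal (norm (F s)) \<partial>\<alpha>) + 2 * (\<integral>\<^sup>+ s\<in>{0<..t}. ennreal (norm (G s)) \<partial>\<alpha>))"
    by (intro add_mono order_refl dbl)
  also have "\<dots> = 2 * energy \<mu> \<alpha> t F + 2 * energy \<mu> \<alpha> t G"
    unfolding energy_def distrib_left by (simp only: ac_simps)
  finally show ?thesis .
qed

lemma energy_scale:
  assumes \<mu>: "sets \<mu> = sets borel_nonneg" and \<alpha>: "sets \<alpha> = sets borel_nonneg"
    and G: "strongly_measurable G" and C: "1 \<le> C"
    and le: "\<And>s. 0 < s \<Longrightarrow> norm (F s) \<le> C * norm (G s)"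
  shows "energy \<mu> \<alpha> t F \<le> ennreal (C\<^sup>2) * energy \<mu> \<alpha> t G"
proof -
  have C': "C \<le> C\<^sup>2" "0 \<le> C\<^sup>2" using self_le_power[OF C, of 2] by simp_all
  have "energy \<mu> \<alpha> t F \<le> (\<integral>\<^sup>+ s. ennreal (C\<^sup>2) * (ennreal ((norm (G s))\<^sup>2) * indicator {0<..t} s) \<partial>\<mu>)
    + (\<integral>\<^sup>+ s. ennreal (C\<^sup>2) * (ennreal (norm (G s)) * indicator {0<..t} s) \<partial>\<alpha>)"
    unfolding energy_def
  proof (intro add_mono nn_integral_mono)
    fix s
    show "ennreal ((norm (F s))\<^sup>2) * indicator {0<..t} s \<le> ennreal (C\<^sup>2) * (ennreal ((norm (G s))\<^sup>2) * indicator {0<..t} s)"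
    proof (cases "s \<in> {0<..t}")
      case True
      then have "(norm (F s))\<^sup>2 \<le> (C * norm (G s))\<^sup>2" by (intro power_mono le) auto
      then have "ennreal ((norm (F s))\<^sup>2) \<le> ennreal (C\<^sup>2) * ennreal ((norm (G s))\<^sup>2)"
        using C' by (simp add: ennreal_mult[symmetric] power_mult_distrib ennreal_leI)
      then show ?thesis using True by simp
    qed simp
    show "ennreal (norm (F s)) * indicator {0<..t} s \<le> ennreal (C\<^sup>2) * (ennreal (norm (G s)) * indicator {0<..t} s)"
    proof (cases "s \<in> {0<..t}")
      case True
      then have "norm (F s) \<le> C * norm (G s)" by (intro le) auto
      also have "\<dots> \<le> C\<^sup>2 * norm (G s)" using C' by (intro mult_right_mono) auto
      finally have "ennreal (norm (F s)) \<le> ennreal (C\<^sup>2) * ennreal (norm (G s))"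
        using C' by (simp add: ennreal_mult[symmetric] ennreal_leI)
      then show ?thesis using True by simp
    qed simp
  qed
  also have "\<dots> = ennreal (C\<^sup>2) * energy \<mu> \<alpha> t G"
    unfolding energy_def distrib_left
    by (intro arg_cong2[where f = "(+)"] nn_integral_cmult
        measurable_norm_square_on[OF \<mu> G] measurable_norm_on[OF \<alpha> G]) simp_all
  finally show ?thesis .
qed

text \<open>Convergence to \<open>0\<close> in \<open>ennreal\<close> is tested with real bounds, which makes it insensitive to the
  square root in the seminorm.\<close>

lemma ennreal_tendsto_0_iff:
  "(f \<longlongrightarrow> (0::ennreal)) F \<longleftrightarrow> (\<forall>e>0. \<forall>\<^sub>F x in F. f x < ennreal e)"
proof
  assume "(f \<longlongrightarrow> 0) F"
  then show "\<forall>e>0. \<forall>\<^sub>F x in F. f x < ennreal e" by (intro allI impI order_tendstoD(2)) (assumption, metis ennreal_0 ennreal_less_iff order_refl)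
next
  assume ev: "\<forall>e>0. \<forall>\<^sub>F x in F. f x < ennreal e"
  show "(f \<longlongrightarrow> 0) F"
  proof (rule order_tendstoI)
    fix a :: ennreal assume "0 < a"
    then obtain d where d: "0 < d" "d < a" using dense by blast
    have "d < top" by (rule order_less_le_trans[OF d(2) top_greatest])
    then have "d = ennreal (enn2real d)" "0 < enn2real d"
      using d(1) by (simp_all add: enn2real_positive_iff)
    with ev have "\<forall>\<^sub>F x in F. f x < d" by (metis (no_types))
    then show "\<forall>\<^sub>F x in F. f x < a" by eventually_elim (use d in simp)
  qed simp
qed

lemma ennreal_sqrt_less_iff:
  assumes "0 \<le> e"
  shows "ennreal_sqrt x < ennreal e \<longleftrightarrow> x < ennreal (e\<^sup>2)"
proof (cases x)
  case (real r)
  have "sqrt r < e \<longleftrightarrow> r < e\<^sup>2"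
    using assms real by (metis real_sqrt_less_iff real_sqrt_unique)
  then show ?thesis using real assms by (simp add: ennreal_sqrt_def ennreal_less_iff)
qed (simp add: ennreal_sqrt_def)

lemma ennreal_sqrt_tendsto_0_iff:
  "((\<lambda>x. ennreal_sqrt (f x)) \<longlongrightarrow> 0) F \<longleftrightarrow> (f \<longlongrightarrow> 0) F"
proof -
  have "(\<forall>e>0. P (e\<^sup>2)) \<longleftrightarrow> (\<forall>e>0. P e)" for P :: "real \<Rightarrow> bool"
  proof safe
    fix e :: real assume "\<forall>e>0. P (e\<^sup>2)" "e > 0"
    then have "P ((sqrt e)\<^sup>2)" by (metis real_sqrt_gt_zero)
    then show "P e" using \<open>e > 0\<close> by simp
  qed simp
  from this[of "\<lambda>e. \<forall>\<^sub>F x in F. f x < ennreal e"] show ?thesis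
    unfolding ennreal_tendsto_0_iff by (simp add: ennreal_sqrt_less_iff)
qed

lemma ennreal_add_tendsto_0_iff:
  fixes f g :: "'x \<Rightarrow> ennreal"
  shows "((\<lambda>x. f x + g x) \<longlongrightarrow> 0) F \<longleftrightarrow> (f \<longlongrightarrow> 0) F \<and> (g \<longlongrightarrow> 0) F"
proof safe
  assume lim: "((\<lambda>x. f x + g x) \<longlongrightarrow> 0) F"
  show "(f \<longlongrightarrow> 0) F" "(g \<longlongrightarrow> 0) F"
    by (rule tendsto_sandwich[OF _ _ tendsto_const lim]; simp)+
next
  assume "(f \<longlongrightarrow> 0) F" "(g \<longlongrightarrow> 0) F"
  from tendsto_add[OF this] show "((\<lambda>x. f x + g x) \<longlongrightarrow> 0) F" by simp
qed

context
  fixes FA :: "real \<Rightarrow> 'a::cstar_prob_space set" and X M A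
  assumes FA: "filtration FA" and D: "L2_decomposition FA X M A"
begin

lemma X_seminorm_finite_iff:
  "X_seminorm FA X t H < \<infinity> \<longleftrightarrow> energy_of M A t H < \<infinity>"
  unfolding X_seminorm_def energy_def kappa_mart_part[OF FA D] kappa_fv_part[OF FA D]
  by (simp add: ennreal_sqrt_def less_top[symmetric])

lemma L_tendsto_iff:
  "L_tendsto FA X Hn H \<longleftrightarrow>
    (\<forall>t\<ge>0. (\<lambda>n. energy_of M A t (\<lambda>s. Hn n s - H s)) \<longlonglongrightarrow> 0)"
  unfolding L_tendsto_def X_seminorm_def energy_def kappa_mart_part[OF FA D] kappa_fv_part[OF FA D]
    ennreal_add_tendsto_0_iff ennreal_sqrt_tendsto_0_iff ..

text \<open>Local \<open>\<kappa>\<^sub>X\<close>-integrability follows from finite energy: \<open>\<parallel>H\<parallel> \<le> 1 + \<parallel>H\<parallel>\<^sup>2\<close>, and \<open>\<kappa>\<^sub>M\<close> is finite on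
  bounded intervals. The point \<open>0\<close>, which the seminorms leave out, is a null set.\<close>

lemma L_space_iff:
  "H \<in> L_space FA X \<longleftrightarrow>
    strongly_measurable H \<and> (\<forall>t\<ge>0. energy_of M A t H < \<infinity>)"
proof -
  note \<mu> = halfline_measureD[OF halfline_measure_decomposition_mart[OF FA D]]
  note \<alpha> = halfline_measureD[OF halfline_measure_decomposition_fv[OF FA D]]
  have "(\<integral>\<^sup>+ s\<in>{0..t}. ennreal (norm (H s)) \<partial>kappa FA X) < \<infinity>"
    if H: "strongly_measurable H" and t: "0 \<le> t"
      and fin: "energy_of M A t H < \<infinity>" for t
  proof -
    have s0: "{0..t} \<in> sets borel_nonneg" "{0} \<in> sets borel_nonneg" by (auto simp: sets_borel_nonneg)
    have drop0: "(\<integral>\<^sup>+ s\<in>{0..t}. ennreal (norm (H s)) \<partial>\<kappa>) = (\<integral>\<^sup>+ s\<in>{0<..t}. ennreal (norm (H s)) \<partial>\<kappa>)"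
      if "sets \<kappa> = sets borel_nonneg" "emeasure \<kappa> {0} = 0" for \<kappa>
    proof (rule nn_integral_cong_AE)
      have "AE s in \<kappa>. s \<notin> {0}"
        using that s0 by (intro AE_not_in null_setsI) simp_all
      then show "AE s in \<kappa>. ennreal (norm (H s)) * indicator {0..t} s = ennreal (norm (H s)) * indicator {0<..t} s"
        by eventually_elim (auto simp: indicator_def)
    qed
    have "(\<integral>\<^sup>+ s\<in>{0..t}. ennreal (norm (H s)) \<partial>kappa FA X) =
      (\<integral>\<^sup>+ s\<in>{0..t}. ennreal (norm (H s)) \<partial>kappa_mart M) + (\<integral>\<^sup>+ s\<in>{0..t}. ennreal (norm (H s)) \<partial>kappa_fv A)"
      using s0(1) by (intro nn_integral_kappa[OF FA D] measurable_norm_on[OF refl H])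
    also have "\<dots> = (\<integral>\<^sup>+ s\<in>{0<..t}. ennreal (norm (H s)) \<partial>kappa_mart M) +
        (\<integral>\<^sup>+ s\<in>{0<..t}. ennreal (norm (H s)) \<partial>kappa_fv A)"
      by (simp only: drop0[OF \<mu>(1,3)] drop0[OF \<alpha>(1,3)])
    also have "\<dots> \<le> (emeasure (kappa_mart M) {0<..t} +
        (\<integral>\<^sup>+ s\<in>{0<..t}. ennreal ((norm (H s))\<^sup>2) \<partial>kappa_mart M)) +
        (\<integral>\<^sup>+ s\<in>{0<..t}. ennreal (norm (H s)) \<partial>kappa_fv A)"
    proof (intro add_right_mono)
      have meas: "{0<..t} \<in> sets (kappa_mart M)" by (simp add: \<mu>(1))
      have "(\<integral>\<^sup>+ s\<in>{0<..t}. ennreal (norm (H s)) \<partial>kappa_mart M) \<le>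
        (\<integral>\<^sup>+ s. indicator {0<..t} s + ennreal ((norm (H s))\<^sup>2) * indicator {0<..t} s \<partial>kappa_mart M)"
      proof (intro nn_integral_mono)
        fix s
        have "x \<le> 1 + x\<^sup>2" for x :: real
          using zero_le_power2[of "x - 1/2"] by (simp add: power2_eq_square algebra_simps)
        then have "ennreal (norm (H s)) \<le> 1 + ennreal ((norm (H s))\<^sup>2)"
          by (metis ennreal_1 ennreal_leI ennreal_plus zero_le_one zero_le_power2)
        then show "ennreal (norm (H s)) * indicator {0<..t} s \<le>
            indicator {0<..t} s + ennreal ((norm (H s))\<^sup>2) * indicator {0<..t} s"
          by (simp add: indicator_def)
      qed
      also have "\<dots> = emeasure (kappa_mart M) {0<..t} + (\<integral>\<^sup>+ s\<in>{0<..t}. ennreal ((norm (H s))\<^sup>2) \<partial>kappa_mart M)"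
        using meas by (subst nn_integral_add) (simp_all add: measurable_norm_square_on[OF \<mu>(1) H])
      finally show "(\<integral>\<^sup>+ s\<in>{0<..t}. ennreal (norm (H s)) \<partial>kappa_mart M) \<le> \<dots>" .
    qed
    also have "\<dots> < \<infinity>"
      using fin \<mu>(4)[OF order_refl t] by (simp add: energy_def add.assoc)
    finally show ?thesis .
  qed
  then show ?thesis unfolding L_space_def X_seminorm_finite_iff by blast
qed

end

section \<open>Elementary processes and their integrals\<close>

lemma F22_mono: "s \<le> t \<Longrightarrow> T \<in> F22 FA FB s \<Longrightarrow> T \<in> F22 FA FB t"
  unfolding F22_def by (blast intro: order_trans)

lemma F22_apply:
  "T \<in> F22 FA FB t \<Longrightarrow> t \<le> u \<Longrightarrow> cond_expec (FB u) (blinfun_apply T x) = blinfun_apply T (cond_expec (FA u) x)"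
  unfolding F22_def by blast

lemma F22_maps_L2_of:
  assumes FA: "filtration FA" and FB: "filtration FB"
    and T: "T \<in> F22 FA FB t" and u: "0 \<le> u" "t \<le> u" and x: "x \<in> L2_of (FA u)"
  shows "blinfun_apply T x \<in> L2_of (FB u)"
proof -
  have "cond_expec (FB u) (blinfun_apply T x) = blinfun_apply T x"
    using F22_apply[OF T u(2), of x] cond_expec_ident[OF filtration_subalgebra[OF FA u(1)] x] by simp
  then show ?thesis using cond_expec_in[OF filtration_subalgebra[OF FB u(1)]] by metis
qed

lemma F22_compose:
  assumes "S \<in> F22 FB FC t" "T \<in> F22 FA FB t"
  shows "S o\<^sub>L T \<in> F22 FA FC t"
  unfolding F22_def
proof (intro CollectI allI impI)
  fix u x assume "t \<le> u"
  then show "cond_expec (FC u) (blinfun_apply (S o\<^sub>L T) x) = blinfun_apply (S o\<^sub>L T) (cond_expec (FA u) x)"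
    using F22_apply[OF assms(1)] F22_apply[OF assms(2)] by simp
qed

lemma subspace_F22:
  assumes FA: "filtration FA" and FB: "filtration FB" and t: "0 \<le> t"
  shows "subspace (F22 FA FB t)"
proof (rule subspaceI)
  note B = filtration_subalgebra[OF FB]
  show "0 \<in> F22 FA FB t" using cond_expec_zero[OF B] t by (simp add: F22_def)
  show "S + T \<in> F22 FA FB t" if "S \<in> F22 FA FB t" "T \<in> F22 FA FB t" for S T
    using that cond_expec_add[OF B] t by (simp add: F22_def blinfun.add_left)
  show "c *\<^sub>R T \<in> F22 FA FB t" if "T \<in> F22 FA FB t" for c T
    using that cond_expec_scaleR[OF B] t by (simp add: F22_def blinfun.scaleR_left)
qed

lemma elem_process_Nil [simp]: "elem_process (H0, []) u = indicator {0} u *\<^sub>R H0"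
  and elem_process_Cons: "elem_process (H0, (s, t, Hi) # Hs) u
    = indicator {s<..t} u *\<^sub>R Hi + elem_process (H0, Hs) u"
  by (simp_all add: elem_process_def)

lemma elem_integral_Nil [simp]: "elem_integral (H0, []) X u = 0"
  and elem_integral_Cons: "elem_integral (H0, (s, t, Hi) # Hs) X u
    = blinfun_apply Hi (X (min t u) - X (min s u)) + elem_integral (H0, Hs) X u"
  by (simp_all add: elem_integral_def)

lemma elem_data_Cons:
  "(H0, (s, t, Hi) # Hs) \<in> elem_data FA FB \<longleftrightarrow>
    0 \<le> s \<and> s \<le> t \<and> Hi \<in> F22 FA FB s \<and> (H0, Hs) \<in> elem_data FA FB"
  by (auto simp: elem_data_def)

lemma elem_data_induct [consumes 1, case_names Nil Cons]:
  assumes "E \<in> elem_data FA FB"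
    and "\<And>H0. H0 \<in> F22 FA FB 0 \<Longrightarrow> P (H0, [])"
    and "\<And>H0 s t Hi Hs. 0 \<le> s \<Longrightarrow> s \<le> t \<Longrightarrow> Hi \<in> F22 FA FB s \<Longrightarrow> (H0, Hs) \<in> elem_data FA FB
      \<Longrightarrow> P (H0, Hs) \<Longrightarrow> P (H0, (s, t, Hi) # Hs)"
  shows "P E"
proof -
  have "P (H0, Hs)" if "(H0, Hs) \<in> elem_data FA FB" for H0 Hs
    using that
  proof (induction Hs)
    case Nil
    then show ?case using assms(2) by (simp add: elem_data_def)
  next
    case (Cons h Hs)
    obtain s t Hi where "h = (s, t, Hi)" by (cases h)
    with Cons assms(3) show ?case by (simp add: elem_data_Cons)
  qed
  then show ?thesis using assms(1) by (cases E) simp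
qed

lemma simple_function_elem_process:
  assumes "E \<in> elem_data FA FB"
  shows "simple_function borel_nonneg (elem_process E)"
  using assms
proof (induction rule: elem_data_induct)
  case (Nil H0)
  have "simple_function borel_nonneg (\<lambda>u. (indicator {0} u :: real))"
    by (rule simple_function_indicator) (simp add: sets_borel_nonneg)
  then have "simple_function borel_nonneg (\<lambda>u. indicator {0} u *\<^sub>R H0)"
    by (rule simple_function_compose1[where g = "\<lambda>r. r *\<^sub>R H0"])
  then show ?case by (simp cong: simple_function_cong)
next
  case (Cons H0 s t Hi Hs)
  have "simple_function borel_nonneg (\<lambda>u. (indicator {s<..t} u :: real))"
    by (rule simple_function_indicator) (simp add: Cons.hyps)
  then have "simple_function borel_nonneg (\<lambda>u. indicator {s<..t} u *\<^sub>R Hi)"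
    by (rule simple_function_compose1[where g = "\<lambda>r. r *\<^sub>R Hi"])
  from simple_function_compose2[OF this Cons.IH, of "(+)"] show ?case
    unfolding elem_process_Cons[abs_def] .
qed

lemma strongly_measurable_elem_process:
  "E \<in> elem_data FA FB \<Longrightarrow> strongly_measurable (elem_process E)"
  by (rule strongly_measurable_simple[OF simple_function_elem_process])

text \<open>The bound \<open>C \<ge> 1\<close> satisfies \<open>C \<le> C\<^sup>2\<close>, which allows one to scale both parts of the energy by \<open>C\<^sup>2\<close>.\<close>

lemma elem_process_bounded:
  assumes "E \<in> elem_data FA FB"
  shows "\<exists>C\<ge>1. \<forall>u\<ge>0. norm (elem_process E u) \<le> C"
proof -
  have "finite (elem_process E ` {0..})"
    using simple_functionD(1)[OF simple_function_elem_process[OF assms]] by (simp add: space_restrict_space)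
  then obtain C where C: "\<And>x. x \<in> elem_process E ` {0..} \<Longrightarrow> norm x \<le> C"
    using finite_imp_bounded bounded_iff by metis
  show ?thesis
  proof (intro exI[of _ "max 1 C"] conjI allI impI)
    fix u :: real assume "0 \<le> u"
    then have "norm (elem_process E u) \<le> C" by (intro C) auto
    then show "norm (elem_process E u) \<le> max 1 C" by simp
  qed simp
qed

lemma ex_partition_through:
  fixes s t :: real
  assumes D: "finite D" "D \<subseteq> {s..t}" and st: "s \<le> t"
  shows "\<exists>n p. strict_mono_on {..n} p \<and> p 0 = s \<and> p n = t \<and> D \<subseteq> p ` {..n::nat}"
proof -
  define S where "S = insert s (insert t D)"
  define xs where "xs = sorted_list_of_set S"
  define n where "n = length xs - 1"
  have S: "finite S" "S \<subseteq> {s..t}" "S \<noteq> {}" using D st by (auto simp: S_def)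
  have set: "set xs = S" using S(1) by (simp add: xs_def)
  have len: "length xs = Suc n" using S(3) set unfolding n_def by (cases xs) auto
  have less: "xs ! i < xs ! j" if "i < j" "j \<le> n" for i j
    using sorted_wrt_nth_less[of "(<)" xs i j] that len
      sorted_list_of_set.strict_sorted_key_list_of_set[of S] by (simp add: xs_def)
  have img: "S = (!) xs ` {..n}"
    unfolding set[symmetric] set_conv_nth len by (auto simp: less_Suc_eq_le)
  have in_S: "xs ! i \<in> {s..t}" if "i \<le> n" for i using img that S(2) by blast
  have "s \<in> S" "t \<in> S" by (simp_all add: S_def)
  then obtain i j where ij: "i \<le> n" "xs ! i = s" "j \<le> n" "xs ! j = t" using img by auto
  have "xs ! 0 = s"
  proof (cases "i = 0")
    case False
    then have "xs ! 0 < s" using less[of 0 i] ij by simp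
    then show ?thesis using in_S[of 0] by simp
  qed (use ij in simp)
  moreover have "xs ! n = t"
  proof (cases "j = n")
    case False
    then have "t < xs ! n" using less[of j n] ij by simp
    then show ?thesis using in_S[of n] by simp
  qed (use ij in simp)
  moreover have "strict_mono_on {..n} ((!) xs)" by (intro strict_mono_onI less) auto
  moreover have "D \<subseteq> (!) xs ` {..n}" unfolding img[symmetric] by (auto simp: S_def)
  ultimately show ?thesis by blast
qed

text \<open>Over \<open>[s, t]\<close> an elementary integral sees its time points only after truncation to \<open>[s, t]\<close>.\<close>

lemma clamped_increment:
  fixes X :: "real \<Rightarrow> 'v::ab_group_add"
  assumes "s \<le> t"
  shows "X (min b t) - X (min a t) - (X (min b s) - X (min a s))
    = X (max s (min b t)) - X (max s (min a t))"
proof -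
  have "X (min r t) - X (min r s) = X (max s (min r t)) - X s" for r
    using assms by (cases "r \<le> s") (auto simp: min_def max_def)
  note * = this
  have "X (min b t) - X (min a t) - (X (min b s) - X (min a s))
      = (X (min b t) - X (min b s)) - (X (min a t) - X (min a s))"
    by (simp add: algebra_simps)
  also have "\<dots> = X (max s (min b t)) - X (max s (min a t))" unfolding * by simp
  finally show ?thesis .
qed

text \<open>A partition of \<open>[s, t]\<close> on whose intervals the elementary process is constant, so that its integral
  becomes a sum over the partition. The value on an interval is read off at the right end point,
  since the intervals are open at the left; at the left end point it would be the previous value.\<close>

definition adapted_partition ::
  "(real \<Rightarrow> 'a::cstar_prob_space set) \<Rightarrow> (real \<Rightarrow> 'b::cstar_prob_space set) \<Rightarrow>
    ('a L2 \<Rightarrow>\<^sub>L 'b L2) elem_data \<Rightarrow> real \<Rightarrow> real \<Rightarrow> nat \<Rightarrow> (nat \<Rightarrow> real) \<Rightarrow> bool"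
  where "adapted_partition FA FB E s t n p \<longleftrightarrow> mono_on {..n} p \<and> p 0 = s \<and> p n = t \<and>
    (\<forall>X. elem_integral E X t - elem_integral E X s =
      (\<Sum>j<n. blinfun_apply (elem_process E (p (Suc j))) (X (p (Suc j)) - X (p j)))) \<and>
    (\<forall>j<n. elem_process E (p (Suc j)) \<in> F22 FA FB (p j)) \<and>
    (\<forall>j<n. \<forall>u\<in>{p j<..p (Suc j)}. elem_process E u = elem_process E (p (Suc j)))"

text \<open>The partition points are the time points of \<open>E\<close>, truncated to \<open>[s, t]\<close>. An interval \<open>(a, b]\<close> of \<open>E\<close> then
  consists of consecutive intervals of the partition, and its increment telescopes. The value on
  \<open>(p j, p (Suc j)]\<close> only involves operators whose starting time is at most \<open>p j\<close>.\<close>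

lemma ex_adapted_partition:
  assumes FA: "filtration FA" and FB: "filtration FB" and E: "E \<in> elem_data FA FB"
    and st: "0 \<le> s" "s \<le> t"
  shows "\<exists>n p. adapted_partition FA FB E s t n p"
proof -
  obtain H0 Hs where E_eq: "E = (H0, Hs)" by (cases E)
  define c where "c r = max s (min r t)" for r
  define D where "D = (\<Union>(a, b, _)\<in>set Hs. {c a, c b})"
  have "finite D" "D \<subseteq> {s..t}" using st by (auto simp: D_def c_def)
  then obtain n :: nat and p where sp: "strict_mono_on {..n} p" and p0: "p 0 = s" and pn: "p n = t"
    and Dp: "D \<subseteq> p ` {..n}"
    using ex_partition_through[OF \<open>finite D\<close> \<open>D \<subseteq> {s..t}\<close> st(2)] by blast
  have less: "p i < p j \<longleftrightarrow> i < j" if "i \<le> n" "j \<le> n" for i j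
    using strict_mono_on_less[OF sp, of i j] that by auto
  have p: "mono_on {..n} p" by (rule strict_mono_on_imp_mono_on[OF sp])
  note bounds = partition_bounds[OF p p0 pn]
  \<comment> \<open>\<open>(a, b]\<close> contains either all or nothing of \<open>(p j, p (Suc j)]\<close>\<close>
  have ind: "indicator {a<..b} u = (if i \<le> j \<and> j < k then 1 else 0 :: real)"
    if ab: "c a = p i" "c b = p k" "i \<le> n" "k \<le> n" and j: "j < n" and u: "p j < u" "u \<le> p (Suc j)"
    for a b i j k u
  proof -
    have u_st: "s < u" "u \<le> t" using bounds[of j] bounds[of "Suc j"] j u by auto
    have below: "c r < u \<longleftrightarrow> l \<le> j" if "c r = p l" "l \<le> n" for r l
      using less[of l "Suc j"] less[of j l] that j u by (auto simp: not_less[symmetric] less_Suc_eq_le)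
    have "c r < u \<longleftrightarrow> r < u" for r
      unfolding c_def max_less_iff_conj min_less_iff_disj using u_st by auto
    then have "a < u \<longleftrightarrow> i \<le> j"
      using below[OF ab(1,3)] by simp
    moreover have "u \<le> b \<longleftrightarrow> j < k"
    proof -
      have "u \<le> b \<longleftrightarrow> u \<le> c b" using u_st by (auto simp: c_def)
      also have "\<dots> \<longleftrightarrow> j < k"
        unfolding ab(2)
      proof (cases "j < k")
        case True
        then have "p (Suc j) \<le> p k" using ab(4) by (intro monotone_onD[OF p]) auto
        then show "u \<le> p k \<longleftrightarrow> j < k" using True u by simp
      next
        case False
        then have "p k \<le> p j" using j by (intro monotone_onD[OF p]) auto
        then show "u \<le> p k \<longleftrightarrow> j < k" using False u by simp
      qed
      finally show ?thesis .
    qed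
    ultimately show ?thesis by (auto simp: indicator_def)
  qed
  have "(\<forall>X. elem_integral (H0, Gs) X t - elem_integral (H0, Gs) X s =
      (\<Sum>j<n. blinfun_apply (elem_process (H0, Gs) (p (Suc j))) (X (p (Suc j)) - X (p j)))) \<and>
    (\<forall>j<n. elem_process (H0, Gs) (p (Suc j)) \<in> F22 FA FB (p j)) \<and>
    (\<forall>j<n. \<forall>u\<in>{p j<..p (Suc j)}. elem_process (H0, Gs) u = elem_process (H0, Gs) (p (Suc j)))"
    if "set Gs \<subseteq> set Hs" for Gs
    using that
  proof (induction Gs)
    case Nil
    have zero: "elem_process (H0, []) u = 0" if "j < n" "p j < u" for j u
    proof -
      have "0 < u" using bounds(1)[of j] that st by simp
      then show ?thesis by simp
    qed
    have step: "p j < p (Suc j)" if "j < n" for j using less[of j "Suc j"] that by simp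
    show ?case
    proof (intro conjI allI impI ballI)
      fix X :: "real \<Rightarrow> 'a L2"
      show "elem_integral (H0, []) X t - elem_integral (H0, []) X s =
        (\<Sum>j<n. blinfun_apply (elem_process (H0, []) (p (Suc j))) (X (p (Suc j)) - X (p j)))"
        unfolding elem_integral_Nil diff_zero
        by (rule sym[OF sum.neutral]) (auto simp only: lessThan_iff zero[OF _ step] blinfun.zero_left)
    next
      fix j assume j: "j < n"
      show "elem_process (H0, []) (p (Suc j)) \<in> F22 FA FB (p j)"
        unfolding zero[OF j step[OF j]]
        using bounds(1)[of j] j st by (intro subspace_0[OF subspace_F22[OF FA FB]]) simp
      fix u assume "u \<in> {p j<..p (Suc j)}"
      then have "p j < u" by simp
      then show "elem_process (H0, []) u = elem_process (H0, []) (p (Suc j))"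
        using zero[OF j] step[OF j] by (simp only:)
    qed
  next
    case (Cons h Gs)
    obtain a b Hi where h: "h = (a, b, Hi)" by (cases h)
    have hin: "(a, b, Hi) \<in> set Hs" using Cons.prems h by simp
    then have ab: "0 \<le> a" "a \<le> b" "Hi \<in> F22 FA FB a"
      using E by (auto simp: E_eq elem_data_def)
    have "c a \<in> D" "c b \<in> D" using hin by (force simp: D_def)+
    then have "c a \<in> p ` {..n}" "c b \<in> p ` {..n}" using Dp by blast+
    then obtain i k where ik: "c a = p i" "c b = p k" "i \<le> n" "k \<le> n"
      unfolding image_iff Bex_def atMost_iff by blast
    have "c a \<le> c b" using ab(2) by (auto simp: c_def)
    then have "i \<le> k" using less[of k i] ik by auto
    note ind' = ind[OF ik]
    have step: "p j < p (Suc j)" if "j < n" for j using less[of j "Suc j"] that by simp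
    note IH = Cons.IH[OF order_trans[OF set_subset_Cons Cons.prems]]
    show ?case
      unfolding h
    proof (intro conjI allI impI ballI)
      fix X :: "real \<Rightarrow> 'a L2"
      let ?d = "\<lambda>j. X (p (Suc j)) - X (p j)"
      have "(\<Sum>j<n. blinfun_apply (indicator {a<..b} (p (Suc j)) *\<^sub>R Hi) (?d j)) =
          (\<Sum>j<n. if j \<in> {i..<k} then blinfun_apply Hi (?d j) else 0)"
        using ind'[OF _ step] by (intro sum.cong) (auto simp: blinfun.scaleR_left)
      also have "\<dots> = (\<Sum>j\<in>{..<n} \<inter> {i..<k}. blinfun_apply Hi (?d j))"
        by (simp add: sum.inter_restrict)
      also have "{..<n} \<inter> {i..<k} = {i..<k}" using ik(4) by auto
      also have "(\<Sum>j\<in>{i..<k}. blinfun_apply Hi (?d j)) = blinfun_apply Hi (X (p k) - X (p i))"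
        using sum_Suc_diff'[OF \<open>i \<le> k\<close>, of "\<lambda>j. X (p j)"] by (simp add: blinfun.sum_right[symmetric])
      finally have sum: "(\<Sum>j<n. blinfun_apply (indicator {a<..b} (p (Suc j)) *\<^sub>R Hi) (?d j))
        = blinfun_apply Hi (X (c b) - X (c a))" unfolding ik .
      have "elem_integral (H0, (a, b, Hi) # Gs) X t - elem_integral (H0, (a, b, Hi) # Gs) X s =
        blinfun_apply Hi (X (min b t) - X (min a t) - (X (min b s) - X (min a s))) +
        (elem_integral (H0, Gs) X t - elem_integral (H0, Gs) X s)"
        by (simp add: elem_integral_Cons blinfun.diff_right)
      also have "\<dots> = blinfun_apply Hi (X (c b) - X (c a)) +
        (\<Sum>j<n. blinfun_apply (elem_process (H0, Gs) (p (Suc j))) (?d j))"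
        using IH clamped_increment[OF st(2), of X b a] by (simp add: c_def)
      also have "\<dots> = (\<Sum>j<n. blinfun_apply (elem_process (H0, (a, b, Hi) # Gs) (p (Suc j))) (?d j))"
        unfolding sum[symmetric] by (simp add: sum.distrib[symmetric] elem_process_Cons blinfun.add_left)
      finally show "elem_integral (H0, (a, b, Hi) # Gs) X t - elem_integral (H0, (a, b, Hi) # Gs) X s = \<dots>" .
    next
      fix j assume j: "j < n"
      have sub: "subspace (F22 FA FB (p j))"
        using bounds(1)[of j] j st by (intro subspace_F22 FA FB) simp
      have "indicator {a<..b} (p (Suc j)) *\<^sub>R Hi \<in> F22 FA FB (p j)"
      proof (cases "i \<le> j \<and> j < k")
        case True
        then have "c a \<le> p j" using less[of j i] ik j by (simp add: not_less[symmetric])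
        moreover have "p j < t" using step[OF j] bounds(2)[of "Suc j"] j by simp
        ultimately have "a \<le> p j" by (auto simp: c_def max_def min_def split: if_splits)
        then show ?thesis using subspace_scale[OF sub] F22_mono ab(3) by blast
      next
        case False
        then have "indicator {a<..b} (p (Suc j)) = (0::real)"
          using ind'[OF j step[OF j] order_refl] by (simp only: if_False)
        then show ?thesis using subspace_0[OF sub] by (simp only: scaleR_zero_left)
      qed
      then show "elem_process (H0, (a, b, Hi) # Gs) (p (Suc j)) \<in> F22 FA FB (p j)"
        unfolding elem_process_Cons using subspace_add[OF sub] IH j by blast
      fix u assume u: "u \<in> {p j<..p (Suc j)}"
      then have "elem_process (H0, Gs) u = elem_process (H0, Gs) (p (Suc j))" using IH j by blast
      moreover have "indicator {a<..b} u = (indicator {a<..b} (p (Suc j)) :: real)"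
        using ind'[OF j, of u] ind'[OF j step[OF j] order_refl] u by (simp only: greaterThanAtMost_iff)
      ultimately show "elem_process (H0, (a, b, Hi) # Gs) u = elem_process (H0, (a, b, Hi) # Gs) (p (Suc j))"
        by (simp only: elem_process_Cons)
    qed
  qed
  from this[of Hs] have "adapted_partition FA FB E s t n p"
    unfolding adapted_partition_def E_eq using p p0 pn by blast
  then show ?thesis by blast
qed

lemma adapted_partitionD:
  assumes "adapted_partition FA FB E s t n p"
  shows "mono_on {..n} p" "p 0 = s" "p n = t"
    "elem_integral E X t - elem_integral E X s =
      (\<Sum>j<n. blinfun_apply (elem_process E (p (Suc j))) (X (p (Suc j)) - X (p j)))"
    "\<And>j. j < n \<Longrightarrow> elem_process E (p (Suc j)) \<in> F22 FA FB (p j)"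
    "\<And>j u. j < n \<Longrightarrow> p j < u \<Longrightarrow> u \<le> p (Suc j) \<Longrightarrow> elem_process E u = elem_process E (p (Suc j))"
proof -
  note d = assms[unfolded adapted_partition_def]
  show "mono_on {..n} p" "p 0 = s" "p n = t"
    by (rule d[THEN conjunct1] d[THEN conjunct2, THEN conjunct1] d[THEN conjunct2, THEN conjunct2, THEN conjunct1])+
  note d = d[THEN conjunct2, THEN conjunct2, THEN conjunct2]
  show "elem_integral E X t - elem_integral E X s =
      (\<Sum>j<n. blinfun_apply (elem_process E (p (Suc j))) (X (p (Suc j)) - X (p j)))"
    by (rule d[THEN conjunct1, THEN spec])
  show "elem_process E (p (Suc j)) \<in> F22 FA FB (p j)" if "j < n" for j
    by (rule d[THEN conjunct2, THEN conjunct1, rule_format, OF that])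
  show "elem_process E u = elem_process E (p (Suc j))" if "j < n" "p j < u" "u \<le> p (Suc j)" for j u
    by (rule d[THEN conjunct2, THEN conjunct2, rule_format, OF that(1)]) (simp add: that(2,3))
qed

lemma nn_integral_Ioc_partition:
  assumes \<mu>: "sets \<mu> = sets borel_nonneg" and f: "f \<in> borel_measurable borel_nonneg"
    and p: "mono_on {..n} p" and p0: "0 \<le> p 0"
  shows "(\<Sum>j<n. \<integral>\<^sup>+u\<in>{p j<..p (Suc j)}. f u \<partial>\<mu>) = (\<integral>\<^sup>+u\<in>{p 0<..p n}. f u \<partial>\<mu>)"
proof -
  have "(\<Sum>j<m. \<integral>\<^sup>+u\<in>{p j<..p (Suc j)}. f u \<partial>\<mu>) = (\<integral>\<^sup>+u\<in>{p 0<..p m}. f u \<partial>\<mu>)" if "m \<le> n" for m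
    using that
  proof (induction m)
    case (Suc m)
    have le: "p 0 \<le> p m" "p m \<le> p (Suc m)"
      using Suc.prems by (auto intro!: monotone_onD[OF p])
    have meas: "(\<lambda>u. f u * indicator {a<..b} u) \<in> borel_measurable \<mu>" if "0 \<le> a" for a b
    proof (intro borel_measurable_times_ennreal borel_measurable_indicator)
      show "f \<in> borel_measurable \<mu>" by (rule borel_measurable_halfline[OF \<mu> f])
      show "{a<..b} \<in> sets \<mu>" unfolding \<mu> using that by simp
    qed
    have "(\<Sum>j<Suc m. \<integral>\<^sup>+u\<in>{p j<..p (Suc j)}. f u \<partial>\<mu>) =
        (\<integral>\<^sup>+u\<in>{p 0<..p m}. f u \<partial>\<mu>) + (\<integral>\<^sup>+u\<in>{p m<..p (Suc m)}. f u \<partial>\<mu>)"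
      using Suc by simp
    also have "\<dots> = (\<integral>\<^sup>+u. f u * indicator {p 0<..p m} u + f u * indicator {p m<..p (Suc m)} u \<partial>\<mu>)"
      using p0 le by (intro nn_integral_add[symmetric] meas) auto
    also have "\<dots> = (\<integral>\<^sup>+u\<in>{p 0<..p (Suc m)}. f u \<partial>\<mu>)"
      using le by (intro nn_integral_cong) (auto simp: indicator_def)
    finally show ?case .
  qed simp
  then show ?thesis by simp
qed

lemma nn_integral_step:
  assumes \<mu>: "halfline_measure \<mu> g" and "0 \<le> s" "s \<le> t"
    and const: "\<And>u. s < u \<Longrightarrow> u \<le> t \<Longrightarrow> f u = c"
  shows "(\<integral>\<^sup>+u\<in>{s<..t}. f u \<partial>\<mu>) = c * g s t"
proof -
  have "(\<integral>\<^sup>+u\<in>{s<..t}. f u \<partial>\<mu>) = (\<integral>\<^sup>+u. c * indicator {s<..t} u \<partial>\<mu>)"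
    by (intro nn_integral_cong) (simp add: const indicator_def)
  also have "\<dots> = c * emeasure \<mu> {s<..t}"
    using assms(2) by (intro nn_integral_cmult_indicator) (simp add: halfline_measureD(1)[OF \<mu>])
  finally show ?thesis using halfline_measureD(4)[OF \<mu> assms(2,3)] by simp
qed

text \<open>Each term of the sum over a partition is orthogonal to the past of its left end point, as
  \<open>\<F>\<close>-operators commute with conditional expectations and martingale increments have
  conditional expectation zero.\<close>

lemma F22_martingale_increment_orthogonal:
  assumes FA: "filtration FA" and FB: "filtration FB" and M: "L2_martingale FA M"
    and T: "T \<in> F22 FA FB s" and st: "0 \<le> s" "s \<le> t" and z: "z \<in> L2_of (FB s)"
  shows "blinfun_apply T (M t - M s) \<bullet> z = 0"
proof -
  note A = filtration_subalgebra[OF FA st(1)]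
  have "M s \<in> L2_of (FA s)" using M st by (simp add: L2_martingale_def adapted_def)
  then have "cond_expec (FA s) (M t - M s) = 0"
    using M st by (simp add: cond_expec_diff[OF A] cond_expec_ident[OF A] L2_martingale_def)
  then have "cond_expec (FB s) (blinfun_apply T (M t - M s)) = 0"
    using F22_apply[OF T order_refl, of "M t - M s"] by simp
  with cond_expec_orth[OF filtration_subalgebra[OF FB st(1)] z, of "blinfun_apply T (M t - M s)"]
  show ?thesis by simp
qed

lemma elem_integral_adapted:
  assumes FA: "filtration FA" and FB: "filtration FB" and E: "E \<in> elem_data FA FB"
    and X: "adapted FA X"
  shows "adapted FB (elem_integral E X)"
  unfolding adapted_def
proof (intro allI impI)
  fix u :: real assume u: "0 \<le> u"
  note sub = subspace_L2_of[OF filtration_subalgebra[OF FB u]]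
  note subA = subspace_L2_of[OF filtration_subalgebra[OF FA u]]
  have X_in: "X r \<in> L2_of (FA u)" if "0 \<le> r" "r \<le> u" for r
    using X filtration_L2_of_mono[OF FA that] that by (auto simp: adapted_def)
  show "elem_integral E X u \<in> L2_of (FB u)"
    using E
  proof (induction rule: elem_data_induct)
    case (Nil H0)
    then show ?case using subspace_0[OF sub] by simp
  next
    case (Cons H0 s t Hi Hs)
    have "blinfun_apply Hi (X (min t u) - X (min s u)) \<in> L2_of (FB u)"
    proof (cases "s \<le> u")
      case True
      then show ?thesis using Cons.hyps u
        by (intro F22_maps_L2_of[OF FA FB Cons.hyps(3)] subspace_diff[OF subA] X_in) auto
    next
      case False
      then show ?thesis using Cons.hyps subspace_0[OF sub] by (simp add: min_def)
    qed
    then show ?case using Cons.IH subspace_add[OF sub] by (simp add: elem_integral_Cons)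
  qed
qed

lemma elem_integral_martingale:
  assumes FA: "filtration FA" and FB: "filtration FB" and E: "E \<in> elem_data FA FB"
    and M: "L2_martingale FA M"
  shows "L2_martingale FB (elem_integral E M)"
  unfolding L2_martingale_def
proof (intro conjI allI impI)
  show ad: "adapted FB (elem_integral E M)"
    using M by (intro elem_integral_adapted[OF FA FB E]) (simp add: L2_martingale_def)
  fix s t :: real assume st: "0 \<le> s \<and> s \<le> t"
  then obtain n p where ap: "adapted_partition FA FB E s t n p"
    using ex_adapted_partition[OF FA FB E] by blast
  note p = adapted_partitionD[OF ap]
  note b = partition_bounds[OF p(1-3)] partition_step[OF p(1)]
  show "cond_expec (FB s) (elem_integral E M t) = elem_integral E M s"
  proof (rule cond_expec_eqI[OF filtration_subalgebra[OF FB]])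
    fix z assume z: "z \<in> L2_of (FB s)"
    have "blinfun_apply (elem_process E (p (Suc j))) (M (p (Suc j)) - M (p j)) \<bullet> z = 0" if j: "j < n" for j
    proof -
      have "0 \<le> p j" "s \<le> p j" "p j \<le> p (Suc j)" using b(1)[of j] b(3)[of j] j st by auto
      moreover from this have "z \<in> L2_of (FB (p j))" using filtration_L2_of_mono[OF FB, of s "p j"] st z by auto
      ultimately show ?thesis by (intro F22_martingale_increment_orthogonal[OF FA FB M p(5)[OF j]])
    qed
    then show "(elem_integral E M t - elem_integral E M s) \<bullet> z = 0"
      unfolding p(4) by (simp add: inner_sum_left)
  qed (use ad st in \<open>auto simp: adapted_def\<close>)
qed

text \<open>The terms \<open>h\<^sub>j [M(p\<^bsub>j+1\<^esub>) - M(p\<^sub>j)]\<close> are pairwise orthogonal, so the squared norm of their sum is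
  at most \<open>\<Sum>\<^sub>j \<parallel>h\<^sub>j\<parallel>\<^sup>2 \<kappa>\<^sub>M((p\<^sub>j, p\<^bsub>j+1\<^esub>])\<close>, which is the integral of the step function \<open>\<parallel>E\<parallel>\<^sup>2\<close>.\<close>

lemma elem_integral_mart_bound:
  assumes FA: "filtration FA" and FB: "filtration FB" and E: "E \<in> elem_data FA FB"
    and M: "L2_martingale FA M" "continuous_on {0..} M" and st: "0 \<le> s" "s \<le> t"
  shows "ennreal ((norm (elem_integral E M t - elem_integral E M s))\<^sup>2) \<le>
    (\<integral>\<^sup>+u\<in>{s<..t}. ennreal ((norm (elem_process E u))\<^sup>2) \<partial>kappa_mart M)"
proof -
  obtain n p where ap: "adapted_partition FA FB E s t n p"
    using ex_adapted_partition[OF FA FB E st] by blast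
  note p = adapted_partitionD[OF ap]
  note b = partition_bounds[OF p(1-3)] partition_step[OF p(1)]
  note \<mu> = halfline_measure_kappa_mart[OF FA M]
  define h where "h j = elem_process E (p (Suc j))" for j
  define x where "x j = blinfun_apply (h j) (M (p (Suc j)) - M (p j))" for j
  have b': "0 \<le> p j" "p j \<le> p (Suc j)" if "j < n" for j using b(1)[of j] b(3)[of j] that st by auto
  have ad: "adapted FB (elem_integral E M)"
    using M by (intro elem_integral_adapted[OF FA FB E]) (simp add: L2_martingale_def)
  have x_in: "x i \<in> L2_of (FB (p j))" if "i < j" "j < n" for i j
  proof -
    have le: "p i \<le> p (Suc i)" "p (Suc i) \<le> p j" "0 \<le> p i" "0 \<le> p j"
      using b'[of i] b'[of j] that monotone_onD[OF p(1), of "Suc i" j] by auto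
    have M_in: "M r \<in> L2_of (FA (p j))" if "0 \<le> r" "r \<le> p j" for r
      using M(1) filtration_L2_of_mono[OF FA that] that by (auto simp: L2_martingale_def adapted_def)
    have "i < n" using that by simp
    show ?thesis
      unfolding x_def h_def using le
      by (intro F22_maps_L2_of[OF FA FB p(5)[OF \<open>i < n\<close>]] M_in
          subspace_diff[OF subspace_L2_of[OF filtration_subalgebra[OF FA]]]) auto
  qed
  have "(norm (elem_integral E M t - elem_integral E M s))\<^sup>2 = (norm (\<Sum>j<n. x j))\<^sup>2"
    unfolding p(4) x_def h_def ..
  also have "\<dots> = (\<Sum>j<n. (norm (x j))\<^sup>2)"
  proof (rule norm_sum_orthogonal_increments)
    fix j assume j: "j < n"
    have "(\<Sum>i<j. x i) \<in> L2_of (FB (p j))"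
      using x_in j b'[OF j]
      by (intro subspace_sum[OF subspace_L2_of[OF filtration_subalgebra[OF FB]]]) auto
    then show "x j \<bullet> (\<Sum>i<j. x i) = 0"
      unfolding x_def[of j] h_def[of j] using b'[OF j]
      by (intro F22_martingale_increment_orthogonal[OF FA FB M(1) p(5)[OF j]])
  qed
  also have "\<dots> \<le> (\<Sum>j<n. (norm (h j))\<^sup>2 * (norm (M (p (Suc j)) - M (p j)))\<^sup>2)"
    unfolding power_mult_distrib[symmetric] x_def
    by (intro sum_mono power_mono norm_blinfun) auto
  finally have "ennreal ((norm (elem_integral E M t - elem_integral E M s))\<^sup>2) \<le>
      ennreal (\<Sum>j<n. (norm (h j))\<^sup>2 * (norm (M (p (Suc j)) - M (p j)))\<^sup>2)"
    by (rule ennreal_leI)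
  also have "\<dots> = (\<Sum>j<n. ennreal ((norm (h j))\<^sup>2) * ennreal ((norm (M (p (Suc j)) - M (p j)))\<^sup>2))"
    by (simp add: sum_ennreal[symmetric] ennreal_mult del: sum_ennreal)
  also have "\<dots> = (\<Sum>j<n. \<integral>\<^sup>+u\<in>{p j<..p (Suc j)}. ennreal ((norm (elem_process E u))\<^sup>2) \<partial>kappa_mart M)"
  proof (rule sum.cong[OF refl])
    fix j assume "j \<in> {..<n}"
    then have j: "j < n" by simp
    show "ennreal ((norm (h j))\<^sup>2) * ennreal ((norm (M (p (Suc j)) - M (p j)))\<^sup>2)
      = (\<integral>\<^sup>+u\<in>{p j<..p (Suc j)}. ennreal ((norm (elem_process E u))\<^sup>2) \<partial>kappa_mart M)"
      unfolding h_def
      by (rule nn_integral_step[OF \<mu> b'[OF j], symmetric])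
        (rule arg_cong[where f = "\<lambda>T. ennreal ((norm T)\<^sup>2)", OF p(6)[OF j]])
  qed
  also have "\<dots> = (\<integral>\<^sup>+u\<in>{p 0<..p n}. ennreal ((norm (elem_process E u))\<^sup>2) \<partial>kappa_mart M)"
    by (rule nn_integral_Ioc_partition[OF halfline_measureD(1)[OF \<mu>] measurable_compose[OF
        borel_measurable_power[OF strongly_measurable_norm[OF strongly_measurable_elem_process[OF E]]]
        measurable_ennreal] p(1)]) (use p(2) st in simp)
  finally show ?thesis unfolding p(2,3) .
qed

text \<open>The same with the triangle inequality instead of Pythagoras.\<close>

lemma elem_integral_fv_bound:
  assumes FA: "filtration FA" and FB: "filtration FB" and E: "E \<in> elem_data FA FB"
    and A: "continuous_on {0..} A" "locally_bounded_variation A" and st: "0 \<le> s" "s \<le> t"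
  shows "ennreal (norm (elem_integral E A t - elem_integral E A s)) \<le>
    (\<integral>\<^sup>+u\<in>{s<..t}. ennreal (norm (elem_process E u)) \<partial>kappa_fv A)"
proof -
  obtain n p where ap: "adapted_partition FA FB E s t n p"
    using ex_adapted_partition[OF FA FB E st] by blast
  note p = adapted_partitionD[OF ap]
  note b = partition_bounds[OF p(1-3)] partition_step[OF p(1)]
  note \<alpha> = halfline_measure_kappa_fv[OF A]
  define h where "h j = elem_process E (p (Suc j))" for j
  have b': "0 \<le> p j" "p j \<le> p (Suc j)" if "j < n" for j using b(1)[of j] b(3)[of j] that st by auto
  have "norm (elem_integral E A t - elem_integral E A s) \<le> (\<Sum>j<n. norm (h j) * norm (A (p (Suc j)) - A (p j)))"
    unfolding p(4) h_def by (rule order_trans[OF norm_sum sum_mono[OF norm_blinfun]])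
  then have "ennreal (norm (elem_integral E A t - elem_integral E A s)) \<le>
      ennreal (\<Sum>j<n. norm (h j) * norm (A (p (Suc j)) - A (p j)))"
    by (rule ennreal_leI)
  also have "\<dots> = (\<Sum>j<n. ennreal (norm (h j)) * ennreal (norm (A (p (Suc j)) - A (p j))))"
    by (simp add: sum_ennreal[symmetric] ennreal_mult del: sum_ennreal)
  also have "\<dots> \<le> (\<Sum>j<n. ennreal (norm (h j)) * variation A (p j) (p (Suc j)))"
    using b' by (intro sum_mono mult_left_mono norm_increment_le_variation) auto
  also have "\<dots> = (\<Sum>j<n. \<integral>\<^sup>+u\<in>{p j<..p (Suc j)}. ennreal (norm (elem_process E u)) \<partial>kappa_fv A)"
  proof (rule sum.cong[OF refl])
    fix j assume "j \<in> {..<n}"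
    then have j: "j < n" by simp
    show "ennreal (norm (h j)) * variation A (p j) (p (Suc j))
      = (\<integral>\<^sup>+u\<in>{p j<..p (Suc j)}. ennreal (norm (elem_process E u)) \<partial>kappa_fv A)"
      unfolding h_def
      by (rule nn_integral_step[OF \<alpha> b'[OF j], symmetric])
        (rule arg_cong[where f = "\<lambda>T. ennreal (norm T)", OF p(6)[OF j]])
  qed
  also have "\<dots> = (\<integral>\<^sup>+u\<in>{p 0<..p n}. ennreal (norm (elem_process E u)) \<partial>kappa_fv A)"
    by (rule nn_integral_Ioc_partition[OF halfline_measureD(1)[OF \<alpha>] measurable_compose[OF
        strongly_measurable_norm[OF strongly_measurable_elem_process[OF E]]
        measurable_ennreal] p(1)]) (use p(2) st in simp)
  finally show ?thesis unfolding p(2,3) .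
qed

lemma elem_integral_0: "E \<in> elem_data FA FB \<Longrightarrow> elem_integral E X 0 = 0"
  by (induction rule: elem_data_induct) (simp_all add: elem_integral_Cons min_absorb2)

lemma elem_integral_continuous:
  assumes E: "E \<in> elem_data FA FB" and X: "continuous_on {0..} X"
  shows "continuous_on {0..} (elem_integral E X)"
  using E
proof (induction rule: elem_data_induct)
  case (Nil H0)
  then show ?case by simp
next
  case (Cons H0 s t Hi Hs)
  have "continuous_on {0..} (\<lambda>u. X (min r u))" if "0 \<le> r" for r
    by (rule continuous_on_compose2[OF X]) (use that in \<open>auto intro!: continuous_intros\<close>)
  then have "continuous_on {0..} (\<lambda>u. blinfun_apply Hi (X (min t u) - X (min s u)) + elem_integral (H0, Hs) X u)"
    using Cons.hyps Cons.IH
    by (intro continuous_on_add bounded_linear.continuous_on[OF blinfun.bounded_linear_right] continuous_on_diff) auto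
  then show ?case by (simp add: elem_integral_Cons)
qed

lemma elem_integral_decomposition:
  assumes E: "E \<in> elem_data FA FB" and D: "L2_decomposition FA X M A" and u: "0 \<le> u"
  shows "elem_integral E X u = elem_integral E M u + elem_integral E A u"
  using E
proof (induction rule: elem_data_induct)
  case (Cons H0 s t Hi Hs)
  have "X (min t u) - X (min s u) = (M (min t u) - M (min s u)) + (A (min t u) - A (min s u))"
    using L2_decompositionD(2)[OF D, of "min t u"] L2_decompositionD(2)[OF D, of "min s u"] Cons.hyps u
    by (simp add: algebra_simps)
  then show ?case
    unfolding elem_integral_Cons Cons.IH by (simp add: blinfun.add_right)
qed simp

definition elem_diff :: "'v::real_vector elem_data \<Rightarrow> 'v elem_data \<Rightarrow> 'v elem_data"
  where "elem_diff E F = (fst E - fst F, snd E @ map (\<lambda>(s, t, G). (s, t, - G)) (snd F))"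

lemma elem_process_diff: "elem_process (elem_diff E F) u = elem_process E u - elem_process F u"
proof -
  have "(\<Sum>(s, t, G)\<leftarrow>map (\<lambda>(s, t, G). (s, t, - G)) Gs. indicator {s<..t} u *\<^sub>R G)
    = - (\<Sum>(s, t, G)\<leftarrow>Gs. indicator {s<..t} u *\<^sub>R G)" for Gs :: "(real \<times> real \<times> 'a) list"
    by (induction Gs) auto
  then show ?thesis by (simp add: elem_process_def elem_diff_def scaleR_diff_right)
qed

lemma elem_integral_diff:
  fixes E F :: "('v::real_normed_vector \<Rightarrow>\<^sub>L 'w::real_normed_vector) elem_data"
  shows "elem_integral (elem_diff E F) X u = elem_integral E X u - elem_integral F X u"
proof -
  have "(\<Sum>(s, t, G)\<leftarrow>map (\<lambda>(s, t, G). (s, t, - G)) Gs. blinfun_apply G (X (min t u) - X (min s u)))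
    = - (\<Sum>(s, t, G)\<leftarrow>Gs. blinfun_apply G (X (min t u) - X (min s u)))" for Gs :: "(real \<times> real \<times> ('v \<Rightarrow>\<^sub>L 'w)) list"
    by (induction Gs) (auto simp: blinfun.minus_left)
  then show ?thesis by (simp add: elem_integral_def elem_diff_def)
qed

lemma elem_data_diff:
  assumes FA: "filtration FA" and FB: "filtration FB"
    and E: "E \<in> elem_data FA FB" and F: "F \<in> elem_data FA FB"
  shows "elem_diff E F \<in> elem_data FA FB"
  using E F subspace_diff[OF subspace_F22[OF FA FB order_refl]] subspace_neg[OF subspace_F22[OF FA FB]]
  by (fastforce simp: elem_data_def elem_diff_def)

section \<open>Products of elementary processes\<close>

text \<open>The product of \<open>1\<^bsub>(s, t]\<^esub> K\<close> and \<open>1\<^bsub>(s', t']\<^esub> H\<close> lives on \<open>(max s s', min t t']\<close>; the outer \<open>max\<close>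
  replaces a negative interval by an empty one.\<close>

definition elem_compose ::
  "('v::real_normed_vector \<Rightarrow>\<^sub>L 'w::real_normed_vector) elem_data \<Rightarrow> ('u::real_normed_vector \<Rightarrow>\<^sub>L 'v) elem_data
    \<Rightarrow> ('u \<Rightarrow>\<^sub>L 'w) elem_data"
  where "elem_compose E F = (fst E o\<^sub>L fst F,
    concat (map (\<lambda>(s, t, K). map (\<lambda>(s', t', G). (max s s', max (max s s') (min t t'), K o\<^sub>L G)) (snd F)) (snd E)))"

lemma elem_data_entry:
  assumes "E \<in> elem_data FA FB" "(s, t, G) \<in> set (snd E)"
  shows "0 \<le> s" "s \<le> t" "G \<in> F22 FA FB s"
proof -
  obtain H0 Hs where E: "E = (H0, Hs)" by (cases E)
  have "\<forall>(s, t, G)\<in>set Hs. 0 \<le> s \<and> s \<le> t \<and> G \<in> F22 FA FB s"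
    using assms(1) unfolding elem_data_def E by blast
  from bspec[OF this assms(2)[unfolded E snd_conv]] show "0 \<le> s" "s \<le> t" "G \<in> F22 FA FB s"
    by simp_all
qed

lemma elem_data_compose:
  assumes "E \<in> elem_data FB FC" "F \<in> elem_data FA FB"
  shows "elem_compose E F \<in> elem_data FA FC"
proof -
  have "K o\<^sub>L G \<in> F22 FA FC (max s s')" if "K \<in> F22 FB FC s" "G \<in> F22 FA FB s'" for K G s s'
    using F22_compose[OF F22_mono[OF _ that(1)] F22_mono[OF _ that(2)], of "max s s'"] by simp
  then show ?thesis
    using assms F22_compose[of "fst E" FB FC 0 "fst F" FA]
    by (fastforce simp: elem_data_def elem_compose_def)
qed

lemma elem_process_compose:
  assumes E: "E \<in> elem_data FB FC" and F: "F \<in> elem_data FA FB" and u: "0 \<le> u"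
  shows "elem_process (elem_compose E F) u = elem_process E u o\<^sub>L elem_process F u"
proof -
  note bil = bounded_bilinear_blinfun_compose
  note lin = bounded_bilinear.add_left[OF bil] bounded_bilinear.add_right[OF bil]
    bounded_bilinear.scaleR_left[OF bil] bounded_bilinear.scaleR_right[OF bil]
    bounded_bilinear.zero_left[OF bil] bounded_bilinear.zero_right[OF bil]
  obtain K0 Ks where E_eq: "E = (K0, Ks)" by (cases E)
  obtain G0 Gs where F_eq: "F = (G0, Gs)" by (cases F)
  have inner: "(\<Sum>(s', t', L)\<leftarrow>map (\<lambda>(s', t', G). (max s s', max (max s s') (min t t'), K o\<^sub>L G)) Gs.
        indicator {s'<..t'} u *\<^sub>R L)
      = (indicator {s<..t} u *\<^sub>R K) o\<^sub>L (\<Sum>(s', t', G)\<leftarrow>Gs. indicator {s'<..t'} u *\<^sub>R G)"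
    for s t and K :: "'a L2 \<Rightarrow>\<^sub>L 'b L2" and Gs :: "(real \<times> real \<times> ('c L2 \<Rightarrow>\<^sub>L 'a L2)) list"
    by (induction Gs) (auto simp: lin indicator_def)
  have outer: "(\<Sum>(s, t, L)\<leftarrow>concat (map (\<lambda>(s, t, K). map (\<lambda>(s', t', G). (max s s', max (max s s') (min t t'), K o\<^sub>L G)) Gs) Ks).
        indicator {s<..t} u *\<^sub>R L)
      = (\<Sum>(s, t, K)\<leftarrow>Ks. indicator {s<..t} u *\<^sub>R K) o\<^sub>L (\<Sum>(s', t', G)\<leftarrow>Gs. indicator {s'<..t'} u *\<^sub>R G)"
    for Ks :: "(real \<times> real \<times> ('a L2 \<Rightarrow>\<^sub>L 'b L2)) list"
  proof (induction Ks)
    case Nil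
    then show ?case by (simp add: lin)
  next
    case (Cons k Ks)
    obtain s t K where k: "k = (s, t, K)" by (cases k)
    show ?case
      unfolding k list.map concat.simps map_append sum_list_append sum_list.Cons prod.case Cons.IH inner lin ..
  qed
  have zero: "(\<Sum>(s, t, L)\<leftarrow>Ls. indicator {s<..t} 0 *\<^sub>R L) = 0"
    if "\<forall>(s, t, L)\<in>set Ls. 0 \<le> s" for Ls :: "(real \<times> real \<times> 'x::real_vector) list"
    using that by (induction Ls) auto
  \<comment> \<open>the values at \<open>0\<close> are separate data and have to be multiplied separately\<close>
  show ?thesis
  proof (cases "u = 0")
    case True
    have "\<forall>(s, t, L)\<in>set (snd E). 0 \<le> s" "\<forall>(s, t, L)\<in>set (snd F). 0 \<le> s"
      "\<forall>(s, t, L)\<in>set (snd (elem_compose E F)). 0 \<le> s"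
      using elem_data_entry(1)[OF E] elem_data_entry(1)[OF F] elem_data_entry(1)[OF elem_data_compose[OF E F]]
      by fast+
    then show ?thesis
      unfolding True elem_process_def by (simp add: zero) (simp add: elem_compose_def)
  next
    case False
    then show ?thesis
      using outer[of Ks] by (simp add: elem_process_def elem_compose_def E_eq F_eq)
  qed
qed

text \<open>The scalar case of associativity: \<open>X\<close> stopped at the end points of \<open>(s', t']\<close>, and then at those of
  \<open>(s, t]\<close>, has the increments of \<open>X\<close> over the intersection of the two intervals.\<close>

lemma increment_min_max:
  fixes X :: "real \<Rightarrow> 'v::ab_group_add"
  assumes "s \<le> t" "s' \<le> t'"
  shows "X (min (max (max s s') (min t t')) u) - X (min (max s s') u)
    = X (min t' (min t u)) - X (min s' (min t u)) - (X (min t' (min s u)) - X (min s' (min s u)))"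
proof -
  consider "t' \<le> s" | "t \<le> s'" | "s < t'" "s' < t" by linarith
  then show ?thesis
  proof cases
    case 1
    then have "max (max s s') (min t t') = max s s'" "min t' (min t u) = min t' (min s u)"
      "min s' (min t u) = min s' (min s u)"
      using assms by linarith+
    then show ?thesis by simp
  next
    case 2
    then have "max (max s s') (min t t') = max s s'" "min t' (min t u) = min s' (min t u)"
      "min t' (min s u) = min s' (min s u)"
      using assms by linarith+
    then show ?thesis by simp
  next
    case 3
    then have "max (max s s') (min t t') = min t t'" using assms by (simp add: min_def max_def)
    moreover have "X (min t' (min t u)) = X (min (min t t') u)" by (simp add: min.commute min.left_commute)
    moreover have "X (min t' (min s u)) = X (min s u)" using 3 by (simp add: min_def)
    moreover have "X (min s' (min t u)) = X (min s' u)" using 3 by (simp add: min_def)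
    moreover have "X (min (max s s') u) = X (min s u) + X (min s' u) - X (min s' (min s u))"
      by (simp add: min_def max_def)
    ultimately show ?thesis by simp
  qed
qed

lemma elem_integral_compose:
  assumes E: "E \<in> elem_data FB FC" and F: "F \<in> elem_data FA FB"
  shows "elem_integral (elem_compose E F) X u = elem_integral E (elem_integral F X) u"
proof -
  obtain K0 Ks where E_eq: "E = (K0, Ks)" by (cases E)
  obtain G0 Gs where F_eq: "F = (G0, Gs)" by (cases F)
  have inner: "(\<Sum>(s', t', L)\<leftarrow>map (\<lambda>(s', t', G). (max s s', max (max s s') (min t t'), K o\<^sub>L G)) Gs.
        blinfun_apply L (X (min t' u) - X (min s' u)))
      = blinfun_apply K ((\<Sum>(s', t', G)\<leftarrow>Gs. blinfun_apply G (X (min t' (min t u)) - X (min s' (min t u)))) -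
          (\<Sum>(s', t', G)\<leftarrow>Gs. blinfun_apply G (X (min t' (min s u)) - X (min s' (min s u)))))"
    if "s \<le> t" "\<forall>(s', t', G)\<in>set Gs. s' \<le> t'"
    for s t and K :: "'a L2 \<Rightarrow>\<^sub>L 'b L2" and Gs :: "(real \<times> real \<times> ('c L2 \<Rightarrow>\<^sub>L 'a L2)) list"
    using that(2)
  proof (induction Gs)
    case (Cons g Gs)
    obtain s' t' G where g: "g = (s', t', G)" by (cases g)
    have "s' \<le> t'" using Cons.prems g by simp
    have step: "blinfun_apply (K o\<^sub>L G) (p - q) + blinfun_apply K (S - S')
      = blinfun_apply K ((blinfun_apply G p + S) - (blinfun_apply G q + S'))" for p q S S'
      by (simp add: blinfun.add_right blinfun.diff_right)
    have IH: "\<forall>(s', t', G)\<in>set Gs. s' \<le> t'" using Cons.prems by simp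
    show ?case
      unfolding g list.map sum_list.Cons prod.case Cons.IH[OF IH]
        increment_min_max[OF that(1) \<open>s' \<le> t'\<close>] step ..
  qed simp
  have Gs: "\<forall>(s', t', G)\<in>set Gs. s' \<le> t'" using F F_eq by (auto simp: elem_data_def)
  have "\<forall>(s, t, K)\<in>set Ks. s \<le> t" using E E_eq by (auto simp: elem_data_def)
  then have "(\<Sum>(s, t, L)\<leftarrow>concat (map (\<lambda>(s, t, K). map (\<lambda>(s', t', G). (max s s', max (max s s') (min t t'), K o\<^sub>L G)) Gs) Ks).
        blinfun_apply L (X (min t u) - X (min s u)))
      = (\<Sum>(s, t, K)\<leftarrow>Ks. blinfun_apply K (elem_integral F X (min t u) - elem_integral F X (min s u)))"
    unfolding elem_integral_def F_eq snd_conv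
  proof (induction Ks)
    case (Cons k Ks)
    obtain s t K where k: "k = (s, t, K)" by (cases k)
    have "s \<le> t" and IH: "\<forall>(s, t, K)\<in>set Ks. s \<le> t" using Cons.prems k by simp_all
    show ?case
      unfolding k using Cons.IH[OF IH] inner[OF \<open>s \<le> t\<close> Gs, of K] by simp
  qed simp
  moreover have "elem_integral (elem_compose E F) X u =
      (\<Sum>(s, t, L)\<leftarrow>concat (map (\<lambda>(s, t, K). map (\<lambda>(s', t', G). (max s s', max (max s s') (min t t'), K o\<^sub>L G)) Gs) Ks).
        blinfun_apply L (X (min t u) - X (min s u)))"
    by (simp only: elem_integral_def elem_compose_def E_eq F_eq snd_conv)
  moreover have "elem_integral E (elem_integral F X) u =
      (\<Sum>(s, t, K)\<leftarrow>Ks. blinfun_apply K (elem_integral F X (min t u) - elem_integral F X (min s u)))"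
    by (simp only: elem_integral_def[of "(K0, Ks)"] E_eq snd_conv)
  ultimately show ?thesis by (simp only:)
qed

section \<open>Limits of elementary integrals\<close>

lemma tendsto_0_of_ennreal_power_le:
  fixes x :: "nat \<Rightarrow> 'v::real_normed_vector"
  assumes le: "\<And>n. ennreal ((norm (x n)) ^ k) \<le> c n" and c: "c \<longlonglongrightarrow> 0" and k: "0 < k"
  shows "x \<longlonglongrightarrow> 0"
proof (rule tendstoI)
  fix e :: real assume e: "e > 0"
  then have "\<forall>\<^sub>F n in sequentially. c n < ennreal (e ^ k)"
    using c unfolding ennreal_tendsto_0_iff by simp
  then show "\<forall>\<^sub>F n in sequentially. dist (x n) 0 < e"
  proof eventually_elim
    case (elim n)
    then have "ennreal ((norm (x n)) ^ k) < ennreal (e ^ k)" using le[of n] by (rule le_less_trans[rotated])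
    then have "(norm (x n)) ^ k < e ^ k" by (simp add: ennreal_less_iff)
    then have "norm (x n) < e" by (rule power_less_imp_less_base) (use e in simp)
    then show ?case by simp
  qed
qed

text \<open>Used with \<open>k = 2\<close> for integrals against \<open>M\<close> and with \<open>k = 1\<close> for those against \<open>A\<close>; \<open>c n T\<close> is the
  energy of the approximation error up to time \<open>T\<close>.\<close>

lemma ex_uniform_limit_of_ennreal_power_le:
  fixes I :: "nat \<Rightarrow> real \<Rightarrow> 'w::banach"
  assumes le: "\<And>m n u T. 0 \<le> u \<Longrightarrow> u \<le> T \<Longrightarrow>
      ennreal ((norm (I m u - I n u)) ^ k) \<le> 2 * c m T + 2 * c n T"
    and c: "\<And>T. 0 \<le> T \<Longrightarrow> (\<lambda>n. c n T) \<longlonglongrightarrow> 0" and k: "0 < k"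
  shows "\<exists>Y. \<forall>T\<ge>0. uniform_limit {0..T} I Y sequentially"
proof (intro exI allI impI)
  fix T :: real assume T: "0 \<le> T"
  have "uniformly_Cauchy_on {0..T} I"
    unfolding uniformly_Cauchy_on_def
  proof (intro allI impI)
    fix e :: real assume e: "e > 0"
    then have "\<forall>\<^sub>F n in sequentially. c n T < ennreal (e ^ k / 4)"
      using c[OF T] unfolding ennreal_tendsto_0_iff by simp
    then obtain N where N: "\<And>n. N \<le> n \<Longrightarrow> c n T < ennreal (e ^ k / 4)"
      unfolding eventually_sequentially by blast
    have "dist (I m u) (I n u) < e" if "u \<in> {0..T}" "N \<le> m" "N \<le> n" for u m n
    proof -
      have "ennreal ((norm (I m u - I n u)) ^ k) \<le> 2 * c m T + 2 * c n T" using that by (intro le) auto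
      also have "\<dots> < ennreal (e ^ k / 2) + ennreal (e ^ k / 2)"
      proof -
        have "2 * c j T < ennreal (e ^ k / 2)" if "N \<le> j" for j
        proof -
          have "2 * c j T < 2 * ennreal (e ^ k / 4)"
            using N[OF that] by (intro ennreal_mult_strict_left_mono) auto
          also have "\<dots> = ennreal (e ^ k / 2)" using e by (simp flip: ennreal_numeral ennreal_mult)
          finally show ?thesis .
        qed
        then show ?thesis using that by (intro add_strict_mono) auto
      qed
      also have "\<dots> = ennreal (e ^ k)" using e by (simp flip: ennreal_plus)
      finally have "(norm (I m u - I n u)) ^ k < e ^ k" by (simp add: ennreal_less_iff)
      then have "norm (I m u - I n u) < e" by (rule power_less_imp_less_base) (use e in simp)
      then show ?thesis by (simp add: dist_norm)
    qed
    then show "\<exists>N. \<forall>u\<in>{0..T}. \<forall>m\<ge>N. \<forall>n\<ge>N. dist (I m u) (I n u) < e" by blast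
  qed
  then show "uniform_limit {0..T} I (\<lambda>u. lim (\<lambda>n. I n u)) sequentially"
    unfolding uniformly_convergent_uniform_limit_iff[symmetric] by (rule Cauchy_uniformly_convergent)
qed

lemma tendsto_2_add_2:
  fixes f g :: "nat \<Rightarrow> ennreal"
  assumes "f \<longlonglongrightarrow> 0" "g \<longlonglongrightarrow> 0"
  shows "(\<lambda>n. 2 * f n + 2 * g n) \<longlonglongrightarrow> 0"
proof -
  have "2 < (top :: ennreal)" by simp
  from tendsto_add[OF ennreal_tendsto_cmult[OF this assms(1)] ennreal_tendsto_cmult[OF this assms(2)]]
  show ?thesis by simp
qed

lemma continuous_on_halfline:
  fixes f :: "real \<Rightarrow> 'v::topological_space"
  assumes "\<And>T. 0 \<le> T \<Longrightarrow> continuous_on {0..T} f"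
  shows "continuous_on {0..} f"
  unfolding continuous_on_def
proof
  fix x :: real assume x: "x \<in> {0..}"
  have "at x within {0..} = at x within {0..x + 1}"
    by (rule at_within_nhd[of x "{..<x + 1}"]) auto
  moreover have "(f \<longlongrightarrow> f x) (at x within {0..x + 1})"
    using assms[of "x + 1"] x by (simp add: continuous_on_def)
  ultimately show "(f \<longlongrightarrow> f x) (at x within {0..})" by simp
qed

lemma nn_integral_Ioc_add:
  assumes \<mu>: "sets \<mu> = sets borel_nonneg" and f: "f \<in> borel_measurable borel_nonneg"
    and le: "0 \<le> u" "u \<le> v" "v \<le> w"
  shows "(\<integral>\<^sup>+x\<in>{u<..v}. f x \<partial>\<mu>) + (\<integral>\<^sup>+x\<in>{v<..w}. f x \<partial>\<mu>) = (\<integral>\<^sup>+x\<in>{u<..w}. f x \<partial>\<mu>)"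
proof -
  define p :: "nat \<Rightarrow> real" where "p i = (if i = 0 then u else if i = 1 then v else w)" for i
  have p: "p 0 = u" "p (Suc 0) = v" "p (Suc (Suc 0)) = w" by (simp_all add: p_def)
  have "mono_on {..Suc (Suc 0)} p" using le by (intro mono_onI) (auto simp: p_def)
  from nn_integral_Ioc_partition[OF \<mu> f this] le(1) show ?thesis by (simp add: p)
qed

section \<open>The stochastic integral\<close>

context
  fixes FA :: "real \<Rightarrow> 'a::cstar_prob_space set" and X M A
  assumes FA: "filtration FA" and D: "L2_decomposition FA X M A"
begin

lemma sets_kappa: "sets (kappa_mart M) = sets borel_nonneg" "sets (kappa_fv A) = sets borel_nonneg"
  by (rule halfline_measureD(1)[OF halfline_measure_decomposition_mart[OF FA D]]
      halfline_measureD(1)[OF halfline_measure_decomposition_fv[OF FA D]])+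

lemma energy_one_finite:
  assumes t: "0 \<le> t"
  shows "energy_of M A t (\<lambda>_. 1::real) < \<infinity>"
proof -
  have "energy_of M A t (\<lambda>_. 1::real) = emeasure (kappa_mart M) {0<..t} + emeasure (kappa_fv A) {0<..t}"
    by (simp add: energy_def sets_kappa)
  also have "\<dots> < \<infinity>"
    using halfline_measureD(4)[OF halfline_measure_decomposition_mart[OF FA D] order_refl t]
      halfline_measureD(4)[OF halfline_measure_decomposition_fv[OF FA D] order_refl t]
      L2_decompositionD(7)[OF D] t
    by (simp add: locally_bounded_variation_def)
  finally show ?thesis .
qed

lemma energy_elem_process_finite:
  assumes E: "E \<in> elem_data FA' FB'" and t: "0 \<le> t"
  shows "energy_of M A t (elem_process E) < \<infinity>"
proof -
  obtain C where C: "1 \<le> C" "\<And>u. 0 \<le> u \<Longrightarrow> norm (elem_process E u) \<le> C"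
    using elem_process_bounded[OF E] by blast
  have "energy_of M A t (elem_process E) \<le> ennreal (C\<^sup>2) * energy_of M A t (\<lambda>_. 1::real)"
    by (rule energy_scale[OF sets_kappa strongly_measurable_const C(1)]) (simp add: C(2))
  also have "\<dots> < \<infinity>" using energy_one_finite[OF t] by (simp add: ennreal_mult_less_top)
  finally show ?thesis .
qed

lemma energy_elem_diff_le:
  assumes E: "E \<in> elem_data FA' FB'" and F: "F \<in> elem_data FA' FB'" and H: "strongly_measurable H"
  shows "energy_of M A t (elem_process (elem_diff E F)) \<le>
    2 * energy_of M A t (\<lambda>s. elem_process E s - H s) + 2 * energy_of M A t (\<lambda>s. elem_process F s - H s)"
proof (rule energy_triangle[OF sets_kappa])
  show "strongly_measurable (\<lambda>s. elem_process E s - H s)" "strongly_measurable (\<lambda>s. elem_process F s - H s)"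
    by (rule strongly_measurable_diff[OF strongly_measurable_elem_process H], rule E F)+
  show "norm (elem_process (elem_diff E F) s) \<le> norm (elem_process E s - H s) + norm (elem_process F s - H s)" for s
    using norm_triangle_ineq4[of "elem_process E s - H s" "elem_process F s - H s"]
    by (simp add: elem_process_diff)
qed

text \<open>An error of finite energy does not affect finiteness, and elementary processes, being bounded, have
  finite energy.\<close>

lemma energy_finite_of_approx:
  assumes H: "strongly_measurable H" and E: "\<And>n. E n \<in> elem_data FA' FB'" and t: "0 \<le> t"
    and lim: "(\<lambda>n. energy_of M A t (\<lambda>s. elem_process (E n) s - H s)) \<longlonglongrightarrow> 0"
  shows "energy_of M A t H < \<infinity>"
proof -
  have "\<forall>\<^sub>F n in sequentially. energy_of M A t (\<lambda>s. elem_process (E n) s - H s) < ennreal 1"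
    by (rule lim[unfolded ennreal_tendsto_0_iff, rule_format]) simp
  then obtain n where n: "energy_of M A t (\<lambda>s. elem_process (E n) s - H s) < ennreal 1"
    using eventually_happens trivial_limit_sequentially by blast
  note Em = strongly_measurable_elem_process[OF E]
  have "energy_of M A t H \<le> 2 * energy_of M A t (elem_process (E n)) + 2 * energy_of M A t (\<lambda>s. elem_process (E n) s - H s)"
  proof (rule energy_triangle[OF sets_kappa Em strongly_measurable_diff[OF Em H]])
    show "norm (H s) \<le> norm (elem_process (E n) s) + norm (elem_process (E n) s - H s)" for s
      using norm_triangle_ineq4[of "elem_process (E n) s" "elem_process (E n) s - H s"] by simp
  qed
  also have "\<dots> < \<infinity>"
    using energy_elem_process_finite[OF E t] less_trans[OF n ennreal_less_top]
    by (simp add: ennreal_mult_less_top)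
  finally show ?thesis .
qed

end

context
  fixes FA :: "real \<Rightarrow> 'a::cstar_prob_space set" and FB :: "real \<Rightarrow> 'b::cstar_prob_space set" and X M A
  assumes FA: "filtration FA" and FB: "filtration FB" and D: "L2_decomposition FA X M A"
begin

lemma elem_integral_mart_le_energy:
  assumes E: "E \<in> elem_data FA FB" and u: "0 \<le> u" "u \<le> T"
  shows "ennreal ((norm (elem_integral E M u))\<^sup>2) \<le> energy_of M A T (elem_process E)"
proof -
  have "ennreal ((norm (elem_integral E M u))\<^sup>2) \<le>
      (\<integral>\<^sup>+s\<in>{0<..u}. ennreal ((norm (elem_process E s))\<^sup>2) \<partial>kappa_mart M)"
    using elem_integral_mart_bound[OF FA FB E L2_decompositionD(3,4)[OF D] order_refl u(1)]
    by (simp add: elem_integral_0[OF E])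
  also have "\<dots> \<le> energy_of M A u (elem_process E)" by (simp add: energy_def)
  also have "\<dots> \<le> energy_of M A T (elem_process E)" by (rule energy_mono_time[OF u(2)])
  finally show ?thesis .
qed

lemma elem_integral_fv_le_energy:
  assumes E: "E \<in> elem_data FA FB" and u: "0 \<le> u" "u \<le> T"
  shows "ennreal (norm (elem_integral E A u)) \<le> energy_of M A T (elem_process E)"
proof -
  have "ennreal (norm (elem_integral E A u)) \<le>
      (\<integral>\<^sup>+s\<in>{0<..u}. ennreal (norm (elem_process E s)) \<partial>kappa_fv A)"
    using elem_integral_fv_bound[OF FA FB E L2_decompositionD(6,7)[OF D] order_refl u(1)]
    by (simp add: elem_integral_0[OF E])
  also have "\<dots> \<le> energy_of M A u (elem_process E)" by (simp add: energy_def)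
  also have "\<dots> \<le> energy_of M A T (elem_process E)" by (rule energy_mono_time[OF u(2)])
  finally show ?thesis .
qed

lemma elem_integral_tendsto_0:
  assumes E: "\<And>n. E n \<in> elem_data FA FB" and t: "0 \<le> t"
    and lim: "(\<lambda>n. energy_of M A t (elem_process (E n))) \<longlonglongrightarrow> 0"
  shows "(\<lambda>n. elem_integral (E n) X t) \<longlonglongrightarrow> 0"
proof -
  have "(\<lambda>n. elem_integral (E n) M t) \<longlonglongrightarrow> 0"
    by (rule tendsto_0_of_ennreal_power_le[OF elem_integral_mart_le_energy[OF E t order_refl] lim]) simp
  moreover have "ennreal (norm (elem_integral (E n) A t) ^ 1) \<le> energy_of M A t (elem_process (E n))" for n
    using elem_integral_fv_le_energy[OF E t order_refl] by simp
  then have "(\<lambda>n. elem_integral (E n) A t) \<longlonglongrightarrow> 0"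
    by (rule tendsto_0_of_ennreal_power_le[OF _ lim]) simp
  ultimately have "(\<lambda>n. elem_integral (E n) M t + elem_integral (E n) A t) \<longlonglongrightarrow> 0 + 0"
    by (rule tendsto_add)
  then show ?thesis by (simp add: elem_integral_decomposition[OF E D t])
qed

text \<open>The value is independent of the approximating sequence, since the energy of the difference of two
  such sequences tends to \<open>0\<close>, and with it the integral of the difference.\<close>

lemma stoch_integral_eqI:
  assumes H: "strongly_measurable H" and t: "0 \<le> t"
    and E: "\<And>n. E n \<in> elem_data FA FB" "L_tendsto FA X (\<lambda>n. elem_process (E n)) H"
    and y: "(\<lambda>n. elem_integral (E n) X t) \<longlonglongrightarrow> y"
  shows "stoch_integral FA FB H X t = y"
  unfolding stoch_integral_def
proof (rule the_equality)
  show "\<exists>E. (\<forall>n. E n \<in> elem_data FA FB) \<and> L_tendsto FA X (\<lambda>n. elem_process (E n)) H \<and>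
      (\<lambda>n. elem_integral (E n) X t) \<longlonglongrightarrow> y"
    using E y by blast
  fix y' assume "\<exists>E. (\<forall>n. E n \<in> elem_data FA FB) \<and> L_tendsto FA X (\<lambda>n. elem_process (E n)) H \<and>
      (\<lambda>n. elem_integral (E n) X t) \<longlonglongrightarrow> y'"
  then obtain F where F: "\<And>n. F n \<in> elem_data FA FB" "L_tendsto FA X (\<lambda>n. elem_process (F n)) H"
    and y': "(\<lambda>n. elem_integral (F n) X t) \<longlonglongrightarrow> y'" by blast
  have "(\<lambda>n. elem_integral (elem_diff (E n) (F n)) X t) \<longlonglongrightarrow> 0"
  proof (rule elem_integral_tendsto_0[OF elem_data_diff[OF FA FB E(1) F(1)] t])
    have "(\<lambda>n. 2 * energy_of M A t (\<lambda>s. elem_process (E n) s - H s) + 2 * energy_of M A t (\<lambda>s. elem_process (F n) s - H s)) \<longlonglongrightarrow> 0"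
      using E(2) F(2) t unfolding L_tendsto_iff[OF FA D] by (intro tendsto_2_add_2) blast+
    from tendsto_sandwich[OF _ _ tendsto_const this]
    show "(\<lambda>n. energy_of M A t (elem_process (elem_diff (E n) (F n)))) \<longlonglongrightarrow> 0"
      by (simp add: energy_elem_diff_le[OF FA D E(1) F(1) H])
  qed
  moreover have "(\<lambda>n. elem_integral (elem_diff (E n) (F n)) X t) \<longlonglongrightarrow> y - y'"
    unfolding elem_integral_diff by (rule tendsto_diff[OF y y'])
  ultimately have "y - y' = 0" by (rule LIMSEQ_unique[symmetric])
  then show "y' = y" by simp
qed

lemma stoch_integrableI:
  assumes H: "strongly_measurable H" and E: "\<And>n. E n \<in> elem_data FA FB"
    and lim: "\<And>t. 0 \<le> t \<Longrightarrow> (\<lambda>n. energy_of M A t (\<lambda>s. elem_process (E n) s - H s)) \<longlonglongrightarrow> 0"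
  shows "H \<in> stoch_integrable FA FB X"
  unfolding stoch_integrable_def
proof (intro CollectI conjI exI[of _ "\<lambda>n. elem_process (E n)"] allI)
  show "L2_decomposable FA X" using D unfolding L2_decomposable_def by blast
  show "H \<in> L_space FA X"
    unfolding L_space_iff[OF FA D] using H energy_finite_of_approx[OF FA D H E _ lim] by blast
  show "elem_process (E n) \<in> EP22 FA FB" for n unfolding EP22_def using E by blast
  show "L_tendsto FA X (\<lambda>n. elem_process (E n)) H" unfolding L_tendsto_iff[OF FA D] using lim by blast
qed

end

lemma elem_integral_tendsto:
  assumes E: "E \<in> elem_data FA FB" and t: "0 \<le> t" and Z: "\<And>u. 0 \<le> u \<Longrightarrow> (\<lambda>n. Z n u) \<longlonglongrightarrow> Y u"
  shows "(\<lambda>n. elem_integral E (Z n) t) \<longlonglongrightarrow> elem_integral E Y t"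
  using E
proof (induction rule: elem_data_induct)
  case (Nil H0)
  then show ?case by simp
next
  case (Cons H0 a b Hi Hs)
  have "(\<lambda>n. blinfun_apply Hi (Z n (min b t) - Z n (min a t))) \<longlonglongrightarrow> blinfun_apply Hi (Y (min b t) - Y (min a t))"
    using Cons.hyps t
    by (intro bounded_linear.tendsto[OF blinfun.bounded_linear_right] tendsto_diff Z) simp_all
  from tendsto_add[OF this Cons.IH] show ?case by (simp only: elem_integral_Cons)
qed

lemma adapted_limit:
  assumes N: "\<And>n. adapted F (N n)" and lim: "\<And>u. 0 \<le> u \<Longrightarrow> (\<lambda>n. N n u) \<longlonglongrightarrow> M u"
  shows "adapted F M"
  unfolding adapted_def
proof (intro allI impI)
  show "M t \<in> L2_of (F t)" if "0 \<le> t" for t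
    by (rule closed_sequentially[OF closed_L2_of _ lim[OF that]])
      (use N that in \<open>auto simp: adapted_def\<close>)
qed

lemma L2_martingale_limit:
  assumes F: "filtration F" and N: "\<And>n. L2_martingale F (N n)"
    and lim: "\<And>u. 0 \<le> u \<Longrightarrow> (\<lambda>n. N n u) \<longlonglongrightarrow> M u"
  shows "L2_martingale F M"
  unfolding L2_martingale_def
proof (intro conjI allI impI)
  show "adapted F M" using N by (intro adapted_limit[OF _ lim]) (auto simp: L2_martingale_def)
  show "cond_expec (F s) (M t) = M s" if st: "0 \<le> s \<and> s \<le> t" for s t
  proof (rule LIMSEQ_unique)
    show "(\<lambda>n. cond_expec (F s) (N n t)) \<longlonglongrightarrow> cond_expec (F s) (M t)"
      using st by (intro bounded_linear.tendsto[OF bounded_linear_cond_expec[OF filtration_subalgebra[OF F]]] lim) auto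
    have "cond_expec (F s) (N n t) = N n s" for n using N[of n] st by (simp add: L2_martingale_def)
    then show "(\<lambda>n. cond_expec (F s) (N n t)) \<longlonglongrightarrow> M s" using lim[of s] st by simp
  qed
qed

lemma adapted_add:
  assumes F: "filtration F" and "adapted F X" "adapted F Y"
  shows "adapted F (\<lambda>t. X t + Y t)"
  unfolding adapted_def
proof (intro allI impI)
  fix t :: real assume t: "0 \<le> t"
  show "X t + Y t \<in> L2_of (F t)"
    using assms(2,3) t
    by (intro subspace_add[OF subspace_L2_of[OF filtration_subalgebra[OF F t]]]) (simp_all add: adapted_def)
qed

lemma nn_integral_Ioc_le_energy:
  assumes "0 \<le> s"
  shows "(\<integral>\<^sup>+u\<in>{s<..t}. ennreal ((norm (H u))\<^sup>2) \<partial>\<mu>) \<le> energy \<mu> \<alpha> t H"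
    and "(\<integral>\<^sup>+u\<in>{s<..t}. ennreal (norm (H u)) \<partial>\<alpha>) \<le> energy \<mu> \<alpha> t H"
proof -
  have "(\<integral>\<^sup>+u\<in>{s<..t}. f u \<partial>\<kappa>) \<le> (\<integral>\<^sup>+u\<in>{0<..t}. f u \<partial>\<kappa>)" for f and \<kappa> :: "real measure"
    using assms by (intro nn_integral_mono mult_left_mono) (auto simp: indicator_def)
  note mono = this
  show "(\<integral>\<^sup>+u\<in>{s<..t}. ennreal ((norm (H u))\<^sup>2) \<partial>\<mu>) \<le> energy \<mu> \<alpha> t H"
    unfolding energy_def by (rule add_increasing2[OF zero_le mono])
  show "(\<integral>\<^sup>+u\<in>{s<..t}. ennreal (norm (H u)) \<partial>\<alpha>) \<le> energy \<mu> \<alpha> t H"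
    unfolding energy_def by (rule add_increasing[OF zero_le mono])
qed

text \<open>The martingale and the finite variation part of the integral are the uniform limits of the
  elementary integrals against \<open>M\<close> and against \<open>A\<close>, so they inherit the estimates on increments.
  The constant \<open>2\<close> comes from the quasi-triangle inequality; domination up to a constant is all that
  the convergence \<open>K\<^sub>n \<rightarrow> K\<close> in \<open>\<L>\<^sub>Y\<close> requires.\<close>

lemma ex_stoch_integral_decomposition:
  fixes FA :: "real \<Rightarrow> 'a::cstar_prob_space set" and FB :: "real \<Rightarrow> 'b::cstar_prob_space set"
  assumes FA: "filtration FA" and FB: "filtration FB" and D: "L2_decomposition FA X M A"
    and H: "strongly_measurable H" and E: "\<And>n. E n \<in> elem_data FA FB"
    and lim: "\<And>t. 0 \<le> t \<Longrightarrow> (\<lambda>n. energy_of M A t (\<lambda>s. elem_process (E n) s - H s)) \<longlonglongrightarrow> 0"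
  obtains MY AY where "L2_decomposition FB (stoch_integral FA FB H X) MY AY"
    "\<And>t. 0 \<le> t \<Longrightarrow> (\<lambda>n. elem_integral (E n) X t) \<longlonglongrightarrow> stoch_integral FA FB H X t"
    "\<And>s t. 0 \<le> s \<Longrightarrow> s \<le> t \<Longrightarrow> ennreal ((norm (MY t - MY s))\<^sup>2) \<le>
      2 * (\<integral>\<^sup>+u\<in>{s<..t}. ennreal ((norm (H u))\<^sup>2) \<partial>kappa_mart M)"
    "\<And>s t. 0 \<le> s \<Longrightarrow> s \<le> t \<Longrightarrow> variation AY s t \<le>
      2 * (\<integral>\<^sup>+u\<in>{s<..t}. ennreal (norm (H u)) \<partial>kappa_fv A)"
proof -
  let ?\<mu> = "kappa_mart M" and ?\<alpha> = "kappa_fv A"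
  let ?IM = "\<lambda>s t. \<integral>\<^sup>+u\<in>{s<..t}. ennreal ((norm (H u))\<^sup>2) \<partial>?\<mu>"
  let ?IA = "\<lambda>s t. \<integral>\<^sup>+u\<in>{s<..t}. ennreal (norm (H u)) \<partial>?\<alpha>"
  note DM = L2_decompositionD(3,4)[OF D] and DA = L2_decompositionD(5-7)[OF D]
  note sets = sets_kappa[OF FA D]
  define c where "c n t = energy_of M A t (\<lambda>s. elem_process (E n) s - H s)" for n t
  have c: "(\<lambda>n. c n t) \<longlonglongrightarrow> 0" if "0 \<le> t" for t unfolding c_def by (rule lim[OF that])
  have fin: "energy_of M A t H < \<infinity>" if "0 \<le> t" for t
    by (rule energy_finite_of_approx[OF FA D H E that lim[OF that]])
  note diff = elem_data_diff[OF FA FB E E]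
  have diff_le: "energy_of M A t (elem_process (elem_diff (E m) (E n))) \<le> 2 * c m t + 2 * c n t" for m n t
    unfolding c_def by (rule energy_elem_diff_le[OF FA D E E H])
  have "\<exists>Y. \<forall>T\<ge>0. uniform_limit {0..T} (\<lambda>n. elem_integral (E n) M) Y sequentially"
  proof (rule ex_uniform_limit_of_ennreal_power_le[OF _ c])
    fix m n :: nat and u T :: real assume u: "0 \<le> u" "u \<le> T"
    show "ennreal ((norm (elem_integral (E m) M u - elem_integral (E n) M u))\<^sup>2) \<le> 2 * c m T + 2 * c n T"
      using elem_integral_mart_le_energy[OF FA FB D diff u, of m n] diff_le[of T m n]
      unfolding elem_integral_diff by (rule order_trans)
  qed simp_all
  then obtain MY where MY: "\<And>T. 0 \<le> T \<Longrightarrow> uniform_limit {0..T} (\<lambda>n. elem_integral (E n) M) MY sequentially"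
    by blast
  have "\<exists>Y. \<forall>T\<ge>0. uniform_limit {0..T} (\<lambda>n. elem_integral (E n) A) Y sequentially"
  proof (rule ex_uniform_limit_of_ennreal_power_le[OF _ c])
    fix m n :: nat and u T :: real assume u: "0 \<le> u" "u \<le> T"
    show "ennreal ((norm (elem_integral (E m) A u - elem_integral (E n) A u)) ^ 1) \<le> 2 * c m T + 2 * c n T"
      using elem_integral_fv_le_energy[OF FA FB D diff u, of m n] diff_le[of T m n]
      unfolding elem_integral_diff power_one_right by (rule order_trans)
  qed simp_all
  then obtain AY where AY: "\<And>T. 0 \<le> T \<Longrightarrow> uniform_limit {0..T} (\<lambda>n. elem_integral (E n) A) AY sequentially"
    by blast
  have MY_lim: "(\<lambda>n. elem_integral (E n) M u) \<longlonglongrightarrow> MY u" if "0 \<le> u" for u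
    by (rule tendsto_uniform_limitI[OF MY[OF that]]) (use that in simp)
  have AY_lim: "(\<lambda>n. elem_integral (E n) A u) \<longlonglongrightarrow> AY u" if "0 \<le> u" for u
    by (rule tendsto_uniform_limitI[OF AY[OF that]]) (use that in simp)
  have X_lim: "(\<lambda>n. elem_integral (E n) X u) \<longlonglongrightarrow> MY u + AY u" if "0 \<le> u" for u
    unfolding elem_integral_decomposition[OF E D that] by (rule tendsto_add[OF MY_lim[OF that] AY_lim[OF that]])
  have L: "L_tendsto FA X (\<lambda>n. elem_process (E n)) H" unfolding L_tendsto_iff[OF FA D] using lim by blast
  have Y_eq: "stoch_integral FA FB H X u = MY u + AY u" if "0 \<le> u" for u
    by (rule stoch_integral_eqI[OF FA FB D H that E L X_lim[OF that]])
  have zero: "MY 0 = 0" "AY 0 = 0"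
    using MY_lim[of 0] AY_lim[of 0] by (simp_all add: elem_integral_0[OF E] LIMSEQ_const_iff)

  have EH: "strongly_measurable (\<lambda>s. elem_process (E n) s - H s)" for n
    by (rule strongly_measurable_diff[OF strongly_measurable_elem_process[OF E] H])
  have tri: "norm (elem_process (E n) s) \<le> norm (H s) + norm (elem_process (E n) s - H s)" for n s
    using norm_triangle_ineq[of "H s" "elem_process (E n) s - H s"] by simp
  have c2: "(\<lambda>n. K + 2 * c n t) \<longlonglongrightarrow> K" if "0 \<le> t" for K t
  proof -
    have "2 < (top :: ennreal)" by simp
    from tendsto_add[OF tendsto_const[of K] ennreal_tendsto_cmult[OF this c[OF that]]] show ?thesis by simp
  qed
  have MY_bound: "ennreal ((norm (MY t - MY s))\<^sup>2) \<le> 2 * ?IM s t"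
    if st: "0 \<le> s" "s \<le> t" for s t
  proof (rule LIMSEQ_le)
    have t: "0 \<le> t" using st by simp
    show "(\<lambda>n. ennreal ((norm (elem_integral (E n) M t - elem_integral (E n) M s))\<^sup>2)) \<longlonglongrightarrow> ennreal ((norm (MY t - MY s))\<^sup>2)"
      by (intro tendsto_ennrealI tendsto_power tendsto_norm tendsto_diff MY_lim st t)
    show "(\<lambda>n. 2 * ?IM s t + 2 * c n t)
        \<longlonglongrightarrow> 2 * ?IM s t"
      by (rule c2[OF t])
    have "ennreal ((norm (elem_integral (E n) M t - elem_integral (E n) M s))\<^sup>2) \<le>
        2 * ?IM s t + 2 * c n t" for n
    proof -
      have "ennreal ((norm (elem_integral (E n) M t - elem_integral (E n) M s))\<^sup>2) \<le>
          (\<integral>\<^sup>+u\<in>{s<..t}. ennreal ((norm (elem_process (E n) u))\<^sup>2) \<partial>?\<mu>)"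
        by (rule elem_integral_mart_bound[OF FA FB E DM st])
      also have "\<dots> \<le> 2 * ?IM s t +
          2 * (\<integral>\<^sup>+u\<in>{s<..t}. ennreal ((norm (elem_process (E n) u - H u))\<^sup>2) \<partial>?\<mu>)"
        by (rule nn_integral_square_triangle[OF sets(1) _ H EH tri]) (use st in simp)
      also have "\<dots> \<le> 2 * ?IM s t + 2 * c n t"
        unfolding c_def by (intro add_mono order_refl mult_left_mono nn_integral_Ioc_le_energy(1) st) simp
      finally show ?thesis .
    qed
    then show "\<exists>N. \<forall>n\<ge>N. ennreal ((norm (elem_integral (E n) M t - elem_integral (E n) M s))\<^sup>2) \<le>
        2 * ?IM s t + 2 * c n t" by blast
  qed
  have dbl: "x \<le> 2 * x" for x :: ennreal unfolding mult_2 by (rule add_increasing2) simp_all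
  have AY_bound: "ennreal (norm (AY t - AY s)) \<le> 2 * ?IA s t"
    if st: "0 \<le> s" "s \<le> t" for s t
  proof (rule LIMSEQ_le)
    have t: "0 \<le> t" using st by simp
    show "(\<lambda>n. ennreal (norm (elem_integral (E n) A t - elem_integral (E n) A s))) \<longlonglongrightarrow> ennreal (norm (AY t - AY s))"
      by (intro tendsto_ennrealI tendsto_norm tendsto_diff AY_lim st t)
    show "(\<lambda>n. 2 * ?IA s t + 2 * c n t)
        \<longlonglongrightarrow> 2 * ?IA s t"
      by (rule c2[OF t])
    have "ennreal (norm (elem_integral (E n) A t - elem_integral (E n) A s)) \<le>
        2 * ?IA s t + 2 * c n t" for n
    proof -
      have "ennreal (norm (elem_integral (E n) A t - elem_integral (E n) A s)) \<le>
          (\<integral>\<^sup>+u\<in>{s<..t}. ennreal (norm (elem_process (E n) u)) \<partial>?\<alpha>)"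
        by (rule elem_integral_fv_bound[OF FA FB E DA(2,3) st])
      also have "\<dots> \<le> ?IA s t +
          (\<integral>\<^sup>+u\<in>{s<..t}. ennreal (norm (elem_process (E n) u - H u)) \<partial>?\<alpha>)"
        by (rule nn_integral_norm_triangle[OF sets(2) _ H EH tri]) (use st in simp)
      also have "\<dots> \<le> ?IA s t + c n t"
        unfolding c_def by (intro add_mono order_refl nn_integral_Ioc_le_energy(2) st)
      also have "\<dots> \<le> 2 * ?IA s t + 2 * c n t"
        by (intro add_mono dbl)
      finally show ?thesis .
    qed
    then show "\<exists>N. \<forall>n\<ge>N. ennreal (norm (elem_integral (E n) A t - elem_integral (E n) A s)) \<le>
        2 * ?IA s t + 2 * c n t" by blast
  qed
  have nH: "(\<lambda>u. ennreal (norm (H u))) \<in> borel_measurable borel_nonneg"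
    by (rule measurable_compose[OF strongly_measurable_norm[OF H] measurable_ennreal])
  have var: "variation AY s t \<le> 2 * ?IA s t" if st: "0 \<le> s" "s \<le> t" for s t
  proof (rule variation_le_of_increments[where g = "\<lambda>s t. 2 * ?IA s t"])
    fix u v assume "s \<le> u" "u \<le> v"
    then show "ennreal (norm (AY v - AY u)) \<le> 2 * ?IA u v"
      using st by (intro AY_bound) auto
  next
    fix u v w assume uvw: "s \<le> u" "u \<le> v" "v \<le> w"
    have "0 \<le> u" using uvw st by simp
    then show "2 * ?IA u v + 2 * ?IA v w
      \<le> 2 * ?IA u w"
      unfolding distrib_left[symmetric] nn_integral_Ioc_add[OF sets(2) nH \<open>0 \<le> u\<close> uvw(2,3)] by simp
  qed
  have MY_mart: "L2_martingale FB MY"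
    by (rule L2_martingale_limit[OF FB elem_integral_martingale[OF FA FB E DM(1)] MY_lim])
  have AY_adapted: "adapted FB AY"
    by (rule adapted_limit[OF elem_integral_adapted[OF FA FB E DA(1)] AY_lim])
  have cont: "continuous_on {0..} Y"
    if "\<And>T. 0 \<le> T \<Longrightarrow> uniform_limit {0..T} (\<lambda>n. elem_integral (E n) Z) Y sequentially"
      and "continuous_on {0..} Z" for Y Z
  proof (rule continuous_on_halfline)
    fix T :: real assume T: "0 \<le> T"
    have "continuous_on {0..T} (elem_integral (E n) Z)" for n
      by (rule continuous_on_subset[OF elem_integral_continuous[OF E that(2)]]) auto
    then show "continuous_on {0..T} Y"
      by (intro uniform_limit_theorem[OF _ that(1)[OF T]]) simp_all
  qed
  have "L2_decomposition FB (stoch_integral FA FB H X) MY AY"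
    unfolding L2_decomposition_def
  proof (intro conjI allI impI)
    have "adapted FB (\<lambda>t. MY t + AY t)"
      using MY_mart AY_adapted by (intro adapted_add[OF FB]) (simp_all add: L2_martingale_def)
    then show "adapted FB (stoch_integral FA FB H X)" unfolding adapted_def by (simp add: Y_eq)
    show "stoch_integral FA FB H X t = stoch_integral FA FB H X 0 + MY t + AY t" if "0 \<le> t" for t
      unfolding Y_eq[OF that] Y_eq[OF order_refl] zero by simp
    show "locally_bounded_variation AY"
      unfolding locally_bounded_variation_def
    proof (intro allI impI)
      fix s t :: real assume st: "0 \<le> s \<and> s \<le> t"
      have "variation AY s t \<le> 2 * ?IA s t" using st by (intro var) auto
      also have "\<dots> \<le> 2 * energy_of M A t H"
        using st by (intro mult_left_mono nn_integral_Ioc_le_energy(2)) auto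
      also have "\<dots> < \<infinity>" using fin[of t] st by (simp add: ennreal_mult_less_top)
      finally show "variation AY s t < \<infinity>" .
    qed
    show "L2_martingale FB MY" by (rule MY_mart)
    show "adapted FB AY" by (rule AY_adapted)
    show "continuous_on {0..} MY" by (rule cont[OF MY DM(2)])
    show "continuous_on {0..} AY" by (rule cont[OF AY DA(2)])
    show "MY 0 = 0" "AY 0 = 0" by (rule zero)+
  qed
  then show thesis
    using that MY_bound var X_lim Y_eq by simp
qed

text \<open>By the estimates on increments, \<open>\<kappa>\<close> of the integral is dominated: its two parts have densities
  at most \<open>2 \<parallel>H\<parallel>\<^sup>2\<close> and \<open>2 \<parallel>H\<parallel>\<close> with respect to the parts of \<open>\<kappa>\<^sub>X\<close>.\<close>

lemma energy_dominated:
  assumes \<mu>: "halfline_measure \<mu> g" and \<alpha>: "halfline_measure \<alpha> k"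
    and \<mu>': "halfline_measure \<mu>' g'" and \<alpha>': "halfline_measure \<alpha>' k'"
    and H: "strongly_measurable H" and G: "strongly_measurable G"
    and fin: "\<And>t. 0 \<le> t \<Longrightarrow> energy \<mu> \<alpha> t H < \<infinity>"
    and g': "\<And>s t. 0 \<le> s \<Longrightarrow> s \<le> t \<Longrightarrow> g' s t \<le> 2 * (\<integral>\<^sup>+u\<in>{s<..t}. ennreal ((norm (H u))\<^sup>2) \<partial>\<mu>)"
    and k': "\<And>s t. 0 \<le> s \<Longrightarrow> s \<le> t \<Longrightarrow> k' s t \<le> 2 * (\<integral>\<^sup>+u\<in>{s<..t}. ennreal (norm (H u)) \<partial>\<alpha>)"
  shows "energy \<mu>' \<alpha>' t G \<le> 2 * energy \<mu> \<alpha> t (\<lambda>s. norm (G s) * norm (H s))"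
proof -
  \<comment> \<open>both parts at once, with \<open>q\<close> the square for the martingale part and the identity for the other\<close>
  have core: "(\<integral>\<^sup>+s\<in>{0<..t}. ennreal (q (norm (G s))) \<partial>\<kappa>') \<le>
      2 * (\<integral>\<^sup>+s\<in>{0<..t}. ennreal (q (norm (norm (G s) * norm (H s)))) \<partial>\<kappa>)"
    if \<kappa>: "halfline_measure \<kappa> f" and \<kappa>': "halfline_measure \<kappa>' f'"
      and q: "q \<in> borel_measurable borel" "\<And>x y. 0 \<le> x \<Longrightarrow> 0 \<le> y \<Longrightarrow> q (x * y) = q x * q y" "\<And>x. 0 \<le> x \<Longrightarrow> 0 \<le> q x"
      and f': "\<And>s t. 0 \<le> s \<Longrightarrow> s \<le> t \<Longrightarrow> f' s t \<le> 2 * (\<integral>\<^sup>+u\<in>{s<..t}. ennreal (q (norm (H u))) \<partial>\<kappa>)"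
      and le: "\<And>t. 0 \<le> t \<Longrightarrow> (\<integral>\<^sup>+u\<in>{0<..t}. ennreal (q (norm (H u))) \<partial>\<kappa>) \<le> energy \<mu> \<alpha> t H"
    for \<kappa> \<kappa>' f f' and q :: "real \<Rightarrow> real"
  proof -
    have mq: "(\<lambda>u. ennreal (q (norm (L u)))) \<in> borel_measurable borel_nonneg"
      if "strongly_measurable L" for L :: "real \<Rightarrow> 'x::real_normed_vector"
      by (rule measurable_compose[OF measurable_compose[OF strongly_measurable_norm[OF that] q(1)] measurable_ennreal])
    have on: "(\<lambda>u. f u * indicator {s<..t} u) \<in> borel_measurable borel_nonneg"
      if "f \<in> borel_measurable borel_nonneg" "0 \<le> s" for f :: "real \<Rightarrow> ennreal" and s t
      using that by (intro borel_measurable_times_ennreal borel_measurable_indicator) simp_all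
    have pull: "(\<integral>\<^sup>+u. 2 * f u \<partial>\<kappa>) = 2 * (\<integral>\<^sup>+u. f u \<partial>\<kappa>)"
      if "f \<in> borel_measurable borel_nonneg" for f
      by (rule nn_integral_cmult[OF borel_measurable_halfline[OF halfline_measureD(1)[OF \<kappa>] that]])
    have pull': "(\<integral>\<^sup>+u\<in>{s<..t}. 2 * f u \<partial>\<kappa>) = 2 * (\<integral>\<^sup>+u\<in>{s<..t}. f u \<partial>\<kappa>)"
      if "f \<in> borel_measurable borel_nonneg" "0 \<le> s" for f s t
      unfolding mult.assoc by (rule pull[OF on[OF that]])
    have "(\<integral>\<^sup>+s. ennreal (q (norm (G s))) * indicator {0<..t} s \<partial>\<kappa>') \<le>
        (\<integral>\<^sup>+s. (2 * ennreal (q (norm (H s)))) * (ennreal (q (norm (G s))) * indicator {0<..t} s) \<partial>\<kappa>)"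
    proof (rule nn_integral_dominated[OF \<kappa>' \<kappa> _ on[OF mq[OF G] order_refl]])
      show "(\<lambda>s. 2 * ennreal (q (norm (H s)))) \<in> borel_measurable borel_nonneg"
        by (intro borel_measurable_times_ennreal borel_measurable_const mq H)
      show "(\<integral>\<^sup>+u\<in>{0<..t}. 2 * ennreal (q (norm (H u))) \<partial>\<kappa>) < \<infinity>" if t: "0 \<le> t" for t
        unfolding pull'[OF mq[OF H] order_refl] using le_less_trans[OF le[OF t] fin[OF t]]
        by (simp add: ennreal_mult_less_top)
      show "f' s t \<le> (\<integral>\<^sup>+u\<in>{s<..t}. 2 * ennreal (q (norm (H u))) \<partial>\<kappa>)" if "0 \<le> s" "s \<le> t" for s t
        unfolding pull'[OF mq[OF H] that(1)] by (rule f'[OF that])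
    qed
    also have "\<dots> = (\<integral>\<^sup>+s. 2 * (ennreal (q (norm (norm (G s) * norm (H s)))) * indicator {0<..t} s) \<partial>\<kappa>)"
      by (intro nn_integral_cong) (simp add: q(2,3) ennreal_mult ac_simps)
    also have "\<dots> = 2 * (\<integral>\<^sup>+s\<in>{0<..t}. ennreal (q (norm (norm (G s) * norm (H s)))) \<partial>\<kappa>)"
    proof (rule pull, rule on[OF mq order_refl])
      show "strongly_measurable (\<lambda>s. norm (G s) * norm (H s))"
        by (rule strongly_measurable_compose2[OF G H, of "\<lambda>x y. norm x * norm y"]) (intro tendsto_mult tendsto_norm)
    qed
    finally show ?thesis .
  qed
  have "energy \<mu>' \<alpha>' t G \<le> 2 * (\<integral>\<^sup>+s\<in>{0<..t}. ennreal ((norm (norm (G s) * norm (H s)))\<^sup>2) \<partial>\<mu>) +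
      2 * (\<integral>\<^sup>+s\<in>{0<..t}. ennreal (norm (norm (G s) * norm (H s))) \<partial>\<alpha>)"
    unfolding energy_def
  proof (rule add_mono)
    show "(\<integral>\<^sup>+s\<in>{0<..t}. ennreal ((norm (G s))\<^sup>2) \<partial>\<mu>') \<le> 2 * (\<integral>\<^sup>+s\<in>{0<..t}. ennreal ((norm (norm (G s) * norm (H s)))\<^sup>2) \<partial>\<mu>)"
      by (rule core[OF \<mu> \<mu>', where q = "\<lambda>x. x\<^sup>2"])
        (use g' nn_integral_Ioc_le_energy(1)[OF order_refl] in \<open>simp_all add: power_mult_distrib\<close>)
    show "(\<integral>\<^sup>+s\<in>{0<..t}. ennreal (norm (G s)) \<partial>\<alpha>') \<le> 2 * (\<integral>\<^sup>+s\<in>{0<..t}. ennreal (norm (norm (G s) * norm (H s))) \<partial>\<alpha>)"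
      by (rule core[OF \<alpha> \<alpha>', where q = "\<lambda>x. x"])
        (use k' nn_integral_Ioc_le_energy(2)[OF order_refl] in \<open>simp_all\<close>)
  qed
  then show ?thesis by (simp add: energy_def distrib_left)
qed

section \<open>Associativity of the stochastic integral\<close>

text \<open>The indices are chosen such that the error at time \<open>n\<close> is at most \<open>1 / (n + 1)\<close>; by monotonicity this
  controls the error at every fixed time.\<close>

lemma ex_diagonal_index:
  fixes e :: "nat \<Rightarrow> nat \<Rightarrow> real \<Rightarrow> ennreal" and z :: "nat \<Rightarrow> nat \<Rightarrow> 'v::real_normed_vector"
  assumes e: "\<And>n t. 0 \<le> t \<Longrightarrow> (\<lambda>m. e n m t) \<longlonglongrightarrow> 0"
    and mono: "\<And>n m s t. s \<le> t \<Longrightarrow> e n m s \<le> e n m t"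
    and z: "\<And>n. z n \<longlonglongrightarrow> l n"
  obtains m where "\<And>t. 0 \<le> t \<Longrightarrow> (\<lambda>n. e n (m n) t) \<longlonglongrightarrow> 0" "(\<lambda>n. z n (m n) - l n) \<longlonglongrightarrow> 0"
proof -
  have "\<exists>m. e n m (real n) < ennreal (inverse (real (Suc n))) \<and> norm (z n m - l n) < inverse (real (Suc n))" for n
  proof -
    have pos: "0 < inverse (real (Suc n))" by simp
    have "\<forall>\<^sub>F m in sequentially. e n m (real n) < ennreal (inverse (real (Suc n)))"
    proof -
      have "(\<lambda>m. e n m (real n)) \<longlonglongrightarrow> 0" by (rule e) simp
      from this[unfolded ennreal_tendsto_0_iff, rule_format, OF pos] show ?thesis .
    qed
    moreover have "\<forall>\<^sub>F m in sequentially. norm (z n m - l n) < inverse (real (Suc n))"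
      using tendstoD[OF z pos, of n] by (simp add: dist_norm)
    ultimately have "\<forall>\<^sub>F m in sequentially. e n m (real n) < ennreal (inverse (real (Suc n))) \<and>
        norm (z n m - l n) < inverse (real (Suc n))"
      by (rule eventually_conj)
    then show ?thesis using eventually_happens trivial_limit_sequentially by blast
  qed
  then obtain m where m: "\<And>n. e n (m n) (real n) < ennreal (inverse (real (Suc n)))"
    "\<And>n. norm (z n (m n) - l n) < inverse (real (Suc n))" by metis
  have "(\<lambda>n. ennreal (inverse (real (Suc n)))) \<longlonglongrightarrow> ennreal 0"
    by (intro tendsto_ennrealI LIMSEQ_inverse_real_of_nat)
  then have inv: "(\<lambda>n. ennreal (inverse (real (Suc n)))) \<longlonglongrightarrow> 0" by simp
  show thesis
  proof (rule that)
    fix t :: real assume t: "0 \<le> t"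
    obtain N :: nat where N: "t \<le> real N" using real_arch_simple by blast
    have "\<forall>\<^sub>F n in sequentially. e n (m n) t \<le> ennreal (inverse (real (Suc n)))"
      unfolding eventually_sequentially
    proof (intro exI allI impI)
      fix n assume "N \<le> n"
      then have "t \<le> real n" using N by linarith
      from mono[OF this] show "e n (m n) t \<le> ennreal (inverse (real (Suc n)))"
        using m(1)[of n] by (meson less_imp_le order_trans)
    qed
    then show "(\<lambda>n. e n (m n) t) \<longlonglongrightarrow> 0"
      by (intro tendsto_sandwich[OF _ _ tendsto_const inv]) simp_all
  next
    have "(\<lambda>n. norm (z n (m n) - l n)) \<longlonglongrightarrow> 0"
      by (rule tendsto_sandwich[OF _ _ tendsto_const LIMSEQ_inverse_real_of_nat])
        (use m(2) in \<open>auto intro!: always_eventually less_imp_le simp del: of_nat_Suc\<close>)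
    then show "(\<lambda>n. z n (m n) - l n) \<longlonglongrightarrow> 0" by (rule tendsto_norm_zero_cancel)
  qed
qed

text \<open>The product of two elementary processes is close to \<open>K H\<close> in \<open>\<L>\<^sub>X\<close>, by
  \<open>K\<^sub>n H\<^sub>m - K H = K\<^sub>n (H\<^sub>m - H) + (K\<^sub>n - K) H\<close>.\<close>

lemma energy_elem_compose_le:
  fixes K :: "real \<Rightarrow> 'b::cstar_prob_space L2 \<Rightarrow>\<^sub>L 'c::cstar_prob_space L2"
    and H :: "real \<Rightarrow> 'a::cstar_prob_space L2 \<Rightarrow>\<^sub>L 'b L2"
  assumes \<mu>: "sets \<mu> = sets borel_nonneg" and \<alpha>: "sets \<alpha> = sets borel_nonneg"
    and F: "F \<in> elem_data FB FC" and E: "E \<in> elem_data FA FB"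
    and H: "strongly_measurable H" and K: "strongly_measurable K"
  shows "energy \<mu> \<alpha> t (\<lambda>s. elem_process (elem_compose F E) s - (K s o\<^sub>L H s)) \<le>
    2 * energy \<mu> \<alpha> t (\<lambda>s. elem_process F s o\<^sub>L (elem_process E s - H s)) +
    2 * energy \<mu> \<alpha> t (\<lambda>s. norm (elem_process F s - K s) * norm (H s))"
proof (rule energy_triangle[OF \<mu> \<alpha>])
  note Fm = strongly_measurable_elem_process[OF F] and Em = strongly_measurable_elem_process[OF E]
  show "strongly_measurable (\<lambda>s. elem_process F s o\<^sub>L (elem_process E s - H s))"
    by (intro strongly_measurable_compose_blinfun strongly_measurable_diff Fm Em H)
  show "strongly_measurable (\<lambda>s. norm (elem_process F s - K s) * norm (H s))"
    by (rule strongly_measurable_compose2[OF strongly_measurable_diff[OF Fm K] H, of "\<lambda>x y. norm x * norm y"])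
      (intro tendsto_mult tendsto_norm)
  fix s :: real assume "0 < s"
  then have "elem_process (elem_compose F E) s - (K s o\<^sub>L H s)
      = (elem_process F s o\<^sub>L (elem_process E s - H s)) + ((elem_process F s - K s) o\<^sub>L H s)"
    by (simp add: elem_process_compose[OF F E] bounded_bilinear.diff_left[OF bounded_bilinear_blinfun_compose]
        bounded_bilinear.diff_right[OF bounded_bilinear_blinfun_compose])
  then have "norm (elem_process (elem_compose F E) s - (K s o\<^sub>L H s))
      \<le> norm (elem_process F s o\<^sub>L (elem_process E s - H s)) + norm ((elem_process F s - K s) o\<^sub>L H s)"
    by (simp only: norm_triangle_ineq)
  also have "norm ((elem_process F s - K s) o\<^sub>L H s) \<le> norm (elem_process F s - K s) * norm (H s)"
    by (rule norm_blinfun_compose)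
  finally show "norm (elem_process (elem_compose F E) s - (K s o\<^sub>L H s))
      \<le> norm (elem_process F s o\<^sub>L (elem_process E s - H s)) + norm (norm (elem_process F s - K s) * norm (H s))"
    by simp
qed

theorem theorem4p23:
  fixes FA :: "real \<Rightarrow> 'a::cstar_prob_space set"
    and FB :: "real \<Rightarrow> 'b::cstar_prob_space set"
    and FC :: "real \<Rightarrow> 'c::cstar_prob_space set"
    and X M A :: "real \<Rightarrow> 'a L2"
    and H :: "real \<Rightarrow> 'a L2 \<Rightarrow>\<^sub>L 'b L2"
    and K :: "real \<Rightarrow> 'b L2 \<Rightarrow>\<^sub>L 'c L2"
  assumes "filtration FA" and "filtration FB" and "filtration FC"
    and "L2_decomposition FA X M A"
    and "H \<in> stoch_integrable FA FB X"
    and "strongly_measurable K"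
    and "\<exists>Kn. (\<forall>n::nat. Kn n \<in> EP22 FB FC) \<and>
      (\<forall>t\<ge>0. (\<lambda>n.
          (\<integral>\<^sup>+ s\<in>{0<..t}. ennreal ((norm (Kn n s - K s))\<^sup>2 * (norm (H s))\<^sup>2) \<partial>kappa_mart M) +
          (\<integral>\<^sup>+ s\<in>{0<..t}. ennreal (norm (Kn n s - K s) * norm (H s)) \<partial>kappa_fv A))
        \<longlonglongrightarrow> 0)"
  shows "K \<in> stoch_integrable FB FC (stoch_integral FA FB H X)
    \<and> (\<lambda>s. K s o\<^sub>L H s) \<in> stoch_integrable FA FC X
    \<and> (\<forall>t\<ge>0. stoch_integral FB FC K (stoch_integral FA FB H X) t
        = stoch_integral FA FC (\<lambda>s. K s o\<^sub>L H s) X t)"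
proof -
  note FA = assms(1) and FB = assms(2) and FC = assms(3) and D = assms(4) and K = assms(6)
  let ?\<mu> = "kappa_mart M" and ?\<alpha> = "kappa_fv A" and ?Y = "stoch_integral FA FB H X"
  let ?KH = "\<lambda>s. K s o\<^sub>L H s"
  note sets = sets_kappa[OF FA D]
  have H: "strongly_measurable H"
    using assms(5) unfolding stoch_integrable_def L_space_def by blast
  obtain Hn where Hn: "\<And>n. Hn n \<in> EP22 FA FB" "L_tendsto FA X Hn H"
    using assms(5) unfolding stoch_integrable_def by blast
  from Hn(1) have "\<exists>E. E \<in> elem_data FA FB \<and> Hn n = elem_process E" for n
    unfolding EP22_def by blast
  then obtain E where E: "\<And>n. E n \<in> elem_data FA FB" and Hn_eq: "\<And>n. Hn n = elem_process (E n)" by metis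
  have H_lim: "(\<lambda>n. energy_of M A t (\<lambda>s. elem_process (E n) s - H s)) \<longlonglongrightarrow> 0" if "0 \<le> t" for t
    using Hn(2) that unfolding L_tendsto_iff[OF FA D] Hn_eq by blast
  obtain Kn where Kn: "\<And>n. Kn n \<in> EP22 FB FC"
    "\<And>t. 0 \<le> t \<Longrightarrow> (\<lambda>n. (\<integral>\<^sup>+ s\<in>{0<..t}. ennreal ((norm (Kn n s - K s))\<^sup>2 * (norm (H s))\<^sup>2) \<partial>?\<mu>) +
      (\<integral>\<^sup>+ s\<in>{0<..t}. ennreal (norm (Kn n s - K s) * norm (H s)) \<partial>?\<alpha>)) \<longlonglongrightarrow> 0"
    using assms(7) by blast
  from Kn(1) have "\<exists>F. F \<in> elem_data FB FC \<and> Kn n = elem_process F" for n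
    unfolding EP22_def by blast
  then obtain F where F: "\<And>n. F n \<in> elem_data FB FC" and Kn_eq: "\<And>n. Kn n = elem_process (F n)" by metis
  define c where "c n t = energy_of M A t (\<lambda>s. norm (elem_process (F n) s - K s) * norm (H s))" for n t
  have c: "(\<lambda>n. c n t) \<longlonglongrightarrow> 0" if "0 \<le> t" for t
    using Kn(2)[OF that] by (simp add: c_def energy_def Kn_eq power_mult_distrib)

  obtain MY AY where DY: "L2_decomposition FB ?Y MY AY"
    and Y_lim: "\<And>t. 0 \<le> t \<Longrightarrow> (\<lambda>n. elem_integral (E n) X t) \<longlonglongrightarrow> ?Y t"
    and MY: "\<And>s t. 0 \<le> s \<Longrightarrow> s \<le> t \<Longrightarrow> ennreal ((norm (MY t - MY s))\<^sup>2) \<le>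
      2 * (\<integral>\<^sup>+u\<in>{s<..t}. ennreal ((norm (H u))\<^sup>2) \<partial>?\<mu>)"
    and AY: "\<And>s t. 0 \<le> s \<Longrightarrow> s \<le> t \<Longrightarrow> variation AY s t \<le>
      2 * (\<integral>\<^sup>+u\<in>{s<..t}. ennreal (norm (H u)) \<partial>?\<alpha>)"
    by (rule ex_stoch_integral_decomposition[OF FA FB D H E H_lim])
      (assumption, rule that, assumption, blast+)

  \<comment> \<open>\<open>K\<^sub>n\<close> converges to \<open>K\<close> in \<open>\<L>\<^sub>Y\<close>, as \<open>\<kappa>\<^sub>Y\<close> is dominated\<close>
  have K_lim: "(\<lambda>n. energy_of MY AY t (\<lambda>s. elem_process (F n) s - K s)) \<longlonglongrightarrow> 0"
    if t: "0 \<le> t" for t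
  proof (rule tendsto_sandwich[OF _ _ tendsto_const])
    have "2 < (top :: ennreal)" by simp
    from ennreal_tendsto_cmult[OF this c[OF t]] show "(\<lambda>n. 2 * c n t) \<longlonglongrightarrow> 0" by simp
    have "energy_of MY AY t (\<lambda>s. elem_process (F n) s - K s) \<le> 2 * c n t" for n
      unfolding c_def
      by (rule energy_dominated[OF halfline_measure_decomposition_mart[OF FA D]
            halfline_measure_decomposition_fv[OF FA D] halfline_measure_decomposition_mart[OF FB DY]
            halfline_measure_decomposition_fv[OF FB DY] H
            strongly_measurable_diff[OF strongly_measurable_elem_process[OF F] K]
            energy_finite_of_approx[OF FA D H E _ H_lim] MY AY])
    then show "\<forall>\<^sub>F n in sequentially.
        energy_of MY AY t (\<lambda>s. elem_process (F n) s - K s) \<le> 2 * c n t"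
      by (rule always_eventually[OF allI])
  qed simp
  have K_int: "K \<in> stoch_integrable FB FC ?Y"
    by (rule stoch_integrableI[OF FB FC DY K F K_lim])
  have KY_lim: "(\<lambda>n. elem_integral (F n) ?Y t) \<longlonglongrightarrow> stoch_integral FB FC K ?Y t" if t: "0 \<le> t" for t
    by (rule ex_stoch_integral_decomposition[OF FB FC DY K F K_lim]) (assumption, use t in blast)

  \<comment> \<open>for each \<open>n\<close>, \<open>K\<^sub>n H\<^sub>m\<close> converges to \<open>K\<^sub>n H\<close> because \<open>K\<^sub>n\<close> is bounded\<close>
  define e where "e n m t = energy_of M A t (\<lambda>s. elem_process (F n) s o\<^sub>L (elem_process (E m) s - H s))" for n m t
  have e: "(\<lambda>m. e n m t) \<longlonglongrightarrow> 0" if t: "0 \<le> t" for n t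
  proof -
    obtain C where C: "1 \<le> C" "\<And>u. 0 \<le> u \<Longrightarrow> norm (elem_process (F n) u) \<le> C"
      using elem_process_bounded[OF F] by blast
    have le: "e n m t \<le> ennreal (C\<^sup>2) * energy_of M A t (\<lambda>s. elem_process (E m) s - H s)" for m
      unfolding e_def
    proof (rule energy_scale[OF sets strongly_measurable_diff[OF strongly_measurable_elem_process[OF E] H] C(1)])
      fix s :: real assume "0 < s"
      then show "norm (elem_process (F n) s o\<^sub>L (elem_process (E m) s - H s)) \<le> C * norm (elem_process (E m) s - H s)"
        using C(2)[of s] by (intro order_trans[OF norm_blinfun_compose] mult_right_mono) auto
    qed
    have "(\<lambda>m. ennreal (C\<^sup>2) * energy_of M A t (\<lambda>s. elem_process (E m) s - H s)) \<longlonglongrightarrow> ennreal (C\<^sup>2) * 0"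
      by (intro ennreal_tendsto_cmult H_lim[OF t]) simp
    then have "(\<lambda>m. ennreal (C\<^sup>2) * energy_of M A t (\<lambda>s. elem_process (E m) s - H s)) \<longlonglongrightarrow> 0" by simp
    from tendsto_sandwich[OF _ _ tendsto_const this] le show ?thesis by simp
  qed
  have e_mono: "e n m s \<le> e n m t" if "s \<le> t" for n m s t
    unfolding e_def by (rule energy_mono_time[OF that])

  have KH: "strongly_measurable ?KH" by (rule strongly_measurable_compose_blinfun[OF K H])
  have main: "?KH \<in> stoch_integrable FA FC X \<and> stoch_integral FB FC K ?Y t = stoch_integral FA FC ?KH X t"
    if t: "0 \<le> t" for t
  proof -
    obtain m where m: "\<And>t. 0 \<le> t \<Longrightarrow> (\<lambda>n. e n (m n) t) \<longlonglongrightarrow> 0"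
      and d: "(\<lambda>n. elem_integral (F n) (elem_integral (E (m n)) X) t - elem_integral (F n) ?Y t) \<longlonglongrightarrow> 0"
    proof (rule ex_diagonal_index[of e "\<lambda>n m. elem_integral (F n) (elem_integral (E m) X) t"
          "\<lambda>n. elem_integral (F n) ?Y t"])
      show "(\<lambda>m. e n m t) \<longlonglongrightarrow> 0" if "0 \<le> t" for n t by (rule e[OF that])
      show "e n m s \<le> e n m t" if "s \<le> t" for n m s t by (rule e_mono[OF that])
      show "(\<lambda>m. elem_integral (F n) (elem_integral (E m) X) t) \<longlonglongrightarrow> elem_integral (F n) ?Y t" for n
        by (rule elem_integral_tendsto[OF F t Y_lim])
      fix m assume m: "\<And>t. 0 \<le> t \<Longrightarrow> (\<lambda>n. e n (m n) t) \<longlonglongrightarrow> 0"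
        and d: "(\<lambda>n. elem_integral (F n) (elem_integral (E (m n)) X) t - elem_integral (F n) ?Y t) \<longlonglongrightarrow> 0"
      show thesis by (rule that[OF m d])
    qed
    from tendsto_add[OF d KY_lim[OF t]]
    have val: "(\<lambda>n. elem_integral (elem_compose (F n) (E (m n))) X t) \<longlonglongrightarrow> stoch_integral FB FC K ?Y t"
      by (simp add: elem_integral_compose[OF F E])
    note G = elem_data_compose[OF F E]
    have lim: "(\<lambda>n. energy_of M A u (\<lambda>s. elem_process (elem_compose (F n) (E (m n))) s - ?KH s)) \<longlonglongrightarrow> 0"
      if u: "0 \<le> u" for u
    proof (rule tendsto_sandwich[OF _ _ tendsto_const tendsto_2_add_2[OF m[OF u] c[OF u]]])
      show "\<forall>\<^sub>F n in sequentially. energy_of M A u (\<lambda>s. elem_process (elem_compose (F n) (E (m n))) s - ?KH s)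
          \<le> 2 * e n (m n) u + 2 * c n u"
        unfolding e_def c_def
        by (rule always_eventually[OF allI], rule energy_elem_compose_le[OF sets F E H K])
    qed simp
    have "?KH \<in> stoch_integrable FA FC X"
      by (rule stoch_integrableI[OF FA FC D KH G lim])
    moreover have "L_tendsto FA X (\<lambda>n. elem_process (elem_compose (F n) (E (m n)))) ?KH"
      unfolding L_tendsto_iff[OF FA D] using lim by blast
    then have "stoch_integral FA FC ?KH X t = stoch_integral FB FC K ?Y t"
      by (rule stoch_integral_eqI[OF FA FC D KH t G _ val])
    ultimately show ?thesis by simp
  qed
  show ?thesis using K_int main main[OF order_refl] by simp
qed

end
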